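(* Let $(\mathrm X,\mathsf d_{\mathrm X},\mathfrak m_{\mathrm X})$ and $(\mathrm Y,\mathsf d_{\mathrm Y},\mathfrak m_{\mathrm Y})$ be metric measure spaces. Let $f\colon\mathrm X\to\mathrm Y$ be a Borel map with $f_*\mathfrak m_{\mathrm X}\ll\mathfrak m_{\mathrm Y}$. Let $(I,\leq)$ be a directed partially ordered set and let $\big(\{\mathscr M_i\}_{i\in I},\{\varphi_{ij}\}_{i\leq j}\big)$ be a direct system over $I$ of normed $L^0(\mathfrak m_{\mathrm Y})$-modules, with direct limit $\big(\varinjlim\mathscr M_\star,\{\varphi_i\}_{i\in I}\big)$. Then $\big(\{f^*\mathscr M_i\}_{i\in I},\{f^*\varphi_{ij}\}_{i\leq j}\big)$ is a direct system of normed $L^0(\mathfrak m_{\mathrm X})$-modules, and its direct limit is $$\varinjlim f^*\mathscr M_\star\cong f^*\varinjlim\mathscr M_\star$$ together with the canonical morphisms $\{f^*\varphi_i\}_{i\in I}$.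
   Context: A metric measure space $(\mathrm X,\mathsf d,\mathfrak m)$ is a complete separable metric space $(\mathrm X,\mathsf d)$ with a Radon measure $\mathfrak m\geq 0$. $L^0(\mathfrak m)$ is the commutative ring of Borel functions $f\colon\mathrm X\to\mathbb R$ up to $\mathfrak m$-a.e. equality, with distance $\mathsf d_{L^0(\mathfrak m)}(f,g)=\int|f-g|\wedge 1\,\mathrm d\mathfrak m'$, where $\mathfrak m'$ is any Borel probability measure with $\mathfrak m\ll\mathfrak m'\ll\mathfrak m$. A pointwise norm on an $L^0(\mathfrak m)$-module $\mathscr M$ is a map $|\cdot|\colon\mathscr M\to L^0(\mathfrak m)$ such that, $\mathfrak m$-a.e., $|v|\geq 0$, $|v+w|\leq|v|+|w|$, $|f\cdot v|=|f||v|$ for all $v,w\in\mathscr M$, $f\in L^0(\mathfrak m)$, and $|v|=0$ $\mathfrak m$-a.e. if and only if $v=0$. A normed $L^0(\mathfrak m)$-module is an $L^0(\mathfrak m)$-module $\mathscr M$ with a pointwise norm such that the distance $\mathsf d_{\mathscr M}(v,w)=\int|v-w|\wedge 1\,\mathrm d\mathfrak m'$ is complete. A morphism $\varphi\colon\mathscr M\to\mathscr N$ of normed $L^0(\mathfrak m)$-modules is an $L^0(\mathfrak m)$-linear map with $|\varphi(v)|\leq|v|$ $\mathfrak m$-a.e. for every $v\in\mathscr M$. This defines the category of normed $L^0(\mathfrak m)$-modules; $\cong$ denotes isomorphism in it. A subset $S\subseteq\mathscr M$ generates $\mathscr M$ if the set of finite sums $\sum_{i=1}^n f_i\cdot v_i$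 ($f_i\in L^0(\mathfrak m)$, $v_i\in S$) is $\mathsf d_{\mathscr M}$-dense in $\mathscr M$. Pullback: for $f\colon\mathrm X\to\mathrm Y$ Borel with $f_*\mathfrak m_{\mathrm X}\ll\mathfrak m_{\mathrm Y}$ and a normed $L^0(\mathfrak m_{\mathrm Y})$-module $\mathscr M$, the pullback is the couple $(f^*\mathscr M,f^* )$, known to exist and to be unique up to unique isomorphism, where $f^*\mathscr M$ is a normed $L^0(\mathfrak m_{\mathrm X})$-module and $f^*\colon\mathscr M\to f^*\mathscr M$ is a linear map such that $|f^*v|=|v|\circ f$ $\mathfrak m_{\mathrm X}$-a.e. for every $v\in\mathscr M$ and $\{f^*v:v\in\mathscr M\}$ generates $f^*\mathscr M$. For a morphism $\varphi\colon\mathscr M\to\mathscr N$ of normed $L^0(\mathfrak m_{\mathrm Y})$-modules, $f^*\varphi\colon f^*\mathscr M\to f^*\mathscr N$ is the (known to exist) unique morphism of normed $L^0(\mathfrak m_{\mathrm X})$-modules with $(f^*\varphi)(f^*v)=f^*(\varphi(v))$ for every $v\in\mathscr M$. A directed partially ordered set is a nonempty partially ordered set in which any two elements have an upper bound. A direct system over $I$ consists of objects $\{\mathscr M_i\}_{i\in I}$ and morphisms $\varphi_{ij}\colon\mathscr M_i\to\mathscr M_j$ for $i\leq j$ with $\varphi_{ii}=\mathrm{id}$ and $\varphi_{ik}=\varphi_{jk}\circ\varphi_{ij}$ for $i\leq j\leq k$. A target of it is a couple $(\mathscr N,\{\psi_i\}_{i\in I})$ of an object $\mathscr N$ and morphisms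 $\psi_i\colon\mathscr M_i\to\mathscr N$ with $\psi_j\circ\varphi_{ij}=\psi_i$ for all $i\leq j$. The direct limit $\big(\varinjlim\mathscr M_\star,\{\varphi_i\}_{i\in I}\big)$ is a target such that for every target $(\mathscr N,\{\psi_i\}_{i\in I})$ there is a unique morphism $\Phi\colon\varinjlim\mathscr M_\star\to\mathscr N$ with $\Phi\circ\varphi_i=\psi_i$ for every $i\in I$; the $\varphi_i$ are called canonical morphisms. Direct limits exist in the category of normed $L^0(\mathfrak m)$-modules. *)

theory Defs
  imports "HOL-Probability.Probability_Measure" "HOL-Algebra.Module"
begin

section \<open>Metric measure spaces\<close>

text \<open>The complete separable metric space is a type of class \<open>polish_space\<close> (in the library this
  class fixes a complete metric).\<close>

definition radon_measure :: "'a::topological_space measure \<Rightarrow> bool" where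
  "radon_measure m \<longleftrightarrow>
     sets m = sets borel \<and>
     (\<forall>x. \<exists>U. open U \<and> x \<in> U \<and> emeasure m U < \<infinity>) \<and>
     (\<forall>A\<in>sets borel. emeasure m A = (SUP K\<in>{K. compact K \<and> K \<subseteq> A}. emeasure m K))"

definition equivalent_prob :: "'a measure \<Rightarrow> 'a measure \<Rightarrow> bool" where
  "equivalent_prob m m' \<longleftrightarrow>
     prob_space m' \<and> sets m' = sets m \<and> absolutely_continuous m m' \<and> absolutely_continuous m' m"

section \<open>The ring \<open>L\<^sup>0(m)\<close>\<close>

definition L0_class :: "'a measure \<Rightarrow> ('a \<Rightarrow> real) \<Rightarrow> ('a \<Rightarrow> real) set" where
  "L0_class m f = {g \<in> borel_measurable m. AE x in m. g x = f x}"

definition L0_rep :: "('a \<Rightarrow> real) set \<Rightarrow> 'a \<Rightarrow> real" where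
  "L0_rep A = (SOME f. f \<in> A)"

definition L0 :: "'a measure \<Rightarrow> ('a \<Rightarrow> real) set ring" where
  "L0 m = \<lparr>carrier = L0_class m ` borel_measurable m,
           mult = (\<lambda>A B. L0_class m (\<lambda>x. L0_rep A x * L0_rep B x)),
           one = L0_class m (\<lambda>_. 1),
           zero = L0_class m (\<lambda>_. 0),
           add = (\<lambda>A B. L0_class m (\<lambda>x. L0_rep A x + L0_rep B x))\<rparr>"

section \<open>Normed modules\<close>

text \<open>The fields \<open>mult\<close> and \<open>one\<close> that \<open>module\<close> inherits from \<open>ring\<close> play no role.\<close>

record ('a, 'b) nmodule = "('a, 'b) module" +
  pnorm :: "'b \<Rightarrow> 'a"

type_synonym ('x, 'b) L0_nmodule = "(('x \<Rightarrow> real) set, 'b) nmodule"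

text \<open>A representative of the class \<open>|v|\<close>. It is only used below in statements that hold almost
  everywhere and in integrals, which do not depend on its choice.\<close>

definition pn :: "('x, 'b) L0_nmodule \<Rightarrow> 'b \<Rightarrow> 'x \<Rightarrow> real" where
  "pn M v = L0_rep (pnorm M v)"

definition pointwise_norm :: "'x measure \<Rightarrow> ('x, 'b) L0_nmodule \<Rightarrow> bool" where
  "pointwise_norm m M \<longleftrightarrow>
     pnorm M \<in> carrier M \<rightarrow> carrier (L0 m) \<and>
     (\<forall>v\<in>carrier M. AE x in m. 0 \<le> pn M v x) \<and>
     (\<forall>v\<in>carrier M. \<forall>w\<in>carrier M. AE x in m. pn M (v \<oplus>\<^bsub>M\<^esub> w) x \<le> pn M v x + pn M w x) \<and>
     (\<forall>a\<in>carrier (L0 m). \<forall>v\<in>carrier M. AE x in m. pn M (a \<odot>\<^bsub>M\<^esub> v) x = \<bar>L0_rep a x\<bar> * pn M v x) \<and>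
     (\<forall>v\<in>carrier M. (AE x in m. pn M v x = 0) \<longleftrightarrow> v = \<zero>\<^bsub>M\<^esub>)"

text \<open>Outside of the carrier the distance is set to 0, because the locale \<open>Metric_space\<close> asks for
  nonnegativity and symmetry on the whole type.\<close>

definition nm_dist :: "'x measure \<Rightarrow> ('x, 'b) L0_nmodule \<Rightarrow> 'b \<Rightarrow> 'b \<Rightarrow> real" where
  "nm_dist m' M v w =
     (if v \<in> carrier M \<and> w \<in> carrier M then \<integral>x. min (pn M (v \<ominus>\<^bsub>M\<^esub> w) x) 1 \<partial>m' else 0)"

text \<open>Completeness and density do not depend on the probability measure \<open>m'\<close>. If \<open>m = 0\<close> there is no
  such \<open>m'\<close>, but then \<open>L0 m\<close> is the zero ring, so that every module over it is \<open>{0}\<close> and both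
  properties hold trivially.\<close>

definition normed_module :: "'x measure \<Rightarrow> ('x, 'b) L0_nmodule \<Rightarrow> bool" where
  "normed_module m M \<longleftrightarrow>
     module (L0 m) M \<and> pointwise_norm m M \<and>
     (\<forall>m'. equivalent_prob m m' \<longrightarrow> Metric_space.mcomplete (carrier M) (nm_dist m' M))"

definition L0_span :: "'x measure \<Rightarrow> ('x, 'b) L0_nmodule \<Rightarrow> 'b set \<Rightarrow> 'b set" where
  "L0_span m M S =
     {(\<Oplus>\<^bsub>M\<^esub>i\<in>{..<n}. a i \<odot>\<^bsub>M\<^esub> v i) | (n::nat) a v. a \<in> {..<n} \<rightarrow> carrier (L0 m) \<and> v \<in> {..<n} \<rightarrow> S}"

definition generates :: "'x measure \<Rightarrow> ('x, 'b) L0_nmodule \<Rightarrow> 'b set \<Rightarrow> bool" where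
  "generates m M S \<longleftrightarrow>
     S \<subseteq> carrier M \<and>
     (\<forall>m'. equivalent_prob m m' \<longrightarrow>
       Metric_space.mtopology (carrier M) (nm_dist m' M) closure_of L0_span m M S = carrier M)"

text \<open>Morphisms are extensional functions, so that equality of morphisms is equality of functions.\<close>

definition nm_mor :: "'x measure \<Rightarrow> ('x, 'b) L0_nmodule \<Rightarrow> ('x, 'c) L0_nmodule \<Rightarrow> ('b \<Rightarrow> 'c) set" where
  "nm_mor m M N =
     {\<phi> \<in> carrier M \<rightarrow>\<^sub>E carrier N.
        (\<forall>v\<in>carrier M. \<forall>w\<in>carrier M. \<phi> (v \<oplus>\<^bsub>M\<^esub> w) = \<phi> v \<oplus>\<^bsub>N\<^esub> \<phi> w) \<and>
        (\<forall>a\<in>carrier (L0 m). \<forall>v\<in>carrier M. \<phi> (a \<odot>\<^bsub>M\<^esub> v) = a \<odot>\<^bsub>N\<^esub> \<phi> v) \<and>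
        (\<forall>v\<in>carrier M. AE x in m. pn N (\<phi> v) x \<le> pn M v x)}"

definition nm_iso :: "'x measure \<Rightarrow> ('x, 'b) L0_nmodule \<Rightarrow> ('x, 'c) L0_nmodule \<Rightarrow> ('b \<Rightarrow> 'c) set" where
  "nm_iso m M N =
     {\<phi> \<in> nm_mor m M N. \<exists>\<psi>\<in>nm_mor m N M.
        (\<forall>v\<in>carrier M. \<psi> (\<phi> v) = v) \<and> (\<forall>w\<in>carrier N. \<phi> (\<psi> w) = w)}"

section \<open>Pullbacks\<close>

text \<open>The couple \<open>(P, p)\<close> is a pullback \<open>(f\<^sup>*M, f\<^sup>*)\<close>. Since \<open>M\<close> and \<open>P\<close> are modules over different
  rings, linearity of \<open>p\<close> is linearity over the reals, which act as the classes of constant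
  functions.\<close>

definition is_pullback ::
  "'x measure \<Rightarrow> 'y measure \<Rightarrow> ('x \<Rightarrow> 'y) \<Rightarrow> ('y, 'm) L0_nmodule \<Rightarrow>
   ('x, 'p) L0_nmodule \<Rightarrow> ('m \<Rightarrow> 'p) \<Rightarrow> bool" where
  "is_pullback mX mY f M P p \<longleftrightarrow>
     normed_module mX P \<and>
     p \<in> carrier M \<rightarrow> carrier P \<and>
     (\<forall>v\<in>carrier M. \<forall>w\<in>carrier M. p (v \<oplus>\<^bsub>M\<^esub> w) = p v \<oplus>\<^bsub>P\<^esub> p w) \<and>
     (\<forall>c. \<forall>v\<in>carrier M. p (L0_class mY (\<lambda>_. c) \<odot>\<^bsub>M\<^esub> v) = L0_class mX (\<lambda>_. c) \<odot>\<^bsub>P\<^esub> p v) \<and>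
     (\<forall>v\<in>carrier M. AE x in mX. pn P (p v) x = pn M v (f x)) \<and>
     generates mX P (p ` carrier M)"

text \<open>The pullback \<open>f\<^sup>*\<phi>\<close> of a morphism \<open>\<phi>: M \<rightarrow> N\<close>, for pullbacks \<open>(P, p)\<close> of \<open>M\<close> and \<open>(Q, q)\<close> of \<open>N\<close>.\<close>

definition pullback_mor ::
  "'x measure \<Rightarrow> ('y, 'm) L0_nmodule \<Rightarrow> ('x, 'p) L0_nmodule \<Rightarrow> ('m \<Rightarrow> 'p) \<Rightarrow>
   ('x, 'q) L0_nmodule \<Rightarrow> ('n \<Rightarrow> 'q) \<Rightarrow> ('m \<Rightarrow> 'n) \<Rightarrow> 'p \<Rightarrow> 'q" where
  "pullback_mor mX M P p Q q \<phi> =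
     (THE \<theta>. \<theta> \<in> nm_mor mX P Q \<and> (\<forall>v\<in>carrier M. \<theta> (p v) = q (\<phi> v)))"

section \<open>Direct systems and direct limits\<close>

definition directed_poset :: "'i set \<Rightarrow> 'i rel \<Rightarrow> bool" where
  "directed_poset I r \<longleftrightarrow>
     I \<noteq> {} \<and> partial_order_on I r \<and> (\<forall>i\<in>I. \<forall>j\<in>I. \<exists>k\<in>I. (i, k) \<in> r \<and> (j, k) \<in> r)"

definition direct_system ::
  "'x measure \<Rightarrow> 'i set \<Rightarrow> 'i rel \<Rightarrow> ('i \<Rightarrow> ('x, 'm) L0_nmodule) \<Rightarrow> ('i \<Rightarrow> 'i \<Rightarrow> 'm \<Rightarrow> 'm) \<Rightarrow> bool" where
  "direct_system m I r M \<phi> \<longleftrightarrow>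
     (\<forall>i\<in>I. normed_module m (M i)) \<and>
     (\<forall>(i, j)\<in>r. \<phi> i j \<in> nm_mor m (M i) (M j)) \<and>
     (\<forall>i\<in>I. \<forall>v\<in>carrier (M i). \<phi> i i v = v) \<and>
     (\<forall>i j k. (i, j) \<in> r \<longrightarrow> (j, k) \<in> r \<longrightarrow> (\<forall>v\<in>carrier (M i). \<phi> i k v = \<phi> j k (\<phi> i j v)))"

definition target ::
  "'x measure \<Rightarrow> 'i set \<Rightarrow> 'i rel \<Rightarrow> ('i \<Rightarrow> ('x, 'm) L0_nmodule) \<Rightarrow> ('i \<Rightarrow> 'i \<Rightarrow> 'm \<Rightarrow> 'm) \<Rightarrow>
   ('x, 'n) L0_nmodule \<Rightarrow> ('i \<Rightarrow> 'm \<Rightarrow> 'n) \<Rightarrow> bool" where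
  "target m I r M \<phi> N \<psi> \<longleftrightarrow>
     normed_module m N \<and>
     (\<forall>i\<in>I. \<psi> i \<in> nm_mor m (M i) N) \<and>
     (\<forall>(i, j)\<in>r. \<forall>v\<in>carrier (M i). \<psi> j (\<phi> i j v) = \<psi> i v)"

text \<open>HOL cannot quantify over types inside a formula, so the type \<open>'n\<close> of the elements of the
  competing targets is a parameter. The universal property of the direct limit is the validity of
  this predicate at all types \<open>'n\<close>.\<close>

definition direct_limit ::
  "'n itself \<Rightarrow> 'x measure \<Rightarrow> 'i set \<Rightarrow> 'i rel \<Rightarrow> ('i \<Rightarrow> ('x, 'm) L0_nmodule) \<Rightarrow>
   ('i \<Rightarrow> 'i \<Rightarrow> 'm \<Rightarrow> 'm) \<Rightarrow> ('x, 'l) L0_nmodule \<Rightarrow> ('i \<Rightarrow> 'm \<Rightarrow> 'l) \<Rightarrow> bool" where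
  "direct_limit _ m I r M \<phi> L \<kappa> \<longleftrightarrow>
     target m I r M \<phi> L \<kappa> \<and>
     (\<forall>(N :: ('x, 'n) L0_nmodule) \<psi>. target m I r M \<phi> N \<psi> \<longrightarrow>
        (\<exists>!\<Phi>. \<Phi> \<in> nm_mor m L N \<and> (\<forall>i\<in>I. \<forall>v\<in>carrier (M i). \<Phi> (\<kappa> i v) = \<psi> i v)))"

end

theory Submission
  imports Defs
begin

text \<open>Almost everywhere convergence of \<open>|v\<^sub>n - v|\<close> replaces the distances: completeness and density are
  equivalent to their almost everywhere versions, as one sees by passing to fast converging
  subsequences.

  A linear map from \<open>M\<close> whose norm is bounded by \<open>|v| \<circ> f\<close> factors uniquely through \<open>f\<^sup>*M\<close>. Hence, given
  a target \<open>(N, \<psi>)\<close> of the pulled back system, it suffices to extend \<open>\<kappa>\<^sub>i v \<mapsto> \<psi>\<^sub>i (p\<^sub>i v)\<close> to \<open>L\<close>. For this,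
  the images of the \<open>\<kappa>\<^sub>i\<close> must be dense in \<open>L\<close>, and \<open>|\<psi>\<^sub>i (p\<^sub>i v)| \<le> |\<kappa>\<^sub>i v| \<circ> f\<close> must hold. The latter follows
  from \<open>|\<psi>\<^sub>i (p\<^sub>i v)| = |\<psi>\<^sub>j (p\<^sub>j (\<phi>\<^sub>i\<^sub>j v))| \<le> |\<phi>\<^sub>i\<^sub>j v| \<circ> f\<close> for all \<open>j \<ge> i\<close>, because the essential infimum of the
  \<open>|\<phi>\<^sub>i\<^sub>j v|\<close> is attained along countably many \<open>j\<close> and is at most \<open>|\<kappa>\<^sub>i v|\<close>: it is the norm of the image
  of \<open>v\<close> in the completion of the algebraic direct limit, which is a target of the original system.\<close>

text \<open>Three obstacles shape the argument. First, \<open>L0 mX\<close> and \<open>L0 mY\<close>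
  are different rings whose common scalars are only the constants, so a map such as
  \<open>p i\<close> is merely real-linear. Norms of sums with measurable coefficients are therefore
  compared first for constant coefficients, where the sum is again the image of a single element of
  the source, and the general case follows pointwise by approximation. Second, \<open>L\<close> is
  given only by its universal property, so neither its norm nor the size of the images of the
  \<open>\<kappa> i\<close> can be read off. Each fact about \<open>L\<close> is obtained by
  exhibiting a suitable target: the completed algebraic limit bounds the norm from below, and the
  closure of the images yields density. Third, \<open>I\<close> may be uncountable, and the bound
  belonging to an index \<open>j\<close> holds off a null set that depends on \<open>j\<close>. A
  pointwise infimum over \<open>j\<close> would be neither measurable nor comparable almost
  everywhere, whereas the countable family behind an essential infimum also survives composition
  with \<open>f\<close>.\<close>

section \<open>Classes of measurable functions and their representatives\<close>

lemma L0_class_carrier [intro, simp]: "g \<in> borel_measurable m \<Longrightarrow> L0_class m g \<in> carrier (L0 m)"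
  by (simp add: L0_def)

lemma L0_rep_in_class:
  assumes "a \<in> carrier (L0 m)" shows "L0_rep a \<in> a"
proof -
  obtain g where "g \<in> borel_measurable m" "a = L0_class m g"
    using assms by (auto simp: L0_def)
  then have "g \<in> a" by (simp add: L0_class_def)
  then show ?thesis unfolding L0_rep_def by (rule someI[of "\<lambda>g. g \<in> a"])
qed

lemma L0_rep_measurable [measurable (raw), simp]:
  assumes "a \<in> carrier (L0 m)" shows "L0_rep a \<in> borel_measurable m"
  using L0_rep_in_class[OF assms] assms by (auto simp: L0_def L0_class_def)

lemma L0_class_eqI:
  assumes "AE x in m. g x = h x" shows "L0_class m g = L0_class m h"
proof -
  have "(AE x in m. k x = g x) \<longleftrightarrow> (AE x in m. k x = h x)" for k
    using assms by (intro iffI; elim eventually_rev_mp; auto elim: eventually_mono)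
  then show ?thesis by (simp add: L0_class_def)
qed

lemma L0_rep_class:
  assumes "g \<in> borel_measurable m" shows "AE x in m. L0_rep (L0_class m g) x = g x"
  using L0_rep_in_class[OF L0_class_carrier[OF assms]] by (auto simp: L0_class_def)

lemma L0_class_rep [simp]:
  assumes "a \<in> carrier (L0 m)" shows "L0_class m (L0_rep a) = a"
proof -
  obtain g where g: "g \<in> borel_measurable m" "a = L0_class m g"
    using assms by (auto simp: L0_def)
  show ?thesis using L0_class_eqI[OF L0_rep_class[OF g(1)]] g by simp
qed

lemma L0_rep_add:
  assumes "a \<in> carrier (L0 m)" "b \<in> carrier (L0 m)"
  shows "AE x in m. L0_rep (a \<oplus>\<^bsub>L0 m\<^esub> b) x = L0_rep a x + L0_rep b x"
  using assms L0_rep_class[of "\<lambda>x. L0_rep a x + L0_rep b x" m] by (simp add: L0_def)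

lemma L0_class_add:
  assumes "g \<in> borel_measurable m" "h \<in> borel_measurable m"
  shows "L0_class m g \<oplus>\<^bsub>L0 m\<^esub> L0_class m h = L0_class m (\<lambda>x. g x + h x)"
  using L0_rep_class[OF assms(1)] L0_rep_class[OF assms(2)]
  by (auto simp: L0_def intro!: L0_class_eqI)

lemma L0_one: "\<one>\<^bsub>L0 m\<^esub> = L0_class m (\<lambda>_. 1)" and L0_zero: "\<zero>\<^bsub>L0 m\<^esub> = L0_class m (\<lambda>_. 0)"
  by (simp_all add: L0_def)

section \<open>Sigma-finiteness and equivalent probability measures\<close>

lemma radon_sigma_finite:
  fixes m :: "'a::polish_space measure"
  assumes "radon_measure m" shows "sigma_finite_measure m"
proof -
  have s: "sets m = sets borel" using assms by (simp add: radon_measure_def)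
  then have sp: "space m = UNIV" using sets_eq_imp_space_eq by fastforce
  let ?F = "{U. open U \<and> emeasure m U < \<infinity>}"
  have "\<And>S. S \<in> ?F \<Longrightarrow> open S" by simp
  \<comment> \<open>Second countability thins the cover by open sets of finite measure to a
    countable one.\<close>
  from Lindelof[of ?F, OF this] obtain F where F: "F \<subseteq> ?F" "countable F" "\<Union>F = \<Union>?F" by metis
  have "x \<in> \<Union>?F" for x using assms unfolding radon_measure_def by blast
  then have "\<Union>?F = UNIV" by blast
  then have U: "\<Union>F = space m" using F(3) sp by metis
  have "F \<subseteq> sets m" "\<forall>a\<in>F. emeasure m a \<noteq> \<infinity>" using F(1) by (auto simp: s)
  with F(2) U show ?thesis
    by (intro sigma_finite_measure.intro) blast
qed

lemma equivalent_prob_AE: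
  assumes "equivalent_prob m m'" shows "(AE x in m. S x) \<longleftrightarrow> (AE x in m'. S x)"
  using assms absolutely_continuous_AE[of m' m S] absolutely_continuous_AE[of m m' S]
  by (auto simp: equivalent_prob_def)

lemma equivalent_prob_measurable:
  assumes "equivalent_prob m m'" shows "borel_measurable m' = borel_measurable m"
  using assms by (intro measurable_cong_sets) (auto simp: equivalent_prob_def)

text \<open>The density is a normalised integrable function that is strictly positive. Positivity
  keeps the null sets unchanged, and a nonzero total mass makes the normalising constant
  positive.\<close>

lemma (in sigma_finite_measure) ex_equivalent_prob:
  assumes "emeasure M (space M) \<noteq> 0"
  obtains m' where "equivalent_prob M m'"
proof -
  obtain h :: "'a \<Rightarrow> real" where h: "h \<in> borel_measurable M" "\<And>x. h x > 0" "\<And>x. h x \<le> 1" "integrable M h"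
    using obtain_positive_integrable_function by blast
  note [measurable] = h(1)
  let ?c = "\<integral>x. h x \<partial>M"
  have "?c \<noteq> 0"
  proof
    assume "?c = 0"
    then have "AE x in M. h x = 0" using h(4) less_imp_le[OF h(2)]
      by (subst (asm) integral_nonneg_eq_0_iff_AE) auto
    then have "AE x in M. False" by (rule eventually_mono) (metis h(2) less_irrefl)
    then show False using assms by (simp add: AE_iff_null null_sets_def)
  qed
  moreover have "?c \<ge> 0" using less_imp_le[OF h(2)] by (intro integral_nonneg_AE) auto
  ultimately have c: "?c > 0" by simp
  let ?m = "density M (\<lambda>x. ennreal (h x / ?c))"
  have nn: "(\<integral>\<^sup>+x. ennreal (h x / ?c) \<partial>M) = 1"
    using c h less_imp_le[OF h(2)]
    by (subst nn_integral_eq_integral) (auto intro!: AE_I2 divide_nonneg_pos)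
  have "prob_space ?m" using nn
    by (intro prob_spaceI) (simp add: emeasure_density cong: nn_integral_cong)
  moreover have "absolutely_continuous ?m M"
  proof -
    have "null_sets ?m \<subseteq> null_sets M"
    proof
      fix A assume A: "A \<in> null_sets ?m"
      then have "AE x in M. x \<in> A \<longrightarrow> ennreal (h x / ?c) = 0" "A \<in> sets M"
        by (auto simp: null_sets_density_iff)
      then have "AE x in M. x \<notin> A"
        using c h(2) by (auto elim!: eventually_mono simp: ennreal_eq_0_iff not_less[symmetric])
      then show "A \<in> null_sets M" using \<open>A \<in> sets M\<close> by (simp add: AE_iff_null_sets)
    qed
    then show ?thesis by (simp add: absolutely_continuous_def)
  qed
  ultimately have "equivalent_prob M ?m"
    by (auto simp: equivalent_prob_def intro!: absolutely_continuousI_density)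
  then show ?thesis by (rule that)
qed

section \<open>Almost everywhere convergence in normed modules\<close>

definition ae_tendsto :: "'x measure \<Rightarrow> ('x, 'b) L0_nmodule \<Rightarrow> (nat \<Rightarrow> 'b) \<Rightarrow> 'b \<Rightarrow> bool" where
  "ae_tendsto m M s v \<longleftrightarrow> (AE x in m. (\<lambda>n. pn M (s n \<ominus>\<^bsub>M\<^esub> v) x) \<longlonglongrightarrow> 0)"

definition ae_Cauchy :: "'x measure \<Rightarrow> ('x, 'b) L0_nmodule \<Rightarrow> (nat \<Rightarrow> 'b) \<Rightarrow> bool" where
  "ae_Cauchy m M s \<longleftrightarrow> (AE x in m. \<forall>e>0. \<exists>K. \<forall>i\<ge>K. \<forall>j\<ge>K. pn M (s i \<ominus>\<^bsub>M\<^esub> s j) x < e)"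

definition ae_complete :: "'x measure \<Rightarrow> ('x, 'b) L0_nmodule \<Rightarrow> bool" where
  "ae_complete m M \<longleftrightarrow>
     (\<forall>s. s \<in> UNIV \<rightarrow> carrier M \<longrightarrow> ae_Cauchy m M s \<longrightarrow> (\<exists>v\<in>carrier M. ae_tendsto m M s v))"

text \<open>The index type is countable so that the bounds for all indices hold off one null set.
  The filter is left free: with \<open>nat\<close> and \<open>sequentially\<close> this treats
  convergence, with pairs and the product filter it treats the Cauchy property.\<close>

lemma AE_null_add:
  fixes a b c :: "'i::countable \<Rightarrow> 'x \<Rightarrow> real"
  assumes "\<And>i. AE x in m. 0 \<le> a i x" "\<And>i. AE x in m. a i x \<le> b i x + c i x"
    and "AE x in m. ((\<lambda>i. b i x) \<longlongrightarrow> 0) F" "AE x in m. ((\<lambda>i. c i x) \<longlongrightarrow> 0) F"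
  shows "AE x in m. ((\<lambda>i. a i x) \<longlongrightarrow> 0) F"
proof -
  have "AE x in m. \<forall>i. 0 \<le> a i x \<and> a i x \<le> b i x + c i x"
    unfolding AE_all_countable by (intro allI eventually_conj assms)
  then show ?thesis using assms(3,4)
  proof eventually_elim
    case (elim x)
    have "((\<lambda>i. b i x + c i x) \<longlongrightarrow> 0) F" using tendsto_add[OF elim(2,3)] by simp
    then show ?case
      by (rule tendsto_sandwich[OF _ _ tendsto_const, rotated 2]) (use elim(1) in auto)
  qed
qed

lemma AE_null_mult:
  fixes a b :: "'i::countable \<Rightarrow> 'x \<Rightarrow> real"
  assumes "\<And>i. AE x in m. a i x = k x * b i x" "AE x in m. ((\<lambda>i. b i x) \<longlongrightarrow> 0) F"
  shows "AE x in m. ((\<lambda>i. a i x) \<longlongrightarrow> 0) F"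
proof -
  have "AE x in m. \<forall>i. a i x = k x * b i x" unfolding AE_all_countable using assms(1) by blast
  with assms(2) show ?thesis
  proof eventually_elim
    case (elim x)
    show ?case unfolding elim(2)[rule_format] using tendsto_mult_left[OF elim(1), of "k x"] by simp
  qed
qed

text \<open>Rewrites the Cauchy condition as convergence to 0 along a product filter, so that Cauchy
  sequences and convergent sequences share the two squeeze lemmas above.\<close>

lemma null_double_seq_iff:
  fixes a :: "nat \<Rightarrow> nat \<Rightarrow> real"
  assumes "\<And>i j. 0 \<le> a i j"
  shows "((\<lambda>ij. a (fst ij) (snd ij)) \<longlongrightarrow> 0) (sequentially \<times>\<^sub>F sequentially) \<longleftrightarrow>
    (\<forall>e>0. \<exists>K. \<forall>i\<ge>K. \<forall>j\<ge>K. a i j < e)"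
  unfolding tendsto_iff eventually_prod_sequentially using assms by (auto simp: dist_real_def) blast+

text \<open>Completeness is split off because the algebraic direct limit has to be treated as a
  normed module before it is completed, and because a completion or a closure needs the norm
  calculus before its completeness can be proved.\<close>

locale pre_nmod = sigma_finite_measure m + module "L0 m" M
  for m :: "'x measure" and M :: "('x, 'b) L0_nmodule" (structure) +
  assumes pointwise_norm: "pointwise_norm m M"
begin

lemma pnorm_closed: "v \<in> carrier M \<Longrightarrow> pnorm M v \<in> carrier (L0 m)"
  using pointwise_norm by (auto simp: pointwise_norm_def)

lemma pn_measurable [measurable (raw), simp]: "v \<in> carrier M \<Longrightarrow> pn M v \<in> borel_measurable m"
  unfolding pn_def by (intro L0_rep_measurable pnorm_closed)

lemma pn_nonneg: "v \<in> carrier M \<Longrightarrow> AE x in m. 0 \<le> pn M v x"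
  using pointwise_norm by (auto simp: pointwise_norm_def)

lemma pn_add: "v \<in> carrier M \<Longrightarrow> w \<in> carrier M \<Longrightarrow> AE x in m. pn M (v \<oplus> w) x \<le> pn M v x + pn M w x"
  using pointwise_norm by (auto simp: pointwise_norm_def)

lemma pn_smult: "a \<in> carrier (L0 m) \<Longrightarrow> v \<in> carrier M \<Longrightarrow>
    AE x in m. pn M (a \<odot> v) x = \<bar>L0_rep a x\<bar> * pn M v x"
  using pointwise_norm by (auto simp: pointwise_norm_def)

lemma pn_eq_zero_iff: "v \<in> carrier M \<Longrightarrow> (AE x in m. pn M v x = 0) \<longleftrightarrow> v = \<zero>"
  using pointwise_norm by (auto simp: pointwise_norm_def)

lemma pn_zero: "AE x in m. pn M \<zero> x = 0"
  by (simp add: pn_eq_zero_iff)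

lemma L0_minus_one: "\<ominus>\<^bsub>L0 m\<^esub> \<one>\<^bsub>L0 m\<^esub> = L0_class m (\<lambda>_. -1)"
  by (rule R.minus_equality) (simp_all add: L0_one L0_zero L0_class_add)

text \<open>Turns negation into multiplication by a constant. Whatever respects constant scalars,
  such as a real-linear map or a closure, then respects differences without a separate
  argument.\<close>

lemma minus_one_smult:
  assumes "v \<in> carrier M" shows "L0_class m (\<lambda>_. -1) \<odot> v = \<ominus> v"
  using smult_l_minus[of "\<one>\<^bsub>L0 m\<^esub>" v] assms by (simp add: L0_minus_one)

lemma pn_uminus:
  assumes "v \<in> carrier M" shows "AE x in m. pn M (\<ominus> v) x = pn M v x"
proof -
  have "AE x in m. pn M (\<ominus> v) x = \<bar>L0_rep (L0_class m (\<lambda>_. -1)) x\<bar> * pn M v x"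
    using pn_smult[OF L0_class_carrier[OF borel_measurable_const] assms, of "-1"]
    unfolding minus_one_smult[OF assms] .
  moreover have "AE x in m. L0_rep (L0_class m (\<lambda>_. -1)) x = -1" by (rule L0_rep_class) simp
  ultimately show ?thesis by eventually_elim simp
qed

lemma diff_swap: "v \<in> carrier M \<Longrightarrow> w \<in> carrier M \<Longrightarrow> \<ominus> (v \<ominus> w) = w \<ominus> v"
  by (simp add: a_minus_def M.minus_add M.a_comm)

lemma diff_chain:
  "u \<in> carrier M \<Longrightarrow> v \<in> carrier M \<Longrightarrow> w \<in> carrier M \<Longrightarrow> (u \<ominus> v) \<oplus> (v \<ominus> w) = u \<ominus> w"
  unfolding a_minus_def by (simp add: M.a_assoc M.r_neg1)

lemma diff_add:
  "u \<in> carrier M \<Longrightarrow> v \<in> carrier M \<Longrightarrow> u' \<in> carrier M \<Longrightarrow> v' \<in> carrier M \<Longrightarrow>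
   (u \<oplus> u') \<ominus> (v \<oplus> v') = (u \<ominus> v) \<oplus> (u' \<ominus> v')"
  unfolding a_minus_def by (simp add: M.minus_add M.a_ac)

lemma diff_smult:
  "a \<in> carrier (L0 m) \<Longrightarrow> u \<in> carrier M \<Longrightarrow> v \<in> carrier M \<Longrightarrow>
   (a \<odot> u) \<ominus> (a \<odot> v) = a \<odot> (u \<ominus> v)"
  unfolding a_minus_def by (simp add: smult_r_distr smult_r_minus)

lemma diff_smult_left:
  "a \<in> carrier (L0 m) \<Longrightarrow> b \<in> carrier (L0 m) \<Longrightarrow> u \<in> carrier M \<Longrightarrow>
   (a \<odot> u) \<ominus> (b \<odot> u) = (a \<ominus>\<^bsub>L0 m\<^esub> b) \<odot> u"
  unfolding a_minus_def by (simp add: smult_l_distr smult_l_minus)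

lemma diff_self: "v \<in> carrier M \<Longrightarrow> v \<ominus> v = \<zero>"
  by (simp add: a_minus_def M.r_neg)

lemma diff_zero: "v \<in> carrier M \<Longrightarrow> v \<ominus> \<zero> = v"
  by (simp add: a_minus_def)

lemma eq_of_diff_zero:
  assumes "v \<in> carrier M" "w \<in> carrier M" "v \<ominus> w = \<zero>" shows "v = w"
  using diff_chain[OF assms(1,2) M.zero_closed] assms by (simp add: diff_zero)

lemma eqI_pn:
  assumes "v \<in> carrier M" "w \<in> carrier M" "AE x in m. pn M (v \<ominus> w) x = 0"
  shows "v = w"
  using assms pn_eq_zero_iff[OF M.minus_closed[OF assms(1,2)]] by (metis eq_of_diff_zero)

lemma pn_diff_self: "v \<in> carrier M \<Longrightarrow> AE x in m. pn M (v \<ominus> v) x = 0"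
  by (simp add: diff_self pn_zero)

lemma pn_diff_swap:
  "v \<in> carrier M \<Longrightarrow> w \<in> carrier M \<Longrightarrow> AE x in m. pn M (v \<ominus> w) x = pn M (w \<ominus> v) x"
  using pn_uminus[of "w \<ominus> v"] by (simp add: diff_swap)

lemma pn_diff_triangle:
  "u \<in> carrier M \<Longrightarrow> v \<in> carrier M \<Longrightarrow> w \<in> carrier M \<Longrightarrow>
   AE x in m. pn M (u \<ominus> w) x \<le> pn M (u \<ominus> v) x + pn M (v \<ominus> w) x"
  using pn_add[of "u \<ominus> v" "v \<ominus> w"] by (simp add: diff_chain)

lemma pn_diff_add:
  "u \<in> carrier M \<Longrightarrow> v \<in> carrier M \<Longrightarrow> u' \<in> carrier M \<Longrightarrow> v' \<in> carrier M \<Longrightarrow>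
   AE x in m. pn M ((u \<oplus> u') \<ominus> (v \<oplus> v')) x \<le> pn M (u \<ominus> v) x + pn M (u' \<ominus> v') x"
  using pn_add[of "u \<ominus> v" "u' \<ominus> v'"] by (simp add: diff_add)

lemma pn_diff_smult:
  "a \<in> carrier (L0 m) \<Longrightarrow> u \<in> carrier M \<Longrightarrow> v \<in> carrier M \<Longrightarrow>
   AE x in m. pn M ((a \<odot> u) \<ominus> (a \<odot> v)) x = \<bar>L0_rep a x\<bar> * pn M (u \<ominus> v) x"
  using pn_smult[of a "u \<ominus> v"] by (simp add: diff_smult)

lemma pn_le_add_diff:
  assumes "u \<in> carrier M" "v \<in> carrier M"
  shows "AE x in m. pn M u x \<le> pn M v x + pn M (u \<ominus> v) x"
  using pn_diff_triangle[OF assms M.zero_closed] unfolding diff_zero[OF assms(1)] diff_zero[OF assms(2)]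
  by eventually_elim simp

lemma pn_dist_le:
  assumes "u \<in> carrier M" "v \<in> carrier M"
  shows "AE x in m. \<bar>pn M u x - pn M v x\<bar> \<le> pn M (u \<ominus> v) x"
  using pn_le_add_diff[OF assms] pn_le_add_diff[OF assms(2,1)] pn_diff_swap[OF assms]
  by eventually_elim auto

lemma ae_tendsto_const: "v \<in> carrier M \<Longrightarrow> ae_tendsto m M (\<lambda>_. v) v"
  unfolding ae_tendsto_def using pn_diff_self[of v] by (auto elim: eventually_mono)

lemma seq_carrier: "s \<in> UNIV \<rightarrow> carrier M \<Longrightarrow> s n \<in> carrier M"
  by auto

lemma pn_diff_triangle_right:
  assumes "u \<in> carrier M" "v \<in> carrier M" "w \<in> carrier M"
  shows "AE x in m. pn M (u \<ominus> w) x \<le> pn M (u \<ominus> v) x + pn M (w \<ominus> v) x"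
  using pn_diff_triangle[OF assms] pn_diff_swap[OF assms(2,3)] by eventually_elim simp

lemma ae_tendsto_unique:
  assumes s: "s \<in> UNIV \<rightarrow> carrier M" and v: "v \<in> carrier M" and w: "w \<in> carrier M"
    and "ae_tendsto m M s v" "ae_tendsto m M s w"
  shows "v = w"
proof (rule eqI_pn[OF v w])
  have "AE x in m. (\<lambda>n. pn M (v \<ominus> w) x) \<longlonglongrightarrow> 0"
  proof (rule AE_null_add[OF _ _ assms(4,5)[unfolded ae_tendsto_def]])
    fix n :: nat
    note c = seq_carrier[OF s, of n]
    show "AE x in m. 0 \<le> pn M (v \<ominus> w) x" by (intro pn_nonneg M.minus_closed v w)
    show "AE x in m. pn M (v \<ominus> w) x \<le> pn M (s n \<ominus> v) x + pn M (s n \<ominus> w) x"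
      using pn_diff_triangle[OF v c w] pn_diff_swap[OF v c] by eventually_elim simp
  qed
  then show "AE x in m. pn M (v \<ominus> w) x = 0" by eventually_elim (simp add: LIMSEQ_const_iff)
qed

lemma ae_tendsto_close:
  assumes s: "s \<in> UNIV \<rightarrow> carrier M" and t: "t \<in> UNIV \<rightarrow> carrier M" and v: "v \<in> carrier M"
    and lim: "ae_tendsto m M s v" and close: "AE x in m. (\<lambda>n. pn M (t n \<ominus> s n) x) \<longlonglongrightarrow> 0"
  shows "ae_tendsto m M t v"
  unfolding ae_tendsto_def
  by (rule AE_null_add[OF _ _ close lim[unfolded ae_tendsto_def]])
    (intro pn_nonneg pn_diff_triangle M.minus_closed seq_carrier[OF s] seq_carrier[OF t] v)+

lemma ae_tendsto_add:
  assumes s: "s \<in> UNIV \<rightarrow> carrier M" and t: "t \<in> UNIV \<rightarrow> carrier M" and v: "v \<in> carrier M" and w: "w \<in> carrier M"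
    and "ae_tendsto m M s v" "ae_tendsto m M t w"
  shows "ae_tendsto m M (\<lambda>n. s n \<oplus> t n) (v \<oplus> w)"
  unfolding ae_tendsto_def
  by (rule AE_null_add[OF _ _ assms(5,6)[unfolded ae_tendsto_def]])
    (intro pn_nonneg pn_diff_add M.minus_closed M.a_closed seq_carrier[OF s] seq_carrier[OF t] v w)+

lemma ae_tendsto_smult:
  assumes s: "s \<in> UNIV \<rightarrow> carrier M" and v: "v \<in> carrier M" and a: "a \<in> carrier (L0 m)" and lim: "ae_tendsto m M s v"
  shows "ae_tendsto m M (\<lambda>n. a \<odot> s n) (a \<odot> v)"
  unfolding ae_tendsto_def
  by (rule AE_null_mult[OF pn_diff_smult[OF a seq_carrier[OF s] v] lim[unfolded ae_tendsto_def]])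

lemma ae_tendsto_pn:
  assumes "s \<in> UNIV \<rightarrow> carrier M" "v \<in> carrier M" and "ae_tendsto m M s v"
  shows "AE x in m. (\<lambda>n. pn M (s n) x) \<longlonglongrightarrow> pn M v x"
proof -
  have "AE x in m. \<forall>n. \<bar>pn M (s n) x - pn M v x\<bar> \<le> pn M (s n \<ominus> v) x"
    unfolding AE_all_countable using assms by (auto intro!: pn_dist_le)
  then show ?thesis using assms(3) unfolding ae_tendsto_def
  proof eventually_elim
    case (elim x)
    have "(\<lambda>n. pn M (s n) x - pn M v x) \<longlonglongrightarrow> 0"
      by (rule Lim_null_comparison[OF _ elim(2)]) (use elim(1) in auto)
    then show ?case by (simp add: LIM_zero_iff)
  qed
qed

lemma ae_Cauchy_iff_null:
  assumes s: "s \<in> UNIV \<rightarrow> carrier M"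
  shows "ae_Cauchy m M s \<longleftrightarrow>
    (AE x in m. ((\<lambda>ij. pn M (s (fst ij) \<ominus> s (snd ij)) x) \<longlongrightarrow> 0) (sequentially \<times>\<^sub>F sequentially))"
  unfolding ae_Cauchy_def
proof (rule eventually_subst)
  have "AE x in m. \<forall>i j. 0 \<le> pn M (s i \<ominus> s j) x"
    unfolding AE_all_countable by (intro allI pn_nonneg M.minus_closed seq_carrier[OF s])
  then show "AE x in m. (\<forall>e>0. \<exists>K. \<forall>i\<ge>K. \<forall>j\<ge>K. pn M (s i \<ominus> s j) x < e) =
      ((\<lambda>ij. pn M (s (fst ij) \<ominus> s (snd ij)) x) \<longlongrightarrow> 0) (sequentially \<times>\<^sub>F sequentially)"
    by eventually_elim (rule null_double_seq_iff[symmetric], blast)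
qed

lemma ae_tendsto_Cauchy:
  assumes s: "s \<in> UNIV \<rightarrow> carrier M" and v: "v \<in> carrier M" and lim: "ae_tendsto m M s v"
  shows "ae_Cauchy m M s"
  unfolding ae_Cauchy_iff_null[OF s]
proof (rule AE_null_add)
  show "AE x in m. ((\<lambda>ij. pn M (s (fst ij) \<ominus> v) x) \<longlongrightarrow> 0) (sequentially \<times>\<^sub>F sequentially)"
    using lim unfolding ae_tendsto_def by eventually_elim (rule filterlim_compose[OF _ filterlim_fst])
  show "AE x in m. ((\<lambda>ij. pn M (s (snd ij) \<ominus> v) x) \<longlongrightarrow> 0) (sequentially \<times>\<^sub>F sequentially)"
    using lim unfolding ae_tendsto_def by eventually_elim (rule filterlim_compose[OF _ filterlim_snd])
qed (intro pn_nonneg pn_diff_triangle_right M.minus_closed seq_carrier[OF s] v)+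

text \<open>Needed because a limit for the distance is an almost everywhere limit only along a
  subsequence.\<close>

lemma ae_Cauchy_subseq_limit:
  assumes "s \<in> UNIV \<rightarrow> carrier M" "v \<in> carrier M" "ae_Cauchy m M s"
    and "strict_mono (r :: nat \<Rightarrow> nat)" "ae_tendsto m M (s \<circ> r) v"
  shows "ae_tendsto m M s v"
proof -
  have "AE x in m. \<forall>i j. pn M (s i \<ominus> v) x \<le> pn M (s i \<ominus> s j) x + pn M (s j \<ominus> v) x \<and> 0 \<le> pn M (s i \<ominus> v) x"
    unfolding AE_all_countable
  proof (intro allI)
    fix i j have c: "s i \<in> carrier M" "s j \<in> carrier M" using assms by auto
    show "AE x in m. pn M (s i \<ominus> v) x \<le> pn M (s i \<ominus> s j) x + pn M (s j \<ominus> v) x \<and> 0 \<le> pn M (s i \<ominus> v) x"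
      using pn_diff_triangle[OF c assms(2)] pn_nonneg[OF M.minus_closed[OF c(1) assms(2)]]
      by eventually_elim auto
  qed
  then show ?thesis using assms(3,5) unfolding ae_tendsto_def ae_Cauchy_def
  proof eventually_elim
    case (elim x)
    show ?case
    proof (rule LIMSEQ_I)
      fix e :: real assume "e > 0"
      then obtain K where K: "\<And>i j. i \<ge> K \<Longrightarrow> j \<ge> K \<Longrightarrow> pn M (s i \<ominus> s j) x < e/2"
        using elim(2)[rule_format, of "e/2"] by auto
      have "\<forall>\<^sub>F n in sequentially. pn M ((s \<circ> r) n \<ominus> v) x < e/2"
        using order_tendstoD(2)[OF elim(3), of "e/2"] \<open>e > 0\<close> by simp
      then obtain K' where K': "\<And>n. n \<ge> K' \<Longrightarrow> pn M (s (r n) \<ominus> v) x < e/2"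
        by (auto simp: eventually_sequentially)
      let ?j = "r (max K K')"
      have j: "?j \<ge> K" using seq_suble[OF assms(4), of "max K K'"] by simp
      have "norm (pn M (s i \<ominus> v) x - 0) < e" if "i \<ge> K" for i
        using K[OF that j] K'[of "max K K'"] elim(1)[rule_format, of i ?j] by simp
      then show "\<exists>no. \<forall>n\<ge>no. norm (pn M (s n \<ominus> v) x - 0) < e" by blast
    qed
  qed
qed

lemma ae_Cauchy_close:
  assumes s: "s \<in> UNIV \<rightarrow> carrier M" and t: "t \<in> UNIV \<rightarrow> carrier M" and C: "ae_Cauchy m M s"
    and close: "AE x in m. (\<lambda>n. pn M (t n \<ominus> s n) x) \<longlonglongrightarrow> 0"
  shows "ae_Cauchy m M t"
  unfolding ae_Cauchy_iff_null[OF t]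
proof (rule AE_null_add)
  show "AE x in m. ((\<lambda>ij. pn M (t (fst ij) \<ominus> s (fst ij)) x) \<longlongrightarrow> 0) (sequentially \<times>\<^sub>F sequentially)"
    using close by eventually_elim (rule filterlim_compose[OF _ filterlim_fst])
  have "AE x in m. ((\<lambda>ij. pn M (t (snd ij) \<ominus> s (snd ij)) x) \<longlongrightarrow> 0) (sequentially \<times>\<^sub>F sequentially)"
    using close by eventually_elim (rule filterlim_compose[OF _ filterlim_snd])
  with C[unfolded ae_Cauchy_iff_null[OF s]]
  show "AE x in m. ((\<lambda>ij. pn M (s (fst ij) \<ominus> t (snd ij)) x) \<longlongrightarrow> 0) (sequentially \<times>\<^sub>F sequentially)"
    by (rule AE_null_add[rotated 2])
      (intro pn_nonneg pn_diff_triangle_right M.minus_closed seq_carrier[OF s] seq_carrier[OF t])+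
qed (intro pn_nonneg pn_diff_triangle M.minus_closed seq_carrier[OF s] seq_carrier[OF t])+

end

section \<open>Distances of equivalent probability measures against almost everywhere
  convergence\<close>

lemma AE_of_space_null:
  assumes "emeasure m (space m) = 0" shows "AE x in m. S x"
  by (rule AE_I'[of "space m"]) (use assms in \<open>auto simp: null_sets_def\<close>)

text \<open>By monotone convergence the sum of the series has integral at most that of a geometric
  series, and a function with finite integral is finite almost everywhere.\<close>

lemma summable_AE_of_integral_le:
  fixes u :: "nat \<Rightarrow> 'a \<Rightarrow> real"
  assumes [measurable]: "\<And>n. u n \<in> borel_measurable m"
    and nn: "\<And>n x. 0 \<le> u n x" and int: "\<And>n. integrable m (u n)"
    and le: "\<And>n. (\<integral>x. u n x \<partial>m) \<le> (1/2)^n"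
  shows "AE x in m. summable (\<lambda>n. u n x)"
proof -
  have "(\<integral>\<^sup>+x. (\<Sum>n. ennreal (u n x)) \<partial>m) = (\<Sum>n. \<integral>\<^sup>+x. ennreal (u n x) \<partial>m)"
    by (rule nn_integral_suminf) measurable
  also have "\<dots> \<le> (\<Sum>n. ennreal ((1/2)^n))"
  proof (intro suminf_le summableI)
    fix n show "(\<integral>\<^sup>+x. ennreal (u n x) \<partial>m) \<le> ennreal ((1/2)^n)"
      using le[of n] nn by (subst nn_integral_eq_integral[OF int]) (auto intro: ennreal_leI)
  qed
  also have "\<dots> = ennreal (\<Sum>n. (1/2)^n)"
    by (intro suminf_ennreal2 summable_geometric) auto
  finally have "(\<integral>\<^sup>+x. (\<Sum>n. ennreal (u n x)) \<partial>m) \<noteq> \<infinity>" by (auto simp: top_unique)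
  then have "AE x in m. (\<Sum>n. ennreal (u n x)) \<noteq> \<infinity>"
    by (intro nn_integral_PInf_AE) measurable
  then show ?thesis
    by eventually_elim (intro summable_suminf_not_top, use nn in auto)
qed

context pre_nmod begin

context
  fixes m' assumes m': "equivalent_prob m m'"
begin

lemma prob': "prob_space m'"
  using m' by (simp add: equivalent_prob_def)

lemma trunc_measurable: "v \<in> carrier M \<Longrightarrow> (\<lambda>x. min (pn M v x) 1) \<in> borel_measurable m'"
  unfolding equivalent_prob_measurable[OF m'] by (intro borel_measurable_min pn_measurable) auto

lemma trunc_bounds: "v \<in> carrier M \<Longrightarrow> AE x in m'. 0 \<le> min (pn M v x) 1"
  unfolding equivalent_prob_AE[OF m', symmetric] using pn_nonneg[of v] by (auto elim!: eventually_mono)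

lemma trunc_integrable: "v \<in> carrier M \<Longrightarrow> integrable m' (\<lambda>x. min (pn M v x) 1)"
proof -
  assume v: "v \<in> carrier M"
  interpret p: prob_space m' by (rule prob')
  show ?thesis
    using trunc_bounds[OF v]
    by (intro p.integrable_const_bound[where B=1] trunc_measurable[OF v]) (auto elim!: eventually_mono)
qed

lemma nm_dist_eq: "v \<in> carrier M \<Longrightarrow> w \<in> carrier M \<Longrightarrow>
    nm_dist m' M v w = (\<integral>x. min (pn M (v \<ominus> w) x) 1 \<partial>m')"
  by (simp add: nm_dist_def)

text \<open>Truncation at 1 keeps the triangle inequality because the norms are nonnegative almost
  everywhere. Distance 0 forces \<open>v = w\<close> because \<open>m\<close> and \<open>m'\<close>
  have the same null sets.\<close>

lemma nm_dist_metric: "Metric_space (carrier M) (nm_dist m' M)"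
proof
  fix v w
  show "0 \<le> nm_dist m' M v w"
    unfolding nm_dist_def by (auto intro!: integral_nonneg_AE trunc_bounds)
  show "nm_dist m' M v w = nm_dist m' M w v"
  proof (cases "v \<in> carrier M \<and> w \<in> carrier M")
    case True
    then have c: "v \<in> carrier M" "w \<in> carrier M" by auto
    have "AE x in m'. min (pn M (v \<ominus> w) x) 1 = min (pn M (w \<ominus> v) x) 1"
      unfolding equivalent_prob_AE[OF m', symmetric] using pn_diff_swap[OF c] by eventually_elim simp
    then show ?thesis unfolding nm_dist_eq[OF c] nm_dist_eq[OF c(2,1)]
      by (intro integral_cong_AE trunc_measurable M.minus_closed c)
  qed (auto simp: nm_dist_def)
next
  fix v w assume c: "v \<in> carrier M" "w \<in> carrier M"
  have "nm_dist m' M v w = 0 \<longleftrightarrow> (AE x in m'. min (pn M (v \<ominus> w) x) 1 = 0)"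
    unfolding nm_dist_eq[OF c]
    by (intro integral_nonneg_eq_0_iff_AE trunc_integrable trunc_bounds M.minus_closed c)
  also have "\<dots> \<longleftrightarrow> (AE x in m. pn M (v \<ominus> w) x = 0)"
    unfolding equivalent_prob_AE[OF m', symmetric] by (intro AE_cong) (auto simp: min_def)
  also have "\<dots> \<longleftrightarrow> v = w" using eqI_pn[OF c] pn_diff_self[OF c(1)] by metis
  finally show "nm_dist m' M v w = 0 \<longleftrightarrow> v = w" .
next
  fix u v w assume c: "u \<in> carrier M" "v \<in> carrier M" "w \<in> carrier M"
  have "AE x in m'. min (pn M (u \<ominus> w) x) 1 \<le> min (pn M (u \<ominus> v) x) 1 + min (pn M (v \<ominus> w) x) 1"
    unfolding equivalent_prob_AE[OF m', symmetric]
    using pn_diff_triangle[OF c] pn_nonneg[OF M.minus_closed[OF c(1,2)]] pn_nonneg[OF M.minus_closed[OF c(2,3)]]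
    by eventually_elim (auto simp: min_def)
  then have "(\<integral>x. min (pn M (u \<ominus> w) x) 1 \<partial>m') \<le> (\<integral>x. min (pn M (u \<ominus> v) x) 1 + min (pn M (v \<ominus> w) x) 1 \<partial>m')"
    by (intro integral_mono_AE Bochner_Integration.integrable_add trunc_integrable M.minus_closed c)
  also have "\<dots> = nm_dist m' M u v + nm_dist m' M v w"
    unfolding nm_dist_eq[OF c(1,2)] nm_dist_eq[OF c(2,3)]
    by (intro Bochner_Integration.integral_add trunc_integrable M.minus_closed c)
  finally show "nm_dist m' M u w \<le> nm_dist m' M u v + nm_dist m' M v w"
    unfolding nm_dist_eq[OF c(1,3)] .
qed

text \<open>Dominated convergence: the truncations are bounded by the constant 1, which is
  integrable for a probability measure.\<close>

lemma nm_dist_tendsto: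
  assumes s: "s \<in> UNIV \<rightarrow> carrier M" and t: "t \<in> UNIV \<rightarrow> carrier M"
    and lim: "AE x in m. (\<lambda>n. pn M (s n \<ominus> t n) x) \<longlonglongrightarrow> 0"
  shows "(\<lambda>n. nm_dist m' M (s n) (t n)) \<longlonglongrightarrow> 0"
proof -
  interpret p: prob_space m' by (rule prob')
  have c: "s n \<ominus> t n \<in> carrier M" for n using s t by auto
  have "(\<lambda>n. \<integral>x. min (pn M (s n \<ominus> t n) x) 1 \<partial>m') \<longlonglongrightarrow> (\<integral>x. 0 \<partial>m')"
  proof (rule integral_dominated_convergence[where w="\<lambda>_. 1"])
    show "AE x in m'. (\<lambda>n. min (pn M (s n \<ominus> t n) x) 1) \<longlonglongrightarrow> 0"
      unfolding equivalent_prob_AE[OF m', symmetric] using lim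
      by eventually_elim (drule tendsto_min[OF _ tendsto_const[of 1]], simp)
    show "AE x in m'. norm (min (pn M (s n \<ominus> t n) x) 1) \<le> 1" for n
      using trunc_bounds[OF c[of n]] by eventually_elim auto
  qed (auto intro: trunc_measurable c)
  then show ?thesis using nm_dist_eq seq_carrier[OF s] seq_carrier[OF t] by simp
qed

text \<open>The partial converse of \<open>nm_dist_tendsto\<close>. Convergence in the distance
  alone gives no almost everywhere convergence; a geometric rate does.\<close>

lemma ae_summable_of_nm_dist:
  assumes s: "s \<in> UNIV \<rightarrow> carrier M" and t: "t \<in> UNIV \<rightarrow> carrier M"
    and le: "\<And>n. nm_dist m' M (s n) (t n) \<le> (1/2)^n"
  shows "AE x in m. summable (\<lambda>n. pn M (s n \<ominus> t n) x)"
proof -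
  have c: "s n \<ominus> t n \<in> carrier M" for n using s t by auto
  \<comment> \<open>The outer \<open>max\<close> makes the terms nonnegative at every point, whereas
    the norms are so only almost everywhere.\<close>
  let ?u = "\<lambda>n x. max 0 (min (pn M (s n \<ominus> t n) x) 1)"
  have eq: "AE x in m'. ?u n x = min (pn M (s n \<ominus> t n) x) 1" for n
    using trunc_bounds[OF c[of n]] by eventually_elim auto
  have meas: "?u n \<in> borel_measurable m'" for n
    using trunc_measurable[OF c[of n]] by measurable
  have "integrable m' (?u n)" for n
    using trunc_integrable[OF c[of n]] integrable_cong_AE[OF meas trunc_measurable[OF c] eq] by simp
  moreover have "(\<integral>x. ?u n x \<partial>m') \<le> (1/2)^n" for n
    using le[of n] integral_cong_AE[OF meas trunc_measurable[OF c] eq, of n]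
      nm_dist_eq[OF seq_carrier[OF s] seq_carrier[OF t], of n n] by simp
  ultimately have "AE x in m'. summable (\<lambda>n. ?u n x)"
    by (intro summable_AE_of_integral_le meas) auto
  then have 1: "AE x in m. summable (\<lambda>n. ?u n x)" unfolding equivalent_prob_AE[OF m', symmetric] .
  have "AE x in m. \<forall>n. 0 \<le> pn M (s n \<ominus> t n) x"
    unfolding AE_all_countable using pn_nonneg c by blast
  with 1 show ?thesis
  proof eventually_elim
    case (elim x)
    \<comment> \<open>The terms of a convergent series are eventually below 1, where the truncation
      has no effect, so the untruncated series converges by comparison.\<close>
    have "\<forall>\<^sub>F n in sequentially. ?u n x < 1"
      using order_tendstoD(2)[OF summable_LIMSEQ_zero[OF elim(1)], of 1] by simp
    then have "\<forall>\<^sub>F n in sequentially. norm (pn M (s n \<ominus> t n) x) \<le> ?u n x"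
      using elim(2) by (auto elim!: eventually_mono simp: max_def min_def split: if_splits)
    then show ?case using elim(1) by (rule summable_comparison_test_ev)
  qed
qed

text \<open>The norms of consecutive differences are summable almost everywhere, and by telescoping
  a block of this series bounds the norm of \<open>s j \<ominus> s i\<close>.\<close>

lemma ae_Cauchy_of_nm_dist:
  assumes s: "s \<in> UNIV \<rightarrow> carrier M" and le: "\<And>n. nm_dist m' M (s (Suc n)) (s n) \<le> (1/2)^n"
  shows "ae_Cauchy m M s"
proof -
  have c: "s n \<in> carrier M" for n using s by auto
  have 1: "AE x in m. summable (\<lambda>n. pn M (s (Suc n) \<ominus> s n) x)"
    using s le by (intro ae_summable_of_nm_dist) auto
  have 2: "AE x in m. \<forall>i j. pn M (s i \<ominus> s j) x = pn M (s j \<ominus> s i) x"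
    unfolding AE_all_countable using pn_diff_swap c by blast
  have 3: "AE x in m. \<forall>i j. pn M (s (Suc i) \<ominus> s j) x \<le> pn M (s (Suc i) \<ominus> s i) x + pn M (s i \<ominus> s j) x"
    unfolding AE_all_countable using pn_diff_triangle c by blast
  have 4: "AE x in m. \<forall>i. pn M (s i \<ominus> s i) x = 0"
    unfolding AE_all_countable using pn_diff_self c by blast
  from 1 2 3 4 show ?thesis unfolding ae_Cauchy_def
  proof eventually_elim
    case (elim x)
    let ?a = "\<lambda>n. pn M (s (Suc n) \<ominus> s n) x"
    have tele: "pn M (s (i + k) \<ominus> s i) x \<le> sum ?a {i..<i+k}" for i k
    proof (induction k)
      case 0 then show ?case using elim(4) by simp
    next
      case (Suc k)
      then show ?case using elim(3)[rule_format, of "i+k" i] by simp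
    qed
    show ?case
    proof (intro allI impI)
      fix e :: real assume "e > 0"
      then obtain N where N: "\<And>i j. i \<ge> N \<Longrightarrow> norm (sum ?a {i..<j}) < e"
        using elim(1) unfolding summable_Cauchy by blast
      have le: "pn M (s j \<ominus> s i) x < e" if "i \<ge> N" "i \<le> j" for i j
        using tele[of i "j - i"] N[of i j] that by simp
      have "pn M (s i \<ominus> s j) x < e" if "i \<ge> N" "j \<ge> N" for i j
        using le[of i j] le[of j i] that elim(2) by (cases "i \<le> j") auto
      then show "\<exists>K. \<forall>i\<ge>K. \<forall>j\<ge>K. pn M (s i \<ominus> s j) x < e" by blast
    qed
  qed
qed

lemma subseq_limit_ae:
  assumes s: "s \<in> UNIV \<rightarrow> carrier M" and v: "v \<in> carrier M"
    and lim: "\<And>e. e > 0 \<Longrightarrow> \<exists>N. \<forall>n\<ge>N. nm_dist m' M (s n) v < e"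
  obtains r :: "nat \<Rightarrow> nat" where "strict_mono r" "ae_tendsto m M (s \<circ> r) v"
proof -
  have "\<exists>N. \<forall>k. \<forall>n\<ge>N k. nm_dist m' M (s n) v < (1/2)^k" using lim by (intro choice) auto
  then obtain N where N: "\<And>k n. n \<ge> N k \<Longrightarrow> nm_dist m' M (s n) v < (1/2)^k" by blast
  \<comment> \<open>The sum puts \<open>?r n\<close> beyond the threshold \<open>N n\<close>; the
    extra \<open>n\<close> makes the sequence strictly increasing.\<close>
  let ?r = "\<lambda>n. n + sum N {..n}"
  have "strict_mono ?r" by (rule strict_mono_Suc_iff[THEN iffD2]) auto
  moreover have "nm_dist m' M (s (?r n)) v \<le> (1/2)^n" for n
    using N[of n "?r n"] member_le_sum[of n "{..n}" N] by (auto intro: less_imp_le)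
  then have "AE x in m. summable (\<lambda>n. pn M ((s \<circ> ?r) n \<ominus> v) x)"
    using s v by (intro ae_summable_of_nm_dist) auto
  then have "ae_tendsto m M (s \<circ> ?r) v" unfolding ae_tendsto_def
    by eventually_elim (rule summable_LIMSEQ_zero)
  ultimately show ?thesis by (rule that)
qed

text \<open>Dominated convergence speaks of sequences, not of double sequences. A failure of the
  Cauchy property therefore supplies one sequence of bad pairs, along which the distance would
  nevertheless have to tend to 0.\<close>

lemma MCauchy_of_ae_Cauchy:
  assumes s: "s \<in> UNIV \<rightarrow> carrier M" and C: "ae_Cauchy m M s"
  shows "Metric_space.MCauchy (carrier M) (nm_dist m' M) s"
proof -
  interpret Metric_space "carrier M" "nm_dist m' M" by (rule nm_dist_metric)
  have "\<exists>N. \<forall>n n'. N \<le> n \<longrightarrow> N \<le> n' \<longrightarrow> nm_dist m' M (s n) (s n') < e" if "e > 0" for e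
  proof (rule ccontr)
    assume "\<not> ?thesis"
    then have "\<forall>N. \<exists>i j. N \<le> i \<and> N \<le> j \<and> e \<le> nm_dist m' M (s i) (s j)" by (auto simp: not_less)
    then obtain i j where ij: "\<And>N. N \<le> i N" "\<And>N. N \<le> j N" "\<And>N. e \<le> nm_dist m' M (s (i N)) (s (j N))"
      by metis
    have "AE x in m. \<forall>i j. 0 \<le> pn M (s i \<ominus> s j) x"
      unfolding AE_all_countable using s by (auto intro!: pn_nonneg)
    with C have "AE x in m. (\<lambda>N. pn M (s (i N) \<ominus> s (j N)) x) \<longlonglongrightarrow> 0"
      unfolding ae_Cauchy_def
    proof eventually_elim
      case (elim x)
      show ?case
      proof (rule LIMSEQ_I)
        fix e :: real assume "e > 0"
        then obtain K where "\<forall>i\<ge>K. \<forall>j\<ge>K. pn M (s i \<ominus> s j) x < e" using elim(1) by blast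
        then have "pn M (s (i n) \<ominus> s (j n)) x < e" if "n \<ge> K" for n
          using order_trans[OF that ij(1)] order_trans[OF that ij(2)] by blast
        then show "\<exists>no. \<forall>n\<ge>no. norm (pn M (s (i n) \<ominus> s (j n)) x - 0) < e"
          using elim(2) by (intro exI[of _ K]) auto
      qed
    qed
    then have "(\<lambda>N. nm_dist m' M (s (i N)) (s (j N))) \<longlonglongrightarrow> 0"
      using s by (intro nm_dist_tendsto) auto
    from LIMSEQ_le_const[OF this, of e] ij(3) have "e \<le> 0" by auto
    with \<open>e > 0\<close> show False by simp
  qed
  with s show ?thesis by (auto simp: MCauchy_def)
qed

end

text \<open>The metric limit is an almost everywhere limit of a fast subsequence, and the almost
  everywhere Cauchy property carries it back to the whole sequence.\<close>

lemma ae_complete_of_mcomplete: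
  assumes "\<forall>m'. equivalent_prob m m' \<longrightarrow> Metric_space.mcomplete (carrier M) (nm_dist m' M)"
  shows "ae_complete m M"
  unfolding ae_complete_def
proof (intro allI impI)
  fix s assume s: "s \<in> UNIV \<rightarrow> carrier M" and C: "ae_Cauchy m M s"
  show "\<exists>v\<in>carrier M. ae_tendsto m M s v"
  \<comment> \<open>The zero measure has no equivalent probability measure, hence no distance to
    work with; every almost everywhere statement is then true.\<close>
  proof (cases "emeasure m (space m) = 0")
    case True
    then show ?thesis by (intro bexI[of _ "\<zero>"]) (auto simp: ae_tendsto_def intro: AE_of_space_null)
  next
    case False
    then obtain m' where m': "equivalent_prob m m'" by (rule ex_equivalent_prob)
    interpret Metric_space "carrier M" "nm_dist m' M" by (rule nm_dist_metric[OF m'])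
    have "mcomplete" using assms m' by blast
    with MCauchy_of_ae_Cauchy[OF m' s C] obtain v where "limitin mtopology s v sequentially"
      by (auto simp: mcomplete_def)
    then have v: "v \<in> carrier M" "\<And>e. e > 0 \<Longrightarrow> \<exists>N. \<forall>n\<ge>N. nm_dist m' M (s n) v < e"
      unfolding limit_metric_sequentially by blast+
    obtain r :: "nat \<Rightarrow> nat" where "strict_mono r" "ae_tendsto m M (s \<circ> r) v"
      by (rule subseq_limit_ae[OF m' s v])
    then show ?thesis using ae_Cauchy_subseq_limit[OF s v(1) C] v(1) by blast
  qed
qed

text \<open>A Cauchy sequence for the distance has a subsequence with geometric rate. Its almost
  everywhere limit is a metric limit, and a Cauchy sequence with a convergent subsequence
  converges.\<close>

lemma mcomplete_of_ae_complete:
  assumes "ae_complete m M" and m': "equivalent_prob m m'"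
  shows "Metric_space.mcomplete (carrier M) (nm_dist m' M)"
proof -
  interpret Metric_space "carrier M" "nm_dist m' M" by (rule nm_dist_metric[OF m'])
  show ?thesis
    unfolding mcomplete_def
  proof (intro allI impI)
    fix s assume C: "MCauchy s"
    then have s: "s \<in> UNIV \<rightarrow> carrier M" by (auto simp: MCauchy_def)
    have "\<exists>N. \<forall>n n'. N \<le> n \<longrightarrow> N \<le> n' \<longrightarrow> nm_dist m' M (s n) (s n') < (1/2)^k" for k :: nat
      using C by (auto simp: MCauchy_def)
    then obtain N where N: "\<And>k n n'. N k \<le> n \<Longrightarrow> N k \<le> n' \<Longrightarrow> nm_dist m' M (s n) (s n') < (1/2)^k"
      by metis
    let ?r = "\<lambda>n. n + sum N {..n}"
    have r: "strict_mono ?r" by (rule strict_mono_Suc_iff[THEN iffD2]) auto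
    have sr: "s \<circ> ?r \<in> UNIV \<rightarrow> carrier M" using s by auto
    have "nm_dist m' M ((s \<circ> ?r) (Suc n)) ((s \<circ> ?r) n) \<le> (1/2)^n" for n
      using N[of n "?r (Suc n)" "?r n"] member_le_sum[of n "{..n}" N] by (auto intro: less_imp_le)
    then have "ae_Cauchy m M (s \<circ> ?r)" by (intro ae_Cauchy_of_nm_dist[OF m'] sr)
    with assms(1) sr obtain v where v: "v \<in> carrier M" "ae_tendsto m M (s \<circ> ?r) v"
      unfolding ae_complete_def by blast
    have "(\<lambda>n. nm_dist m' M ((s \<circ> ?r) n) v) \<longlonglongrightarrow> 0"
      using nm_dist_tendsto[OF m' sr, of "\<lambda>_. v"] v by (auto simp: ae_tendsto_def)
    then have "limitin mtopology (s \<circ> ?r) v sequentially"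
      using v(1) sr LIMSEQ_D by (fastforce simp: limit_metric_sequentially)
    then show "\<exists>v. limitin mtopology s v sequentially"
      using MCauchy_convergent_subsequence[OF C r] by blast
  qed
qed

lemma span_ae_dense:
  assumes S: "generates m M S" and w: "w \<in> carrier M"
    and sub: "L0_span m M S \<subseteq> carrier M"
  obtains s where "s \<in> UNIV \<rightarrow> L0_span m M S" "ae_tendsto m M s w"
proof (cases "emeasure m (space m) = 0")
  case True
  \<comment> \<open>The empty sum: it lies in the span of every set, the empty one included, so a
    sequence in the span exists.\<close>
  have "finsum M (\<lambda>i. \<zero>\<^bsub>L0 m\<^esub> \<odot> \<zero>) {..<0::nat} \<in> L0_span m M S"
    unfolding L0_span_def by force
  then show ?thesis
    by (intro that[of "\<lambda>_. finsum M (\<lambda>i. \<zero>\<^bsub>L0 m\<^esub> \<odot> \<zero>) {..<0::nat}"])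
      (auto simp: ae_tendsto_def intro: AE_of_space_null[OF True])
next
  case False
  then obtain m' where m': "equivalent_prob m m'" by (rule ex_equivalent_prob)
  interpret Metric_space "carrier M" "nm_dist m' M" by (rule nm_dist_metric[OF m'])
  have "w \<in> mtopology closure_of L0_span m M S" using S m' w by (auto simp: generates_def)
  then have "\<forall>n. \<exists>y\<in>L0_span m M S. nm_dist m' M y w < (1/2)^n"
    unfolding metric_closure_of in_mball by (auto simp: commute) (metis half_gt_zero_iff zero_less_one zero_less_power)
  then obtain s where s: "\<And>n. s n \<in> L0_span m M S" "\<And>n. nm_dist m' M (s n) w < (1/2)^n" by metis
  then have "AE x in m. summable (\<lambda>n. pn M (s n \<ominus> w) x)"
    using sub w by (intro ae_summable_of_nm_dist[OF m']) (auto intro: less_imp_le)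
  then have "ae_tendsto m M s w" unfolding ae_tendsto_def
    by eventually_elim (rule summable_LIMSEQ_zero)
  with s(1) show ?thesis by (intro that[of s]) auto
qed

text \<open>Approximants of the individual \<open>v k\<close> cannot be diagonalised directly,
  because almost everywhere convergence carries no rate. The distance supplies one: choosing
  \<open>t k\<close> within \<open>(1/2)^k\<close> of \<open>v k\<close> makes the errors summable
  almost everywhere.\<close>

lemma ae_complete_of_dense:
  assumes S: "S \<subseteq> carrier M"
    and dense: "\<And>v. v \<in> carrier M \<Longrightarrow> \<exists>s. s \<in> UNIV \<rightarrow> S \<and> ae_tendsto m M s v"
    and complete: "\<And>s. s \<in> UNIV \<rightarrow> S \<Longrightarrow> ae_Cauchy m M s \<Longrightarrow> \<exists>v\<in>carrier M. ae_tendsto m M s v"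
  shows "ae_complete m M"
proof (cases "emeasure m (space m) = 0")
  case True
  then show ?thesis unfolding ae_complete_def
    by (auto simp: ae_tendsto_def intro!: bexI[of _ "\<zero>"] AE_of_space_null)
next
  case False
  then obtain m' where m': "equivalent_prob m m'" by (rule ex_equivalent_prob)
  interpret Metric_space "carrier M" "nm_dist m' M" by (rule nm_dist_metric[OF m'])
  show ?thesis unfolding ae_complete_def
  proof (intro allI impI)
    fix v assume v: "v \<in> UNIV \<rightarrow> carrier M" and C: "ae_Cauchy m M v"
    have "\<exists>t\<in>S. nm_dist m' M t (v k) \<le> (1/2)^k" for k
    proof -
      obtain s where s: "s \<in> UNIV \<rightarrow> S" "ae_tendsto m M s (v k)" using dense[of "v k"] v by auto
      then have "(\<lambda>n. nm_dist m' M (s n) (v k)) \<longlonglongrightarrow> 0"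
        using S v by (intro nm_dist_tendsto[OF m']) (auto simp: ae_tendsto_def)
      from order_tendstoD(2)[OF this, of "(1/2)^k"] obtain n where "nm_dist m' M (s n) (v k) < (1/2)^k"
        by (auto simp: eventually_sequentially)
      with s(1) show ?thesis by (intro bexI[of _ "s n"]) auto
    qed
    then obtain t where t: "\<And>k. t k \<in> S" "\<And>k. nm_dist m' M (t k) (v k) \<le> (1/2)^k" by metis
    then have tS: "t \<in> UNIV \<rightarrow> S" and tM: "t \<in> UNIV \<rightarrow> carrier M" using S by auto
    have close: "AE x in m. (\<lambda>n. pn M (t n \<ominus> v n) x) \<longlonglongrightarrow> 0"
      using ae_summable_of_nm_dist[OF m' tM v t(2)] by eventually_elim (rule summable_LIMSEQ_zero)
    have "ae_Cauchy m M t" by (rule ae_Cauchy_close[OF v tM C close])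
    then obtain w where w: "w \<in> carrier M" "ae_tendsto m M t w" using complete tS by blast
    have "AE x in m. \<forall>n. pn M (v n \<ominus> t n) x = pn M (t n \<ominus> v n) x"
      unfolding AE_all_countable using pn_diff_swap[OF seq_carrier[OF v] seq_carrier[OF tM]] by blast
    with close have "AE x in m. (\<lambda>n. pn M (v n \<ominus> t n) x) \<longlonglongrightarrow> 0" by eventually_elim simp
    with w show "\<exists>w\<in>carrier M. ae_tendsto m M v w" using ae_tendsto_close[OF tM v] by blast
  qed
qed

end

locale nmod = pre_nmod +
  assumes complete: "ae_complete m M"

lemma normed_module_iff_nmod:
  assumes "sigma_finite_measure m"
  shows "normed_module m M \<longleftrightarrow> nmod m M"
proof
  assume n: "normed_module m M"
  then interpret pre_nmod m M
    using assms by (auto simp: normed_module_def pre_nmod_def pre_nmod_axioms_def)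
  show "nmod m M" using n
    by unfold_locales (auto simp: normed_module_def intro!: ae_complete_of_mcomplete)
next
  assume "nmod m M"
  then interpret nmod m M .
  show "normed_module m M"
    using module_axioms pointwise_norm mcomplete_of_ae_complete[OF complete] by (auto simp: normed_module_def)
qed

section \<open>Maps dominated by a pullback\<close>

text \<open>The common form of the maps to be extended. The pullback maps are instances, and so are
  morphisms, with \<open>f\<close> the identity. Linearity is over the reals because the two modules
  have different scalars.\<close>

definition dominated_map ::
  "'x measure \<Rightarrow> 'y measure \<Rightarrow> ('x \<Rightarrow> 'y) \<Rightarrow> ('y, 'm) L0_nmodule \<Rightarrow> ('x, 'n) L0_nmodule \<Rightarrow> ('m \<Rightarrow> 'n) \<Rightarrow> bool" where
  "dominated_map mX mY f M N T \<longleftrightarrow>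
     T \<in> carrier M \<rightarrow> carrier N \<and>
     (\<forall>v\<in>carrier M. \<forall>w\<in>carrier M. T (v \<oplus>\<^bsub>M\<^esub> w) = T v \<oplus>\<^bsub>N\<^esub> T w) \<and>
     (\<forall>c. \<forall>v\<in>carrier M. T (L0_class mY (\<lambda>_. c) \<odot>\<^bsub>M\<^esub> v) = L0_class mX (\<lambda>_. c) \<odot>\<^bsub>N\<^esub> T v) \<and>
     (\<forall>v\<in>carrier M. AE x in mX. pn N (T v) x \<le> pn M v (f x))"

lemma dominated_mapD:
  assumes "dominated_map mX mY f M N T"
  shows "\<And>v. v \<in> carrier M \<Longrightarrow> T v \<in> carrier N"
    and "\<And>v w. v \<in> carrier M \<Longrightarrow> w \<in> carrier M \<Longrightarrow> T (v \<oplus>\<^bsub>M\<^esub> w) = T v \<oplus>\<^bsub>N\<^esub> T w"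
    and "\<And>c v. v \<in> carrier M \<Longrightarrow> T (L0_class mY (\<lambda>_. c) \<odot>\<^bsub>M\<^esub> v) = L0_class mX (\<lambda>_. c) \<odot>\<^bsub>N\<^esub> T v"
    and "\<And>v. v \<in> carrier M \<Longrightarrow> AE x in mX. pn N (T v) x \<le> pn M v (f x)"
  using assms unfolding dominated_map_def by auto

lemma nm_mor_dominated: "\<phi> \<in> nm_mor m M N \<Longrightarrow> dominated_map m m (\<lambda>x. x) M N \<phi>"
  by (auto simp: nm_mor_def dominated_map_def)

text \<open>Absolute continuity of the image measure enters in the form \<open>AE_comp\<close>,
  which the identity on a single measure satisfies as well. Morphisms over one ring are thereby
  covered by the same lemmas.\<close>

locale nmod_map = M: pre_nmod mY M + N: pre_nmod mX N
  for mX :: "'x measure" and mY :: "'y measure" and f :: "'x \<Rightarrow> 'y"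
    and M :: "('y, 'm) L0_nmodule" and N :: "('x, 'n) L0_nmodule" +
  assumes AE_comp: "\<And>S. AE y in mY. S y \<Longrightarrow> AE x in mX. S (f x)"
begin

lemma dominated_diff:
  assumes T: "dominated_map mX mY f M N T" and c: "v \<in> carrier M" "w \<in> carrier M"
  shows "T (v \<ominus>\<^bsub>M\<^esub> w) = T v \<ominus>\<^bsub>N\<^esub> T w"
proof -
  have "T v = T ((v \<ominus>\<^bsub>M\<^esub> w) \<oplus>\<^bsub>M\<^esub> w)"
    using c by (simp add: a_minus_def M.M.a_assoc M.M.l_neg)
  also have "\<dots> = T (v \<ominus>\<^bsub>M\<^esub> w) \<oplus>\<^bsub>N\<^esub> T w" using dominated_mapD(2)[OF T] c by simp
  finally show ?thesis
    using dominated_mapD(1)[OF T] c by (simp add: a_minus_def N.M.a_assoc N.M.r_neg)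
qed

lemma dominated_zero:
  assumes T: "dominated_map mX mY f M N T" shows "T \<zero>\<^bsub>M\<^esub> = \<zero>\<^bsub>N\<^esub>"
  using dominated_diff[OF T, of "\<zero>\<^bsub>M\<^esub>" "\<zero>\<^bsub>M\<^esub>"] dominated_mapD(1)[OF T, of "\<zero>\<^bsub>M\<^esub>"]
  by (simp add: M.diff_self N.diff_self)

lemma dominated_tendsto:
  assumes T: "dominated_map mX mY f M N T" and s: "s \<in> UNIV \<rightarrow> carrier M" and v: "v \<in> carrier M"
    and lim: "ae_tendsto mY M s v"
  shows "ae_tendsto mX N (T \<circ> s) (T v)"
proof -
  have c: "s n \<in> carrier M" for n using s by auto
  have "AE x in mX. \<forall>n. 0 \<le> pn N (T (s n) \<ominus>\<^bsub>N\<^esub> T v) x \<and> pn N (T (s n) \<ominus>\<^bsub>N\<^esub> T v) x \<le> pn M (s n \<ominus>\<^bsub>M\<^esub> v) (f x)"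
    unfolding AE_all_countable
  proof
    fix n
    show "AE x in mX. 0 \<le> pn N (T (s n) \<ominus>\<^bsub>N\<^esub> T v) x \<and> pn N (T (s n) \<ominus>\<^bsub>N\<^esub> T v) x \<le> pn M (s n \<ominus>\<^bsub>M\<^esub> v) (f x)"
      using N.pn_nonneg[OF dominated_mapD(1)[OF T M.M.minus_closed[OF c v]], of n]
        dominated_mapD(4)[OF T M.M.minus_closed[OF c v], of n]
      unfolding dominated_diff[OF T c v] by eventually_elim auto
  qed
  with AE_comp[OF lim[unfolded ae_tendsto_def]] show ?thesis unfolding ae_tendsto_def comp_def
  proof eventually_elim
    case (elim x)
    show ?case
      by (rule tendsto_sandwich[OF _ _ tendsto_const elim(1)]) (use elim(2) in auto)
  qed
qed

lemma dominated_unique: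
  assumes T: "dominated_map mX mY f M N T" and T': "dominated_map mX mY f M N T'"
    and D: "D \<subseteq> carrier M" "\<And>d. d \<in> D \<Longrightarrow> T d = T' d"
    and s: "s \<in> UNIV \<rightarrow> D" "ae_tendsto mY M s v" and v: "v \<in> carrier M"
  shows "T v = T' v"
proof -
  have sM: "s \<in> UNIV \<rightarrow> carrier M" using s D by auto
  have "T \<circ> s = T' \<circ> s" using s D by (auto simp: fun_eq_iff)
  then have "ae_tendsto mX N (T \<circ> s) (T v)" "ae_tendsto mX N (T \<circ> s) (T' v)"
    using dominated_tendsto[OF T sM v s(2)] dominated_tendsto[OF T' sM v s(2)] by auto
  then show ?thesis
    using dominated_mapD(1)[OF T] dominated_mapD(1)[OF T'] M.seq_carrier[OF sM] v
    by (intro N.ae_tendsto_unique[of "T \<circ> s"]) auto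
qed

text \<open>The closure of an additive relation whose second component is dominated by the first one is
  again dominated, hence single-valued.\<close>

lemma dominated_extension:
  assumes complete: "ae_complete mX N"
    and G: "G \<subseteq> carrier M \<times> carrier N"
    and bound: "\<And>v w. (v, w) \<in> G \<Longrightarrow> AE x in mX. pn N w x \<le> pn M v (f x)"
    and add: "\<And>v w v' w'. (v, w) \<in> G \<Longrightarrow> (v', w') \<in> G \<Longrightarrow> (v \<oplus>\<^bsub>M\<^esub> v', w \<oplus>\<^bsub>N\<^esub> w') \<in> G"
    and scale: "\<And>c v w. (v, w) \<in> G \<Longrightarrow> (L0_class mY (\<lambda>_. c) \<odot>\<^bsub>M\<^esub> v, L0_class mX (\<lambda>_. c) \<odot>\<^bsub>N\<^esub> w) \<in> G"
    and dense: "\<And>v. v \<in> carrier M \<Longrightarrow> \<exists>s t. (\<forall>n. (s n, t n) \<in> G) \<and> ae_tendsto mY M s v"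
  obtains T where "dominated_map mX mY f M N T" "T \<in> extensional (carrier M)" "\<And>v w. (v, w) \<in> G \<Longrightarrow> T v = w"
    "\<And>a b v. a \<in> carrier (L0 mY) \<Longrightarrow> b \<in> carrier (L0 mX) \<Longrightarrow>
       (\<And>v w. (v, w) \<in> G \<Longrightarrow> (a \<odot>\<^bsub>M\<^esub> v, b \<odot>\<^bsub>N\<^esub> w) \<in> G) \<Longrightarrow> v \<in> carrier M \<Longrightarrow> T (a \<odot>\<^bsub>M\<^esub> v) = b \<odot>\<^bsub>N\<^esub> T v"
proof -
  define H where "H v w \<longleftrightarrow> v \<in> carrier M \<and> w \<in> carrier N \<and>
      (\<exists>s t. (\<forall>n. (s n, t n) \<in> G) \<and> ae_tendsto mY M s v \<and> ae_tendsto mX N t w)" for v w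
  have seqs: "s \<in> UNIV \<rightarrow> carrier M" "t \<in> UNIV \<rightarrow> carrier N" if "\<forall>n. (s n, t n) \<in> G" for s t
    using that G by auto
  have neg: "(\<ominus>\<^bsub>M\<^esub> v, \<ominus>\<^bsub>N\<^esub> w) \<in> G" if "(v, w) \<in> G" for v w
    using scale[OF that, of "-1"] that G by (auto simp: M.minus_one_smult N.minus_one_smult)
  have diff: "(v \<ominus>\<^bsub>M\<^esub> v', w \<ominus>\<^bsub>N\<^esub> w') \<in> G" if "(v, w) \<in> G" "(v', w') \<in> G" for v w v' w'
    using add[OF that(1) neg[OF that(2)]] by (simp add: a_minus_def)
  have Hc: "v \<in> carrier M" "w \<in> carrier N" if "H v w" for v w using that by (auto simp: H_def)
  have HI: "H v w" if "\<forall>n. (s n, t n) \<in> G" "ae_tendsto mY M s v" "ae_tendsto mX N t w"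
      "v \<in> carrier M" "w \<in> carrier N" for s t v w
    unfolding H_def using that by blast
  have HG: "H v w" if "(v, w) \<in> G" for v w
    unfolding H_def using that G M.ae_tendsto_const[of v] N.ae_tendsto_const[of w]
    by (intro conjI exI[of _ "\<lambda>_. v"] exI[of _ "\<lambda>_. w"]) auto
  have Hadd: "H (v \<oplus>\<^bsub>M\<^esub> v') (w \<oplus>\<^bsub>N\<^esub> w')" if H1: "H v w" and H2: "H v' w'" for v w v' w'
  proof -
    obtain s t where 1: "\<forall>n. (s n, t n) \<in> G" "ae_tendsto mY M s v" "ae_tendsto mX N t w"
      using H1 unfolding H_def by blast
    obtain s' t' where 2: "\<forall>n. (s' n, t' n) \<in> G" "ae_tendsto mY M s' v'" "ae_tendsto mX N t' w'"
      using H2 unfolding H_def by blast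
    have "\<forall>n. (s n \<oplus>\<^bsub>M\<^esub> s' n, t n \<oplus>\<^bsub>N\<^esub> t' n) \<in> G" using 1(1) 2(1) add by blast
    moreover have "ae_tendsto mY M (\<lambda>n. s n \<oplus>\<^bsub>M\<^esub> s' n) (v \<oplus>\<^bsub>M\<^esub> v')"
      using 1 2 Hc[OF H1] Hc[OF H2] by (intro M.ae_tendsto_add seqs)
    moreover have "ae_tendsto mX N (\<lambda>n. t n \<oplus>\<^bsub>N\<^esub> t' n) (w \<oplus>\<^bsub>N\<^esub> w')"
      using 1 2 Hc[OF H1] Hc[OF H2] by (intro N.ae_tendsto_add seqs)
    ultimately show ?thesis by (rule HI) (use Hc[OF H1] Hc[OF H2] in auto)
  qed
  \<comment> \<open>The two scalars come from different rings and are tied together only through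
    preserving \<open>G\<close>. Classes of the same constant give real linearity of the extension;
    over one base measure, \<open>a = b\<close> gives linearity over the whole ring.\<close>
  have Hscale: "H (a \<odot>\<^bsub>M\<^esub> v) (b \<odot>\<^bsub>N\<^esub> w)"
    if H1: "H v w" and ab: "a \<in> carrier (L0 mY)" "b \<in> carrier (L0 mX)"
      and sc: "\<And>v w. (v, w) \<in> G \<Longrightarrow> (a \<odot>\<^bsub>M\<^esub> v, b \<odot>\<^bsub>N\<^esub> w) \<in> G" for v w a b
  proof -
    obtain s t where 1: "\<forall>n. (s n, t n) \<in> G" "ae_tendsto mY M s v" "ae_tendsto mX N t w"
      using H1 unfolding H_def by blast
    have "\<forall>n. (a \<odot>\<^bsub>M\<^esub> s n, b \<odot>\<^bsub>N\<^esub> t n) \<in> G" using 1(1) sc by blast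
    moreover have "ae_tendsto mY M (\<lambda>n. a \<odot>\<^bsub>M\<^esub> s n) (a \<odot>\<^bsub>M\<^esub> v)"
      using 1 Hc[OF H1] ab(1) by (intro M.ae_tendsto_smult seqs)
    moreover have "ae_tendsto mX N (\<lambda>n. b \<odot>\<^bsub>N\<^esub> t n) (b \<odot>\<^bsub>N\<^esub> w)"
      using 1 Hc[OF H1] ab(2) by (intro N.ae_tendsto_smult seqs)
    ultimately show ?thesis by (rule HI) (use Hc[OF H1] ab in auto)
  qed
  have Hbound: "AE x in mX. pn N w x \<le> pn M v (f x)" if H: "H v w" for v w
  proof -
    obtain s t where 1: "\<forall>n. (s n, t n) \<in> G" "ae_tendsto mY M s v" "ae_tendsto mX N t w"
      using H unfolding H_def by blast
    have "AE x in mX. \<forall>n. pn N (t n) x \<le> pn M (s n) (f x)"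
      unfolding AE_all_countable using 1(1) bound by blast
    with AE_comp[OF M.ae_tendsto_pn[OF seqs(1)[OF 1(1)] Hc(1)[OF H] 1(2)]]
      N.ae_tendsto_pn[OF seqs(2)[OF 1(1)] Hc(2)[OF H] 1(3)]
    show ?thesis
      by eventually_elim (rule LIMSEQ_le, auto)
  qed
  have Huniq: "w = w'" if H: "H v w" "H v w'" for v w w'
  proof -
    have "H (L0_class mY (\<lambda>_. -1) \<odot>\<^bsub>M\<^esub> v) (L0_class mX (\<lambda>_. -1) \<odot>\<^bsub>N\<^esub> w')"
      by (rule Hscale[OF H(2)]) (auto intro: scale)
    then have "H (v \<ominus>\<^bsub>M\<^esub> v) (w \<ominus>\<^bsub>N\<^esub> w')"
      using Hadd[OF H(1), of "\<ominus>\<^bsub>M\<^esub> v" "\<ominus>\<^bsub>N\<^esub> w'"] Hc[OF H(2)]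
      by (simp add: M.minus_one_smult N.minus_one_smult a_minus_def)
    from Hbound[OF this] AE_comp[OF M.pn_diff_self[OF Hc(1)[OF H(1)]]]
      N.pn_nonneg[OF N.M.minus_closed[OF Hc(2)[OF H(1)] Hc(2)[OF H(2)]]]
    have "AE x in mX. pn N (w \<ominus>\<^bsub>N\<^esub> w') x = 0" by eventually_elim simp
    then show ?thesis using Hc(2) H by (intro N.eqI_pn)
  qed
  have Hex: "\<exists>w. H v w" if v: "v \<in> carrier M" for v
  proof -
    obtain s t where 1: "\<forall>n. (s n, t n) \<in> G" "ae_tendsto mY M s v" using dense[OF v] by auto
    \<comment> \<open>Differences of pairs stay in \<open>G\<close>, so the Cauchy property passes
      from \<open>s\<close> to \<open>t\<close>; completeness of \<open>N\<close> then supplies the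
      value of the extension.\<close>
    have "AE x in mX. \<forall>i j. pn N (t i \<ominus>\<^bsub>N\<^esub> t j) x \<le> pn M (s i \<ominus>\<^bsub>M\<^esub> s j) (f x)"
      unfolding AE_all_countable using 1(1) diff bound by blast
    with AE_comp[OF M.ae_tendsto_Cauchy[OF seqs(1)[OF 1(1)] v 1(2), unfolded ae_Cauchy_def]]
    have "ae_Cauchy mX N t" unfolding ae_Cauchy_def
      by eventually_elim (meson le_less_trans)
    then obtain w where "w \<in> carrier N" "ae_tendsto mX N t w"
      using complete seqs(2)[OF 1(1)] unfolding ae_complete_def by blast
    then show ?thesis using 1 v by (auto simp: H_def)
  qed
  define T where "T = restrict (\<lambda>v. THE w. H v w) (carrier M)"
  have T: "H v (T v)" if "v \<in> carrier M" for v
    using theI'[of "H v"] Hex[OF that] Huniq that by (auto simp: T_def)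
  have TI: "T v = w" if "H v w" for v w
    using T[OF Hc(1)[OF that]] that by (rule Huniq)
  show ?thesis
  proof (rule that[of T])
    show "dominated_map mX mY f M N T"
      unfolding dominated_map_def
    proof (intro conjI ballI allI)
      show "T \<in> carrier M \<rightarrow> carrier N" using T Hc(2) by blast
      show "T (v \<oplus>\<^bsub>M\<^esub> w) = T v \<oplus>\<^bsub>N\<^esub> T w" if "v \<in> carrier M" "w \<in> carrier M" for v w
        by (rule TI[OF Hadd[OF T T]]) fact+
      show "T (L0_class mY (\<lambda>_. c) \<odot>\<^bsub>M\<^esub> v) = L0_class mX (\<lambda>_. c) \<odot>\<^bsub>N\<^esub> T v" if "v \<in> carrier M" for c v
        by (rule TI[OF Hscale[OF T]]) (use that scale in auto)
      show "AE x in mX. pn N (T v) x \<le> pn M v (f x)" if "v \<in> carrier M" for v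
        by (rule Hbound[OF T[OF that]])
    qed
    show "T \<in> extensional (carrier M)" by (simp add: T_def)
    show "T v = w" if "(v, w) \<in> G" for v w by (rule TI[OF HG[OF that]])
    show "T (a \<odot>\<^bsub>M\<^esub> v) = b \<odot>\<^bsub>N\<^esub> T v"
      if "a \<in> carrier (L0 mY)" "b \<in> carrier (L0 mX)"
        "\<And>v w. (v, w) \<in> G \<Longrightarrow> (a \<odot>\<^bsub>M\<^esub> v, b \<odot>\<^bsub>N\<^esub> w) \<in> G" "v \<in> carrier M" for a b v
      using that by (intro TI Hscale T) auto
  qed
qed

end

section \<open>Linear combinations and approximation of their coefficients by rational
  constants\<close>

definition lincomb :: "('x, 'n) L0_nmodule \<Rightarrow> ('m \<Rightarrow> 'n) \<Rightarrow> (('x \<Rightarrow> real) set \<times> 'm) list \<Rightarrow> 'n" where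
  "lincomb N T xs = foldr (\<lambda>(a, v) w. (a \<odot>\<^bsub>N\<^esub> T v) \<oplus>\<^bsub>N\<^esub> w) xs \<zero>\<^bsub>N\<^esub>"

lemma lincomb_simps [simp]:
  "lincomb N T [] = \<zero>\<^bsub>N\<^esub>"
  "lincomb N T ((a, v) # xs) = (a \<odot>\<^bsub>N\<^esub> T v) \<oplus>\<^bsub>N\<^esub> lincomb N T xs"
  by (simp_all add: lincomb_def)

definition const_scalars :: "'x measure \<Rightarrow> rat list \<Rightarrow> 'm list \<Rightarrow> (('x \<Rightarrow> real) set \<times> 'm) list" where
  "const_scalars m cs vs = zip (map (\<lambda>c. L0_class m (\<lambda>_. of_rat c)) cs) vs"

lemma const_scalars_simps [simp]:
  "const_scalars m [] vs = []"
  "const_scalars m cs [] = []"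
  "const_scalars m (c # cs) (v # vs) = (L0_class m (\<lambda>_. of_rat c), v) # const_scalars m cs vs"
  by (simp_all add: const_scalars_def)

text \<open>The pointwise cost of replacing the coefficients \<open>a\<close> by the constants
  \<open>c\<close>. The weight \<open>u\<close> is a parameter because one choice of constants must
  serve two modules at once, with the sum of both norms as common weight.\<close>

definition scalar_error :: "('m \<Rightarrow> 'x \<Rightarrow> real) \<Rightarrow> rat list \<Rightarrow> (('x \<Rightarrow> real) set \<times> 'm) list \<Rightarrow> 'x \<Rightarrow> real" where
  "scalar_error u cs xs x = (\<Sum>(c, a, v)\<leftarrow>zip cs xs. \<bar>L0_rep a x - of_rat c\<bar> * u v x)"

lemma scalar_error_simps [simp]:
  "scalar_error u [] xs x = 0"
  "scalar_error u cs [] x = 0"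
  "scalar_error u (c # cs) ((a, v) # xs) x = \<bar>L0_rep a x - of_rat c\<bar> * u v x + scalar_error u cs xs x"
  by (simp_all add: scalar_error_def)

lemma scalar_error_mono:
  "(\<And>v. u v x \<le> u' v x) \<Longrightarrow> scalar_error u cs xs x \<le> scalar_error u' cs xs x"
  unfolding scalar_error_def by (intro sum_list_mono) (auto intro: mult_left_mono)

lemma scalar_error_small:
  assumes "e > 0" "\<And>v. 0 \<le> u v x"
  shows "\<exists>cs. length cs = length xs \<and> scalar_error u cs xs x < e"
  using assms(1)
proof (induction xs arbitrary: e)
  case (Cons y xs)
  obtain a v where y: "y = (a, v)" by (cases y)
  obtain cs where cs: "length cs = length xs" "scalar_error u cs xs x < e/2"
    using Cons.IH[of "e/2"] Cons.prems by auto
  \<comment> \<open>Half of \<open>e\<close> is spent on the first term and half on the rest; the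
    \<open>+ 1\<close> covers the case \<open>u v x = 0\<close>.\<close>
  define d where "d = e / 2 / (u v x + 1)"
  have d: "d > 0" using Cons.prems assms(2)[of v] by (auto simp: d_def intro!: divide_pos_pos)
  obtain c where c: "L0_rep a x < of_rat c" "of_rat c < L0_rep a x + d"
    using of_rat_dense[of "L0_rep a x" "L0_rep a x + d"] d by auto
  have "\<bar>L0_rep a x - of_rat c\<bar> * u v x \<le> d * (u v x + 1)"
    using c assms(2)[of v] by (intro mult_mono) auto
  also have "\<dots> = e / 2"
  proof -
    have "u v x + 1 \<noteq> 0" using assms(2)[of v] by simp
    then show ?thesis unfolding d_def by (rule nonzero_eq_divide_eq[THEN iffD1, OF _ refl])
  qed
  finally show ?case using cs by (intro exI[of _ "c # cs"]) (auto simp: y)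
qed auto

context pre_nmod begin

lemma lincomb_closed [simp]:
  assumes "set xs \<subseteq> carrier (L0 m) \<times> A" "T \<in> A \<rightarrow> carrier M"
  shows "lincomb M T xs \<in> carrier M"
  using assms(1)
proof (induction xs)
  case (Cons y xs)
  then have "lincomb M T xs \<in> carrier M" "fst y \<in> carrier (L0 m)" "T (snd y) \<in> carrier M"
    using assms(2) by auto
  then show ?case by (cases y) simp
qed simp

lemma lincomb_append:
  assumes "set xs \<subseteq> carrier (L0 m) \<times> A" "set ys \<subseteq> carrier (L0 m) \<times> A" "T \<in> A \<rightarrow> carrier M"
  shows "lincomb M T (xs @ ys) = lincomb M T xs \<oplus> lincomb M T ys"
  using assms(1)
proof (induction xs)
  case Nil
  then show ?case using lincomb_closed[OF assms(2,3)] by simp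
next
  case (Cons y xs)
  then have "lincomb M T xs \<in> carrier M" "lincomb M T ys \<in> carrier M"
      "fst y \<in> carrier (L0 m)" "T (snd y) \<in> carrier M"
    using lincomb_closed[OF _ assms(3)] assms(2,3) by auto
  with Cons show ?case by (cases y) (simp add: M.a_assoc)
qed

lemma lincomb_smult:
  assumes "set xs \<subseteq> carrier (L0 m) \<times> A" "T \<in> A \<rightarrow> carrier M" "b \<in> carrier (L0 m)"
  shows "lincomb M T (map (\<lambda>(a, v). (b \<otimes>\<^bsub>L0 m\<^esub> a, v)) xs) = b \<odot> lincomb M T xs"
  using assms(1)
proof (induction xs)
  case Nil
  then show ?case using assms(3) by simp
next
  case (Cons y xs)
  obtain a v where y: "y = (a, v)" by (cases y)
  have c: "lincomb M T xs \<in> carrier M" "a \<in> carrier (L0 m)" "T v \<in> carrier M"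
    using Cons.prems lincomb_closed[OF _ assms(2)] assms(2) by (auto simp: y)
  show ?case using Cons c assms(3) by (auto simp: y smult_r_distr smult_assoc1)
qed

text \<open>A list of coefficients and vectors does not mention the target module, so the same list
  can be evaluated with \<open>p\<close> in the pullback and with \<open>T\<close> in another
  module. Concatenation of lists plays the role of addition.\<close>

lemma L0_span_lincomb:
  assumes "w \<in> L0_span m M (T ` A)" "T \<in> A \<rightarrow> carrier M"
  obtains xs where "set xs \<subseteq> carrier (L0 m) \<times> A" "w = lincomb M T xs"
proof -
  obtain n a u where w: "w = (\<Oplus>\<^bsub>M\<^esub>i\<in>{..<n::nat}. a i \<odot> u i)" "a \<in> {..<n} \<rightarrow> carrier (L0 m)" "u \<in> {..<n} \<rightarrow> T ` A"
    using assms(1) by (auto simp: L0_span_def)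
  have "\<exists>xs. set xs \<subseteq> carrier (L0 m) \<times> A \<and> (\<Oplus>\<^bsub>M\<^esub>i\<in>{..<n}. a i \<odot> u i) = lincomb M T xs"
    using w(2,3)
  proof (induction n)
    case 0
    show ?case by (intro exI[of _ "[]"]) simp
  next
    case (Suc n)
    then obtain xs where xs: "set xs \<subseteq> carrier (L0 m) \<times> A" "(\<Oplus>\<^bsub>M\<^esub>i\<in>{..<n}. a i \<odot> u i) = lincomb M T xs"
      by (auto simp: Pi_iff)
    obtain v where v: "v \<in> A" "u n = T v" using Suc.prems by auto
    have c: "a i \<odot> u i \<in> carrier M" if "i < Suc n" for i
    proof -
      have "a i \<in> carrier (L0 m)" "u i \<in> T ` A" using Suc.prems that by auto
      moreover have "T ` A \<subseteq> carrier M" using assms(2) by auto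
      ultimately show ?thesis by blast
    qed
    have "(\<Oplus>\<^bsub>M\<^esub>i\<in>{..<Suc n}. a i \<odot> u i) = (a n \<odot> u n) \<oplus> (\<Oplus>\<^bsub>M\<^esub>i\<in>{..<n}. a i \<odot> u i)"
      unfolding lessThan_Suc using c by (subst M.finsum_insert) auto
    then show ?case using xs v Suc.prems by (intro exI[of _ "(a n, v) # xs"]) auto
  qed
  with w(1) that show ?thesis by auto
qed

lemma L0_span_closed: "S \<subseteq> carrier M \<Longrightarrow> L0_span m M S \<subseteq> carrier M"
  unfolding L0_span_def by (auto intro!: M.finsum_closed)

lemma const_scalars_carrier:
  "set vs \<subseteq> A \<Longrightarrow> set (const_scalars m cs vs) \<subseteq> carrier (L0 m) \<times> A"
proof (induction cs arbitrary: vs)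
  case (Cons c cs)
  then show ?case by (cases vs) auto
qed simp

lemma lincomb_error:
  assumes "set xs \<subseteq> carrier (L0 m) \<times> A" "T \<in> A \<rightarrow> carrier M" "length cs = length xs"
  shows "AE x in m. pn M (lincomb M T xs \<ominus> lincomb M T (const_scalars m cs (map snd xs))) x
           \<le> scalar_error (\<lambda>v. pn M (T v)) cs xs x"
  using assms(3,1)
proof (induction cs xs rule: list_induct2)
  case Nil
  then show ?case using pn_diff_self[OF M.zero_closed] by (auto elim: eventually_mono)
next
  case (Cons c cs y xs)
  obtain a v where y: "y = (a, v)" by (cases y)
  let ?c = "L0_class m (\<lambda>_. real_of_rat c)"
  let ?l = "lincomb M T xs" and ?r = "lincomb M T (const_scalars m cs (map snd xs))"
  have a: "a \<in> carrier (L0 m)" "T v \<in> carrier M" "?c \<in> carrier (L0 m)" using Cons.prems assms(2) by (auto simp: y)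
  have xs: "set xs \<subseteq> carrier (L0 m) \<times> A" "set (map snd xs) \<subseteq> A" using Cons.prems by auto
  have l: "?l \<in> carrier M" "?r \<in> carrier M"
    using lincomb_closed[OF xs(1) assms(2)] lincomb_closed[OF const_scalars_carrier[OF xs(2)] assms(2)] by auto
  have "AE x in m. L0_rep (a \<ominus>\<^bsub>L0 m\<^esub> ?c) x = L0_rep a x - of_rat c"
  proof -
    have "\<ominus>\<^bsub>L0 m\<^esub> ?c = L0_class m (\<lambda>_. - of_rat c)"
      by (rule R.minus_equality) (simp_all add: L0_zero L0_class_add)
    then have "a \<ominus>\<^bsub>L0 m\<^esub> ?c = a \<oplus>\<^bsub>L0 m\<^esub> L0_class m (\<lambda>_. - of_rat c)" by (simp add: a_minus_def)
    moreover have "AE x in m. L0_rep (L0_class m (\<lambda>_. - real_of_rat c)) x = - of_rat c"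
      by (rule L0_rep_class) simp
    moreover have "AE x in m. L0_rep (a \<oplus>\<^bsub>L0 m\<^esub> L0_class m (\<lambda>_. - of_rat c)) x = L0_rep a x + L0_rep (L0_class m (\<lambda>_. - real_of_rat c)) x"
      by (rule L0_rep_add) (auto simp: a)
    ultimately show ?thesis by (auto elim: eventually_elim2)
  qed
  moreover have "AE x in m. pn M ((a \<odot> T v) \<ominus> (?c \<odot> T v)) x = \<bar>L0_rep (a \<ominus>\<^bsub>L0 m\<^esub> ?c) x\<bar> * pn M (T v) x"
    unfolding diff_smult_left[OF a(1,3,2)] by (rule pn_smult[OF R.minus_closed[OF a(1,3)] a(2)])
  moreover have "AE x in m. pn M (((a \<odot> T v) \<oplus> ?l) \<ominus> ((?c \<odot> T v) \<oplus> ?r)) x \<le>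
      pn M ((a \<odot> T v) \<ominus> (?c \<odot> T v)) x + pn M (?l \<ominus> ?r) x"
    using a l by (intro pn_diff_add smult_closed)
  moreover note Cons.IH[OF xs(1)]
  ultimately show ?case
    by eventually_elim (simp add: y)
qed

end

text \<open>Constants are the coefficients that make sense over both base measures. For them the
  combination can be formed in \<open>M\<close> before \<open>T\<close> is applied, which reduces a
  sum to a single vector.\<close>

lemma (in nmod_map) dominated_lincomb_const:
  assumes T: "dominated_map mX mY f M N T" and vs: "set vs \<subseteq> carrier M"
  shows "lincomb N T (const_scalars mX cs vs) = T (lincomb M (\<lambda>v. v) (const_scalars mY cs vs))"
  using vs
proof (induction cs arbitrary: vs)
  case Nil
  show ?case by (simp add: dominated_zero[OF T])
next
  case (Cons c cs)
  show ?case
  proof (cases vs)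
    case Nil
    then show ?thesis by (simp add: dominated_zero[OF T])
  next
    case (Cons w ws)
    then have "lincomb M (\<lambda>v. v) (const_scalars mY cs ws) \<in> carrier M"
      using \<open>set vs \<subseteq> carrier M\<close> by (intro M.lincomb_closed[OF M.const_scalars_carrier[of ws "carrier M"]]) auto
    then show ?thesis using Cons Cons.IH[of ws] \<open>set vs \<subseteq> carrier M\<close>
      by (simp add: dominated_mapD[OF T])
  qed
qed

text \<open>It suffices to compare the two norms for constant rational coefficients: almost everywhere, all
  of these countably many inequalities hold at once, and the coefficients at a point can be
  approximated by rational numbers.\<close>

lemma lincomb_dominated:
  assumes P: "nmod_map mX mY f M P" and N: "nmod_map mX mY f M N"
    and p: "dominated_map mX mY f M P p" and T: "dominated_map mX mY f M N T"
    and iso: "\<And>v. v \<in> carrier M \<Longrightarrow> AE x in mX. pn P (p v) x = pn M v (f x)"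
    and xs: "set xs \<subseteq> carrier (L0 mX) \<times> carrier M"
  shows "AE x in mX. pn N (lincomb N T xs) x \<le> pn P (lincomb P p xs) x"
proof -
  interpret P: nmod_map mX mY f M P by (rule P)
  interpret N: nmod_map mX mY f M N by (rule N)
  have pc: "p \<in> carrier M \<rightarrow> carrier P" and Tc: "T \<in> carrier M \<rightarrow> carrier N"
    using dominated_mapD(1)[OF p] dominated_mapD(1)[OF T] by auto
  have vs: "set (map snd xs) \<subseteq> carrier M" using xs by auto
  let ?LN = "\<lambda>cs. lincomb N T (const_scalars mX cs (map snd xs))"
  let ?LP = "\<lambda>cs. lincomb P p (const_scalars mX cs (map snd xs))"
  \<comment> \<open>The absolute values make the weight nonnegative at every point, as
    \<open>scalar_error_small\<close> asks.\<close>
  let ?u = "\<lambda>v x. \<bar>pn N (T v) x\<bar> + \<bar>pn P (p v) x\<bar>"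
  \<comment> \<open>The factor 2 accounts for one replacement of coefficients in \<open>N\<close>
    and one in \<open>P\<close>.\<close>
  have "AE x in mX. \<forall>cs. length cs = length xs \<longrightarrow>
      pn N (lincomb N T xs) x \<le> pn P (lincomb P p xs) x + 2 * scalar_error ?u cs xs x"
    unfolding AE_all_countable
  proof
    fix cs :: "rat list"
    show "AE x in mX. length cs = length xs \<longrightarrow>
      pn N (lincomb N T xs) x \<le> pn P (lincomb P p xs) x + 2 * scalar_error ?u cs xs x"
    proof (cases "length cs = length xs")
      case True
      let ?v = "lincomb M (\<lambda>v. v) (const_scalars mY cs (map snd xs))"
      have cN: "lincomb N T xs \<in> carrier N" "?LN cs \<in> carrier N"
        using N.N.lincomb_closed[OF xs Tc] N.N.lincomb_closed[OF N.N.const_scalars_carrier[OF vs] Tc] by auto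
      have cP: "lincomb P p xs \<in> carrier P" "?LP cs \<in> carrier P"
        using P.N.lincomb_closed[OF xs pc] P.N.lincomb_closed[OF P.N.const_scalars_carrier[OF vs] pc] by auto
      have v: "?v \<in> carrier M"
        by (rule P.M.lincomb_closed[OF P.M.const_scalars_carrier[OF vs]]) auto
      have "AE x in mX. pn N (?LN cs) x \<le> pn P (?LP cs) x"
        unfolding N.dominated_lincomb_const[OF T vs] P.dominated_lincomb_const[OF p vs]
        using iso[OF v] dominated_mapD(4)[OF T v] by eventually_elim simp
      with P.N.lincomb_error[OF xs pc True] N.N.lincomb_error[OF xs Tc True]
        N.N.pn_le_add_diff[OF cN] P.N.pn_le_add_diff[OF cP(2,1)] P.N.pn_diff_swap[OF cP]
      show ?thesis
      proof eventually_elim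
        case (elim x)
        have "scalar_error (\<lambda>v. pn N (T v)) cs xs x \<le> scalar_error ?u cs xs x"
          "scalar_error (\<lambda>v. pn P (p v)) cs xs x \<le> scalar_error ?u cs xs x"
          by (intro scalar_error_mono; simp)+
        with elim show ?case by simp
      qed
    qed simp
  qed
  then show ?thesis
  proof eventually_elim
    case (elim x)
    show ?case
    proof (rule field_le_epsilon)
      fix e :: real assume "e > 0"
      \<comment> \<open>This list depends on the point, which is harmless: the exceptional null set
        was fixed for all lists beforehand.\<close>
      then obtain cs where "length cs = length xs" "scalar_error ?u cs xs x < e/2"
        using scalar_error_small[of "e/2" ?u x xs] by auto
      with elim[rule_format, of cs] show "pn N (lincomb N T xs) x \<le> pn P (lincomb P p xs) x + e" by simp
    qed
  qed
qed

section \<open>The universal property of the pullback\<close>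

lemma pullback_dominated: "is_pullback mX mY f M P p \<Longrightarrow> dominated_map mX mY f M P p"
  by (auto simp: is_pullback_def dominated_map_def elim!: ballE intro: eventually_mono)

text \<open>The value at a combination of vectors \<open>p v\<close> is forced to be the same
  combination of the \<open>T v\<close>. By \<open>lincomb_dominated\<close> this assignment does
  not increase norms, so it extends to the closure of the span, which is all of \<open>P\<close>;
  two morphisms agreeing on the \<open>p v\<close> agree there too.\<close>

theorem pullback_universal:
  assumes P: "nmod_map mX mY f M P" and N: "nmod_map mX mY f M N" and complete: "ae_complete mX N"
    and p: "is_pullback mX mY f M P p" and T: "dominated_map mX mY f M N T"
  shows "\<exists>!\<theta>. \<theta> \<in> nm_mor mX P N \<and> (\<forall>v\<in>carrier M. \<theta> (p v) = T v)"
proof -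
  interpret P: nmod_map mX mY f M P by (rule P)
  interpret N: nmod_map mX mY f M N by (rule N)
  interpret PN: nmod_map mX mX "\<lambda>x. x" P N by unfold_locales
  note pd = pullback_dominated[OF p]
  have pc: "p \<in> carrier M \<rightarrow> carrier P" and Tc: "T \<in> carrier M \<rightarrow> carrier N"
    using dominated_mapD(1)[OF pd] dominated_mapD(1)[OF T] by auto
  have iso: "AE x in mX. pn P (p v) x = pn M v (f x)" if "v \<in> carrier M" for v
    using p that by (auto simp: is_pullback_def)
  have gen: "generates mX P (p ` carrier M)" using p by (auto simp: is_pullback_def)
  let ?X = "carrier (L0 mX) \<times> carrier M"
  have dense: "\<exists>xs. (\<forall>n. set (xs n) \<subseteq> ?X) \<and> ae_tendsto mX P (\<lambda>n. lincomb P p (xs n)) w" if w: "w \<in> carrier P" for w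
  proof -
    obtain s where s: "s \<in> UNIV \<rightarrow> L0_span mX P (p ` carrier M)" "ae_tendsto mX P s w"
      using pc by (rule_tac P.N.span_ae_dense[OF gen w P.N.L0_span_closed]) auto
    have "\<forall>n. \<exists>xs. set xs \<subseteq> ?X \<and> s n = lincomb P p xs"
    proof
      fix n have "s n \<in> L0_span mX P (p ` carrier M)" using s(1) by auto
      then obtain xs where "set xs \<subseteq> ?X" "s n = lincomb P p xs"
        by (rule P.N.L0_span_lincomb[OF _ pc])
      then show "\<exists>xs. set xs \<subseteq> ?X \<and> s n = lincomb P p xs" by blast
    qed
    from choice[OF this] obtain xs where xs: "\<And>n. set (xs n) \<subseteq> ?X \<and> s n = lincomb P p (xs n)" by blast
    then have "s = (\<lambda>n. lincomb P p (xs n))" by (simp add: fun_eq_iff)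
    with s(2) xs show ?thesis by blast
  qed
  \<comment> \<open>A relation, since different lists can represent one element of \<open>P\<close>.
    That it is single-valued comes out of the norm bound in
    \<open>dominated_extension\<close>.\<close>
  define G where "G = (\<lambda>xs. (lincomb P p xs, lincomb N T xs)) ` {xs. set xs \<subseteq> ?X}"
  have GI: "(lincomb P p xs, lincomb N T xs) \<in> G" if "set xs \<subseteq> ?X" for xs using that by (auto simp: G_def)
  have GE: "\<exists>xs. set xs \<subseteq> ?X \<and> v = lincomb P p xs \<and> w = lincomb N T xs" if "(v, w) \<in> G" for v w
    using that by (auto simp: G_def)
  have scale: "(b \<odot>\<^bsub>P\<^esub> v, b \<odot>\<^bsub>N\<^esub> w) \<in> G" if b: "b \<in> carrier (L0 mX)" and vw: "(v, w) \<in> G" for b v w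
  proof -
    obtain xs where xs: "set xs \<subseteq> ?X" "v = lincomb P p xs" "w = lincomb N T xs" using GE[OF vw] by auto
    show ?thesis
      unfolding xs(2,3) P.N.lincomb_smult[OF xs(1) pc b, symmetric] N.N.lincomb_smult[OF xs(1) Tc b, symmetric]
      by (rule GI) (use xs(1) b in auto)
  qed
  obtain \<theta> where \<theta>: "dominated_map mX mX (\<lambda>x. x) P N \<theta>" "\<theta> \<in> extensional (carrier P)"
      "\<And>v w. (v, w) \<in> G \<Longrightarrow> \<theta> v = w"
      "\<And>a b v. a \<in> carrier (L0 mX) \<Longrightarrow> b \<in> carrier (L0 mX) \<Longrightarrow>
       (\<And>v w. (v, w) \<in> G \<Longrightarrow> (a \<odot>\<^bsub>P\<^esub> v, b \<odot>\<^bsub>N\<^esub> w) \<in> G) \<Longrightarrow> v \<in> carrier P \<Longrightarrow> \<theta> (a \<odot>\<^bsub>P\<^esub> v) = b \<odot>\<^bsub>N\<^esub> \<theta> v"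
  proof (rule PN.dominated_extension[OF complete, of G])
    show "G \<subseteq> carrier P \<times> carrier N"
      using P.N.lincomb_closed[OF _ pc] N.N.lincomb_closed[OF _ Tc] by (auto simp: G_def)
    show "AE x in mX. pn N w x \<le> pn P v x" if vw: "(v, w) \<in> G" for v w
    proof -
      obtain xs where xs: "set xs \<subseteq> ?X" "v = lincomb P p xs" "w = lincomb N T xs" using GE[OF vw] by auto
      show ?thesis unfolding xs(2,3) by (rule lincomb_dominated[OF P N pd T iso xs(1)])
    qed
    show "(v \<oplus>\<^bsub>P\<^esub> v', w \<oplus>\<^bsub>N\<^esub> w') \<in> G" if vw: "(v, w) \<in> G" "(v', w') \<in> G" for v w v' w'
    proof -
      obtain xs where xs: "set xs \<subseteq> ?X" "v = lincomb P p xs" "w = lincomb N T xs" using GE[OF vw(1)] by auto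
      obtain ys where ys: "set ys \<subseteq> ?X" "v' = lincomb P p ys" "w' = lincomb N T ys" using GE[OF vw(2)] by auto
      show ?thesis
        unfolding xs(2,3) ys(2,3) P.N.lincomb_append[OF xs(1) ys(1) pc, symmetric]
          N.N.lincomb_append[OF xs(1) ys(1) Tc, symmetric]
        by (rule GI) (use xs(1) ys(1) in auto)
    qed
    show "\<exists>s t. (\<forall>n. (s n, t n) \<in> G) \<and> ae_tendsto mX P s w" if w: "w \<in> carrier P" for w
    proof -
      obtain xs where xs: "\<forall>n. set (xs n) \<subseteq> ?X" "ae_tendsto mX P (\<lambda>n. lincomb P p (xs n)) w" using dense[OF w] by auto
      with GI show ?thesis
        by (intro exI[of _ "\<lambda>n. lincomb P p (xs n)"] exI[of _ "\<lambda>n. lincomb N T (xs n)"]) auto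
    qed
  qed (use scale in auto)
  have \<theta>mor: "\<theta> \<in> nm_mor mX P N"
    using dominated_mapD[OF \<theta>(1)] \<theta>(2) \<theta>(4) scale by (auto simp: nm_mor_def PiE_def)
  have \<theta>p: "\<theta> (p v) = T v" if v: "v \<in> carrier M" for v
  proof (rule \<theta>(3))
    have c: "p v \<in> carrier P" "T v \<in> carrier N" using pc Tc v by auto
    show "(p v, T v) \<in> G" using GI[of "[(\<one>\<^bsub>L0 mX\<^esub>, v)]"] v c by simp
  qed
  show ?thesis
  proof (rule ex1I[of _ \<theta>])
    show "\<theta> \<in> nm_mor mX P N \<and> (\<forall>v\<in>carrier M. \<theta> (p v) = T v)" using \<theta>mor \<theta>p by blast
  next
    fix \<theta>' assume \<theta>': "\<theta>' \<in> nm_mor mX P N \<and> (\<forall>v\<in>carrier M. \<theta>' (p v) = T v)"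
    then have m': "dominated_map mX mX (\<lambda>x. x) P N \<theta>'" using nm_mor_dominated by blast
    have lin: "\<theta>'' (lincomb P p xs) = lincomb N T xs"
      if xs: "set xs \<subseteq> ?X" and \<theta>'': "\<theta>'' \<in> nm_mor mX P N" "\<forall>v\<in>carrier M. \<theta>'' (p v) = T v" for xs \<theta>''
      using xs
    proof (induction xs)
      case Nil
      show ?case using PN.dominated_zero[OF nm_mor_dominated[OF \<theta>''(1)]] by simp
    next
      case (Cons y xs)
      obtain a v where y: "y = (a, v)" by (cases y)
      have c: "a \<in> carrier (L0 mX)" "p v \<in> carrier P" "v \<in> carrier M" "lincomb P p xs \<in> carrier P"
        using Cons.prems pc P.N.lincomb_closed[OF _ pc, of xs] by (auto simp: y)
      then have "\<theta>'' ((a \<odot>\<^bsub>P\<^esub> p v) \<oplus>\<^bsub>P\<^esub> lincomb P p xs) = (a \<odot>\<^bsub>N\<^esub> \<theta>'' (p v)) \<oplus>\<^bsub>N\<^esub> \<theta>'' (lincomb P p xs)"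
        using \<theta>''(1) P.N.smult_closed[OF c(1,2)] by (auto simp: nm_mor_def)
      with Cons c \<theta>''(2) show ?case by (simp add: y)
    qed
    show "\<theta>' = \<theta>"
    proof (rule extensionalityI[of _ "carrier P"])
      show "\<theta>' \<in> extensional (carrier P)" using \<theta>' by (auto simp: nm_mor_def PiE_def)
      fix w assume w: "w \<in> carrier P"
      obtain xs where xs: "\<forall>n. set (xs n) \<subseteq> ?X" "ae_tendsto mX P (\<lambda>n. lincomb P p (xs n)) w" using dense[OF w] by auto
      show "\<theta>' w = \<theta> w"
      proof (rule PN.dominated_unique[OF m' \<theta>(1) _ _ _ xs(2) w])
        let ?D = "lincomb P p ` {xs. set xs \<subseteq> ?X}"
        show "?D \<subseteq> carrier P" using P.N.lincomb_closed[OF _ pc] by auto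
        show "\<theta>' d = \<theta> d" if d: "d \<in> ?D" for d
        proof -
          obtain xs where "set xs \<subseteq> ?X" "d = lincomb P p xs" using d by blast
          then show ?thesis using lin[of xs \<theta>'] lin[of xs \<theta>] \<theta>' \<theta>mor \<theta>p by metis
        qed
        show "(\<lambda>n. lincomb P p (xs n)) \<in> UNIV \<rightarrow> ?D" using xs(1) by auto
      qed
    qed (rule \<theta>(2))
  qed
qed

section \<open>Completion\<close>

definition Cauchy_seqs :: "'x measure \<Rightarrow> ('x, 'b) L0_nmodule \<Rightarrow> (nat \<Rightarrow> 'b) set" where
  "Cauchy_seqs m M = {s \<in> UNIV \<rightarrow> carrier M. ae_Cauchy m M s}"

definition Cauchy_class :: "'x measure \<Rightarrow> ('x, 'b) L0_nmodule \<Rightarrow> (nat \<Rightarrow> 'b) \<Rightarrow> (nat \<Rightarrow> 'b) set" where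
  "Cauchy_class m M s = {t \<in> Cauchy_seqs m M. AE x in m. (\<lambda>n. pn M (s n \<ominus>\<^bsub>M\<^esub> t n) x) \<longlonglongrightarrow> 0}"

definition Cauchy_rep :: "(nat \<Rightarrow> 'b) set \<Rightarrow> nat \<Rightarrow> 'b" where
  "Cauchy_rep X = (SOME s. s \<in> X)"

text \<open>The elements are sets of sequences, a type determined by that of \<open>M\<close>; for
  the algebraic limit it is the type at which the universal property of \<open>L\<close> is used.
  The norm is the pointwise limit along a chosen sequence, with an arbitrary value on the null set
  where the norms diverge.\<close>

definition completion :: "'x measure \<Rightarrow> ('x, 'b) L0_nmodule \<Rightarrow> ('x, (nat \<Rightarrow> 'b) set) L0_nmodule" where
  "completion m M = \<lparr>carrier = Cauchy_class m M ` Cauchy_seqs m M,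
     mult = undefined, one = undefined,
     zero = Cauchy_class m M (\<lambda>_. \<zero>\<^bsub>M\<^esub>),
     add = (\<lambda>X Y. Cauchy_class m M (\<lambda>n. Cauchy_rep X n \<oplus>\<^bsub>M\<^esub> Cauchy_rep Y n)),
     smult = (\<lambda>a X. Cauchy_class m M (\<lambda>n. a \<odot>\<^bsub>M\<^esub> Cauchy_rep X n)),
     pnorm = (\<lambda>X. L0_class m (\<lambda>x. lim (\<lambda>n. pn M (Cauchy_rep X n) x)))\<rparr>"

context pre_nmod begin

lemma Cauchy_seqsD: "s \<in> Cauchy_seqs m M \<Longrightarrow> s n \<in> carrier M" "s \<in> Cauchy_seqs m M \<Longrightarrow> ae_Cauchy m M s"
  by (auto simp: Cauchy_seqs_def)

lemma Cauchy_seqs_iff: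
  "s \<in> Cauchy_seqs m M \<longleftrightarrow> (\<forall>n. s n \<in> carrier M) \<and>
    (AE x in m. ((\<lambda>ij. pn M (s (fst ij) \<ominus> s (snd ij)) x) \<longlongrightarrow> 0) (sequentially \<times>\<^sub>F sequentially))"
  using ae_Cauchy_iff_null[of s] by (auto simp: Cauchy_seqs_def)

lemmas Cauchy_seqs_null = Cauchy_seqs_iff[THEN iffD1, THEN conjunct2]

lemma Cauchy_seqs_add:
  assumes s: "s \<in> Cauchy_seqs m M" and t: "t \<in> Cauchy_seqs m M"
  shows "(\<lambda>n. s n \<oplus> t n) \<in> Cauchy_seqs m M"
  unfolding Cauchy_seqs_iff
proof (intro conjI allI)
  note c = Cauchy_seqsD(1)[OF s] Cauchy_seqsD(1)[OF t]
  show "s n \<oplus> t n \<in> carrier M" for n by (intro M.a_closed c)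
  show "AE x in m. ((\<lambda>ij. pn M ((s (fst ij) \<oplus> t (fst ij)) \<ominus> (s (snd ij) \<oplus> t (snd ij))) x) \<longlongrightarrow> 0)
      (sequentially \<times>\<^sub>F sequentially)"
    by (rule AE_null_add[OF _ _ Cauchy_seqs_null[OF s] Cauchy_seqs_null[OF t]])
      (intro pn_nonneg pn_diff_add M.minus_closed M.a_closed c)+
qed

lemma Cauchy_seqs_smult:
  assumes s: "s \<in> Cauchy_seqs m M" and a: "a \<in> carrier (L0 m)"
  shows "(\<lambda>n. a \<odot> s n) \<in> Cauchy_seqs m M"
  unfolding Cauchy_seqs_iff
proof (intro conjI allI)
  note c = Cauchy_seqsD(1)[OF s]
  show "a \<odot> s n \<in> carrier M" for n by (intro smult_closed a c)
  show "AE x in m. ((\<lambda>ij. pn M ((a \<odot> s (fst ij)) \<ominus> (a \<odot> s (snd ij))) x) \<longlongrightarrow> 0) (sequentially \<times>\<^sub>F sequentially)"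
    by (rule AE_null_mult[OF pn_diff_smult[OF a c c] Cauchy_seqs_null[OF s]])
qed

lemma Cauchy_seqs_const: "v \<in> carrier M \<Longrightarrow> (\<lambda>_. v) \<in> Cauchy_seqs m M"
  using ae_tendsto_Cauchy[OF _ _ ae_tendsto_const, of v] by (auto simp: Cauchy_seqs_def)

lemma Cauchy_seqs_uminus:
  assumes "s \<in> Cauchy_seqs m M" shows "(\<lambda>n. \<ominus> s n) \<in> Cauchy_seqs m M"
proof -
  have "(\<lambda>n. \<ominus> s n) = (\<lambda>n. L0_class m (\<lambda>_. -1) \<odot> s n)"
    using minus_one_smult[OF Cauchy_seqsD(1)[OF assms]] by simp
  then show ?thesis using Cauchy_seqs_smult[OF assms] by simp
qed

lemma Cauchy_class_eq_iff:
  assumes s: "s \<in> Cauchy_seqs m M" and t: "t \<in> Cauchy_seqs m M"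
  shows "Cauchy_class m M s = Cauchy_class m M t \<longleftrightarrow> (AE x in m. (\<lambda>n. pn M (s n \<ominus> t n) x) \<longlonglongrightarrow> 0)"
    (is "?L \<longleftrightarrow> ?R s t")
proof
  have refl: "?R t t"
    using AE_all_countable[of "\<lambda>n x. pn M (t n \<ominus> t n) x = 0" m] pn_diff_self[OF Cauchy_seqsD(1)[OF t]]
    by (auto elim: eventually_mono)
  assume ?L
  then have "t \<in> Cauchy_class m M s" using refl t by (auto simp: Cauchy_class_def)
  then show "?R s t" by (auto simp: Cauchy_class_def)
next
  have tr: "?R u w" if "?R u v" "?R w v" "u \<in> Cauchy_seqs m M" "v \<in> Cauchy_seqs m M" "w \<in> Cauchy_seqs m M" for u v w
  proof -
    note c = Cauchy_seqsD(1)[OF that(3)] Cauchy_seqsD(1)[OF that(4)] Cauchy_seqsD(1)[OF that(5)]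
    show ?thesis
      by (rule AE_null_add[OF _ _ that(1,2)]) (intro pn_nonneg pn_diff_triangle_right M.minus_closed c)+
  qed
  have sym: "?R v u" if "?R u v" "u \<in> Cauchy_seqs m M" "v \<in> Cauchy_seqs m M" for u v
  proof -
    have "AE x in m. \<forall>n. pn M (u n \<ominus> v n) x = pn M (v n \<ominus> u n) x"
      unfolding AE_all_countable by (intro allI pn_diff_swap Cauchy_seqsD that)
    with that(1) show ?thesis by eventually_elim simp
  qed
  assume R: "?R s t"
  have "?R s u \<longleftrightarrow> ?R t u" if u: "u \<in> Cauchy_seqs m M" for u
  proof
    assume "?R s u"
    from sym[OF tr[OF sym[OF this s u] sym[OF R s t] u s t] u t] show "?R t u" .
  next
    assume "?R t u"
    from tr[OF R sym[OF this t u] s t u] show "?R s u" .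
  qed
  then show ?L unfolding Cauchy_class_def by (intro Collect_cong conj_cong refl)
qed

lemma Cauchy_class_self: "s \<in> Cauchy_seqs m M \<Longrightarrow> s \<in> Cauchy_class m M s"
  using Cauchy_class_eq_iff[of s s] by (simp add: Cauchy_class_def)

lemma Cauchy_rep_class:
  assumes s: "s \<in> Cauchy_seqs m M"
  shows "Cauchy_rep (Cauchy_class m M s) \<in> Cauchy_seqs m M"
    and "AE x in m. (\<lambda>n. pn M (s n \<ominus> Cauchy_rep (Cauchy_class m M s) n) x) \<longlonglongrightarrow> 0"
proof -
  have "Cauchy_rep (Cauchy_class m M s) \<in> Cauchy_class m M s"
    unfolding Cauchy_rep_def by (rule someI[of "\<lambda>t. t \<in> Cauchy_class m M s", OF Cauchy_class_self[OF s]])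
  then show "Cauchy_rep (Cauchy_class m M s) \<in> Cauchy_seqs m M"
    "AE x in m. (\<lambda>n. pn M (s n \<ominus> Cauchy_rep (Cauchy_class m M s) n) x) \<longlonglongrightarrow> 0"
    by (auto simp: Cauchy_class_def)
qed

lemma completion_carrier: "carrier (completion m M) = Cauchy_class m M ` Cauchy_seqs m M"
  and completion_zero: "\<zero>\<^bsub>completion m M\<^esub> = Cauchy_class m M (\<lambda>_. \<zero>)"
  by (simp_all add: completion_def)

lemma completion_add:
  assumes s: "s \<in> Cauchy_seqs m M" and t: "t \<in> Cauchy_seqs m M"
  shows "Cauchy_class m M s \<oplus>\<^bsub>completion m M\<^esub> Cauchy_class m M t = Cauchy_class m M (\<lambda>n. s n \<oplus> t n)"
proof -
  let ?s = "Cauchy_rep (Cauchy_class m M s)" and ?t = "Cauchy_rep (Cauchy_class m M t)"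
  note s' = Cauchy_rep_class[OF s] and t' = Cauchy_rep_class[OF t]
  note c = Cauchy_seqsD(1)[OF s] Cauchy_seqsD(1)[OF s'(1)] Cauchy_seqsD(1)[OF t] Cauchy_seqsD(1)[OF t'(1)]
  have "AE x in m. (\<lambda>n. pn M ((s n \<oplus> t n) \<ominus> (?s n \<oplus> ?t n)) x) \<longlonglongrightarrow> 0"
    by (rule AE_null_add[OF _ _ s'(2) t'(2)]) (intro pn_nonneg pn_diff_add M.minus_closed M.a_closed c)+
  then have "Cauchy_class m M (\<lambda>n. s n \<oplus> t n) = Cauchy_class m M (\<lambda>n. ?s n \<oplus> ?t n)"
    using Cauchy_class_eq_iff[OF Cauchy_seqs_add[OF s t] Cauchy_seqs_add[OF s'(1) t'(1)]] by blast
  then show ?thesis by (simp add: completion_def)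
qed

lemma completion_smult:
  assumes s: "s \<in> Cauchy_seqs m M" and a: "a \<in> carrier (L0 m)"
  shows "a \<odot>\<^bsub>completion m M\<^esub> Cauchy_class m M s = Cauchy_class m M (\<lambda>n. a \<odot> s n)"
proof -
  let ?s = "Cauchy_rep (Cauchy_class m M s)"
  note s' = Cauchy_rep_class[OF s]
  note c = Cauchy_seqsD(1)[OF s] Cauchy_seqsD(1)[OF s'(1)]
  have "AE x in m. (\<lambda>n. pn M ((a \<odot> s n) \<ominus> (a \<odot> ?s n)) x) \<longlonglongrightarrow> 0"
    by (rule AE_null_mult[OF pn_diff_smult[OF a c] s'(2)])
  then have "Cauchy_class m M (\<lambda>n. a \<odot> s n) = Cauchy_class m M (\<lambda>n. a \<odot> ?s n)"
    using Cauchy_class_eq_iff[OF Cauchy_seqs_smult[OF s a] Cauchy_seqs_smult[OF s'(1) a]] by blast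
  then show ?thesis by (simp add: completion_def)
qed

lemma Cauchy_seqs_pn_convergent:
  assumes s: "s \<in> Cauchy_seqs m M"
  shows "AE x in m. (\<lambda>n. pn M (s n) x) \<longlonglongrightarrow> lim (\<lambda>n. pn M (s n) x)"
proof -
  have "AE x in m. \<forall>i j. \<bar>pn M (s i) x - pn M (s j) x\<bar> \<le> pn M (s i \<ominus> s j) x"
    unfolding AE_all_countable by (intro allI pn_dist_le Cauchy_seqsD s)
  with Cauchy_seqsD(2)[OF s] show ?thesis unfolding ae_Cauchy_def
  proof eventually_elim
    case (elim x)
    have "Cauchy (\<lambda>n. pn M (s n) x)"
      unfolding Cauchy_def dist_real_def
    proof (intro allI impI)
      fix e :: real assume "e > 0"
      then obtain K where "\<forall>i\<ge>K. \<forall>j\<ge>K. pn M (s i \<ominus> s j) x < e" using elim(1) by blast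
      then show "\<exists>K. \<forall>i\<ge>K. \<forall>j\<ge>K. \<bar>pn M (s i) x - pn M (s j) x\<bar> < e"
        using elim(2) by (meson le_less_trans)
    qed
    then show ?case by (simp add: Cauchy_convergent_iff convergent_LIMSEQ_iff)
  qed
qed

lemma lim_pn_measurable:
  "s \<in> Cauchy_seqs m M \<Longrightarrow> (\<lambda>x. lim (\<lambda>n. pn M (s n) x)) \<in> borel_measurable m"
  by (intro borel_measurable_lim_metric pn_measurable Cauchy_seqsD)

text \<open>The norm of a class can be computed along any of its sequences, so each axiom for the
  norm of the completion is a limit of the same axiom in \<open>M\<close>.\<close>

lemma completion_pn:
  assumes s: "s \<in> Cauchy_seqs m M"
  shows "AE x in m. (\<lambda>n. pn M (s n) x) \<longlonglongrightarrow> pn (completion m M) (Cauchy_class m M s) x"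
proof -
  let ?s = "Cauchy_rep (Cauchy_class m M s)"
  note s' = Cauchy_rep_class[OF s]
  have "AE x in m. pn (completion m M) (Cauchy_class m M s) x = lim (\<lambda>n. pn M (?s n) x)"
    unfolding pn_def[of "completion m M"] using L0_rep_class[OF lim_pn_measurable[OF s'(1)]]
    by (simp add: completion_def)
  moreover have "AE x in m. \<forall>n. \<bar>pn M (s n) x - pn M (?s n) x\<bar> \<le> pn M (s n \<ominus> ?s n) x"
    unfolding AE_all_countable by (intro allI pn_dist_le Cauchy_seqsD s s')
  ultimately show ?thesis using Cauchy_seqs_pn_convergent[OF s'(1)] s'(2)
  proof eventually_elim
    case (elim x)
    have "(\<lambda>n. pn M (s n) x - pn M (?s n) x) \<longlonglongrightarrow> 0"
      by (rule Lim_null_comparison[OF _ elim(4)]) (use elim(2) in auto)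
    from tendsto_add[OF this elim(3)] show ?case unfolding elim(1) by simp
  qed
qed

lemma completion_pre_nmod: "pre_nmod m (completion m M)"
proof -
  let ?C = "completion m M" and ?cl = "Cauchy_class m M" and ?S = "Cauchy_seqs m M"
  have closed: "?cl s \<in> carrier ?C" if "s \<in> ?S" for s using that by (simp add: completion_carrier)
  have ex: "\<exists>s\<in>?S. X = ?cl s" if "X \<in> carrier ?C" for X using that by (auto simp: completion_carrier)
  note zero = Cauchy_seqs_const[OF M.zero_closed]
  note rules = completion_zero completion_add completion_smult Cauchy_seqs_add Cauchy_seqs_smult Cauchy_seqs_uminus
    closed zero M.a_ac M.r_neg smult_l_distr smult_r_distr smult_assoc1
  have ab: "abelian_group ?C"
  proof (rule abelian_groupI)
    fix X Y assume "X \<in> carrier ?C" "Y \<in> carrier ?C"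
    then obtain s t where "s \<in> ?S" "t \<in> ?S" "X = ?cl s" "Y = ?cl t" using ex by metis
    note st = this Cauchy_seqsD(1)[OF this(1)] Cauchy_seqsD(1)[OF this(2)]
    show "X \<oplus>\<^bsub>?C\<^esub> Y \<in> carrier ?C" "X \<oplus>\<^bsub>?C\<^esub> Y = Y \<oplus>\<^bsub>?C\<^esub> X" by (simp_all add: st rules)
    fix Z assume "Z \<in> carrier ?C"
    then obtain u where "u \<in> ?S" "Z = ?cl u" using ex by metis
    note u = this Cauchy_seqsD(1)[OF this(1)]
    show "(X \<oplus>\<^bsub>?C\<^esub> Y) \<oplus>\<^bsub>?C\<^esub> Z = X \<oplus>\<^bsub>?C\<^esub> (Y \<oplus>\<^bsub>?C\<^esub> Z)" by (simp add: st u rules)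
  next
    show "\<zero>\<^bsub>?C\<^esub> \<in> carrier ?C" by (simp add: rules)
  next
    fix X assume "X \<in> carrier ?C"
    then obtain s where "s \<in> ?S" "X = ?cl s" using ex by metis
    note s = this Cauchy_seqsD(1)[OF this(1)]
    show "\<zero>\<^bsub>?C\<^esub> \<oplus>\<^bsub>?C\<^esub> X = X" by (simp add: s rules)
    show "\<exists>Y\<in>carrier ?C. Y \<oplus>\<^bsub>?C\<^esub> X = \<zero>\<^bsub>?C\<^esub>"
      by (intro bexI[OF _ closed[OF Cauchy_seqs_uminus[OF s(1)]]]) (simp add: s rules)
  qed
  have md: "module (L0 m) ?C"
  proof (rule moduleI[OF R.is_cring ab])
    fix a X assume a: "a \<in> carrier (L0 m)" and "X \<in> carrier ?C"
    then obtain s where "s \<in> ?S" "X = ?cl s" using ex by metis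
    note s = this Cauchy_seqsD(1)[OF this(1)]
    show "a \<odot>\<^bsub>?C\<^esub> X \<in> carrier ?C" by (simp add: s a rules)
    fix b assume b: "b \<in> carrier (L0 m)"
    show "(a \<oplus>\<^bsub>L0 m\<^esub> b) \<odot>\<^bsub>?C\<^esub> X = (a \<odot>\<^bsub>?C\<^esub> X) \<oplus>\<^bsub>?C\<^esub> (b \<odot>\<^bsub>?C\<^esub> X)"
      "(a \<otimes>\<^bsub>L0 m\<^esub> b) \<odot>\<^bsub>?C\<^esub> X = a \<odot>\<^bsub>?C\<^esub> (b \<odot>\<^bsub>?C\<^esub> X)"
      by (simp_all add: s a b rules)
  next
    fix a X Y assume a: "a \<in> carrier (L0 m)" and "X \<in> carrier ?C" "Y \<in> carrier ?C"
    then obtain s t where "s \<in> ?S" "t \<in> ?S" "X = ?cl s" "Y = ?cl t" using ex by metis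
    note st = this Cauchy_seqsD(1)[OF this(1)] Cauchy_seqsD(1)[OF this(2)]
    show "a \<odot>\<^bsub>?C\<^esub> (X \<oplus>\<^bsub>?C\<^esub> Y) = (a \<odot>\<^bsub>?C\<^esub> X) \<oplus>\<^bsub>?C\<^esub> (a \<odot>\<^bsub>?C\<^esub> Y)" by (simp add: st a rules)
  next
    fix X assume "X \<in> carrier ?C"
    then obtain s where "s \<in> ?S" "X = ?cl s" using ex by metis
    then show "\<one>\<^bsub>L0 m\<^esub> \<odot>\<^bsub>?C\<^esub> X = X" using Cauchy_seqsD(1)[of s] by (simp add: rules)
  qed
  have "pointwise_norm m ?C"
    unfolding pointwise_norm_def
  proof (intro conjI ballI)
    show "pnorm ?C \<in> carrier ?C \<rightarrow> carrier (L0 m)"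
    proof
      fix X assume "X \<in> carrier ?C"
      then obtain s where s: "s \<in> ?S" "X = ?cl s" using ex by metis
      show "pnorm ?C X \<in> carrier (L0 m)"
        using L0_class_carrier[OF lim_pn_measurable[OF Cauchy_rep_class(1)[OF s(1)]]] by (simp add: completion_def s(2))
    qed
  next
    fix X assume "X \<in> carrier ?C"
    then obtain s where s: "s \<in> ?S" "X = ?cl s" using ex by metis
    have nn: "AE x in m. \<forall>n. 0 \<le> pn M (s n) x"
      unfolding AE_all_countable by (intro allI pn_nonneg Cauchy_seqsD s)
    with completion_pn[OF s(1)] show "AE x in m. 0 \<le> pn ?C X x"
      unfolding s(2) by eventually_elim (rule LIMSEQ_le_const, auto)
    have dz: "s n \<ominus> \<zero> = s n" for n by (rule diff_zero[OF Cauchy_seqsD(1)[OF s(1)]])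
    show "(AE x in m. pn ?C X x = 0) \<longleftrightarrow> X = \<zero>\<^bsub>?C\<^esub>"
      unfolding s(2) completion_zero Cauchy_class_eq_iff[OF s(1) zero] dz
    proof
      assume "AE x in m. pn ?C (?cl s) x = 0"
      with completion_pn[OF s(1)] show "AE x in m. (\<lambda>n. pn M (s n) x) \<longlonglongrightarrow> 0" by eventually_elim simp
    next
      assume "AE x in m. (\<lambda>n. pn M (s n) x) \<longlonglongrightarrow> 0"
      with completion_pn[OF s(1)] show "AE x in m. pn ?C (?cl s) x = 0"
        by eventually_elim (rule LIMSEQ_unique)
    qed
    fix a assume a: "a \<in> carrier (L0 m)"
    have "AE x in m. \<forall>n. pn M (a \<odot> s n) x = \<bar>L0_rep a x\<bar> * pn M (s n) x"
      unfolding AE_all_countable by (intro allI pn_smult a Cauchy_seqsD s)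
    with completion_pn[OF s(1)] completion_pn[OF Cauchy_seqs_smult[OF s(1) a]]
    show "AE x in m. pn ?C (a \<odot>\<^bsub>?C\<^esub> X) x = \<bar>L0_rep a x\<bar> * pn ?C X x"
      unfolding s(2) completion_smult[OF s(1) a]
    proof eventually_elim
      case (elim x)
      from LIMSEQ_unique[OF elim(2)] tendsto_mult_left[OF elim(1), of "\<bar>L0_rep a x\<bar>"] elim(3)
      show ?case by simp
    qed
  next
    fix X Y assume "X \<in> carrier ?C" "Y \<in> carrier ?C"
    then obtain s t where st: "s \<in> ?S" "t \<in> ?S" "X = ?cl s" "Y = ?cl t" using ex by metis
    have "AE x in m. \<forall>n. pn M (s n \<oplus> t n) x \<le> pn M (s n) x + pn M (t n) x"
      unfolding AE_all_countable by (intro allI pn_add Cauchy_seqsD st)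
    with completion_pn[OF st(1)] completion_pn[OF st(2)] completion_pn[OF Cauchy_seqs_add[OF st(1,2)]]
    show "AE x in m. pn ?C (X \<oplus>\<^bsub>?C\<^esub> Y) x \<le> pn ?C X x + pn ?C Y x"
      unfolding st completion_add[OF st(1,2)]
    proof eventually_elim
      case (elim x)
      show ?case by (rule LIMSEQ_le[OF elim(3) tendsto_add[OF elim(1,2)]]) (use elim(4) in auto)
    qed
  qed
  then show ?thesis using md by (intro pre_nmod.intro pre_nmod_axioms.intro sigma_finite_measure_axioms)
qed

definition embed :: "'b \<Rightarrow> (nat \<Rightarrow> 'b) set" where
  "embed v = Cauchy_class m M (\<lambda>_. v)"

lemma embed_closed: "v \<in> carrier M \<Longrightarrow> embed v \<in> carrier (completion m M)"
  by (auto simp: embed_def completion_carrier intro: Cauchy_seqs_const)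

lemma embed_add:
  "v \<in> carrier M \<Longrightarrow> w \<in> carrier M \<Longrightarrow> embed (v \<oplus> w) = embed v \<oplus>\<^bsub>completion m M\<^esub> embed w"
  by (simp add: embed_def completion_add Cauchy_seqs_const)

lemma embed_smult:
  "a \<in> carrier (L0 m) \<Longrightarrow> v \<in> carrier M \<Longrightarrow> embed (a \<odot> v) = a \<odot>\<^bsub>completion m M\<^esub> embed v"
  by (simp add: embed_def completion_smult Cauchy_seqs_const)

lemma pn_embed: "v \<in> carrier M \<Longrightarrow> AE x in m. pn (completion m M) (embed v) x = pn M v x"
  using completion_pn[OF Cauchy_seqs_const[of v]] unfolding embed_def
  by (auto elim!: eventually_mono simp: LIMSEQ_const_iff)

lemma completion_diff:
  assumes s: "s \<in> Cauchy_seqs m M" and t: "t \<in> Cauchy_seqs m M"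
  shows "Cauchy_class m M s \<ominus>\<^bsub>completion m M\<^esub> Cauchy_class m M t = Cauchy_class m M (\<lambda>n. s n \<ominus> t n)"
proof -
  interpret C: pre_nmod m "completion m M" by (rule completion_pre_nmod)
  have c: "Cauchy_class m M t \<in> carrier (completion m M)" using t by (simp add: completion_carrier)
  have "\<ominus>\<^bsub>completion m M\<^esub> Cauchy_class m M t = Cauchy_class m M (\<lambda>n. \<ominus> t n)"
    unfolding C.minus_one_smult[OF c, symmetric] completion_smult[OF t L0_class_carrier[OF borel_measurable_const]]
    using minus_one_smult[OF Cauchy_seqsD(1)[OF t]] by simp
  then show ?thesis
    unfolding a_minus_def using completion_add[OF s Cauchy_seqs_uminus[OF t]] by simp
qed

text \<open>The norm of the difference at stage \<open>k\<close> is the limit over \<open>n\<close>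
  of the norms of \<open>s k \<ominus> s n\<close>, which the Cauchy property makes small for large
  \<open>k\<close>.\<close>

lemma embed_tendsto:
  assumes s: "s \<in> Cauchy_seqs m M"
  shows "ae_tendsto m (completion m M) (\<lambda>k. embed (s k)) (Cauchy_class m M s)"
proof -
  let ?C = "completion m M"
  interpret C: pre_nmod m ?C by (rule completion_pre_nmod)
  note c = Cauchy_seqsD(1)[OF s]
  have diff: "(\<lambda>n. s k \<ominus> s n) \<in> Cauchy_seqs m M" for k
    unfolding a_minus_def by (intro Cauchy_seqs_add Cauchy_seqs_const Cauchy_seqs_uminus s c)
  have eq: "embed (s k) \<ominus>\<^bsub>?C\<^esub> Cauchy_class m M s = Cauchy_class m M (\<lambda>n. s k \<ominus> s n)" for k
    unfolding embed_def by (rule completion_diff[OF Cauchy_seqs_const[OF c] s])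
  have "AE x in m. \<forall>k. (\<lambda>n. pn M (s k \<ominus> s n) x) \<longlonglongrightarrow> pn ?C (embed (s k) \<ominus>\<^bsub>?C\<^esub> Cauchy_class m M s) x"
    unfolding AE_all_countable eq by (intro allI completion_pn diff)
  moreover have "AE x in m. \<forall>k. 0 \<le> pn ?C (embed (s k) \<ominus>\<^bsub>?C\<^esub> Cauchy_class m M s) x"
    unfolding AE_all_countable eq using diff by (intro allI C.pn_nonneg) (simp add: completion_carrier)
  ultimately show ?thesis using Cauchy_seqsD(2)[OF s] unfolding ae_tendsto_def ae_Cauchy_def
  proof eventually_elim
    case (elim x)
    show ?case
    proof (rule LIMSEQ_I)
      fix e :: real assume "e > 0"
      then obtain K where K: "\<And>i j. i \<ge> K \<Longrightarrow> j \<ge> K \<Longrightarrow> pn M (s i \<ominus> s j) x < e/2"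
        using elim(3)[rule_format, of "e/2"] by auto
      have "norm (pn ?C (embed (s k) \<ominus>\<^bsub>?C\<^esub> Cauchy_class m M s) x - 0) < e" if "k \<ge> K" for k
      proof -
        have "pn ?C (embed (s k) \<ominus>\<^bsub>?C\<^esub> Cauchy_class m M s) x \<le> e/2"
          by (rule LIMSEQ_le_const2[OF elim(1)[rule_format]]) (use K[OF that] in \<open>auto intro!: exI[of _ K] less_imp_le\<close>)
        with \<open>e > 0\<close> elim(2)[rule_format, of k] show ?thesis by simp
      qed
      then show "\<exists>K. \<forall>k\<ge>K. norm (pn ?C (embed (s k) \<ominus>\<^bsub>?C\<^esub> Cauchy_class m M s) x - 0) < e" by blast
    qed
  qed
qed

text \<open>By \<open>ae_complete_of_dense\<close> it suffices to find limits for sequences of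
  embedded elements. Since \<open>embed\<close> preserves norms, such a sequence comes from a Cauchy
  sequence in \<open>M\<close>, whose class is the limit.\<close>

theorem completion_nmod: "nmod m (completion m M)"
proof -
  let ?C = "completion m M"
  interpret C: pre_nmod m ?C by (rule completion_pre_nmod)
  have "ae_complete m ?C"
  proof (rule C.ae_complete_of_dense[of "embed ` carrier M"])
    show "embed ` carrier M \<subseteq> carrier ?C" using embed_closed by auto
  next
    fix X assume "X \<in> carrier ?C"
    then obtain s where s: "s \<in> Cauchy_seqs m M" "X = Cauchy_class m M s" by (auto simp: completion_carrier)
    have "(\<lambda>k. embed (s k)) \<in> UNIV \<rightarrow> embed ` carrier M" using Cauchy_seqsD(1)[OF s(1)] by auto
    with embed_tendsto[OF s(1)] s(2) show "\<exists>t. t \<in> UNIV \<rightarrow> embed ` carrier M \<and> ae_tendsto m ?C t X" by blast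
  next
    fix t assume t: "t \<in> UNIV \<rightarrow> embed ` carrier M" and C: "ae_Cauchy m ?C t"
    have "\<forall>n. \<exists>v. v \<in> carrier M \<and> t n = embed v" using t by blast
    from choice[OF this] obtain s where s: "\<And>n. s n \<in> carrier M" "\<And>n. t n = embed (s n)" by blast
    have "AE x in m. \<forall>i j. pn ?C (t i \<ominus>\<^bsub>?C\<^esub> t j) x = pn M (s i \<ominus> s j) x"
      unfolding AE_all_countable
    proof (intro allI)
      fix i j
      have "t i \<ominus>\<^bsub>?C\<^esub> t j = embed (s i \<ominus> s j)"
        unfolding s(2) embed_def by (rule completion_diff) (intro Cauchy_seqs_const s)+
      then show "AE x in m. pn ?C (t i \<ominus>\<^bsub>?C\<^esub> t j) x = pn M (s i \<ominus> s j) x"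
        using pn_embed[OF M.minus_closed[OF s(1,1)]] by simp
    qed
    with C have "ae_Cauchy m M s" unfolding ae_Cauchy_def by eventually_elim simp
    then have sC: "s \<in> Cauchy_seqs m M" using s(1) by (auto simp: Cauchy_seqs_def)
    have "t = (\<lambda>k. embed (s k))" using s(2) by auto
    with embed_tendsto[OF sC] sC show "\<exists>v\<in>carrier ?C. ae_tendsto m ?C t v" by (auto simp: completion_carrier)
  qed
  then show ?thesis using completion_pre_nmod by (intro nmod.intro nmod_axioms.intro)
qed

end

section \<open>The algebraic direct limit\<close>

text \<open>The function is required to be the infimum of a countable subfamily at every point. The
  \<open>max 0\<close> keeps these infima bounded below, since the \<open>F a\<close> of interest
  are nonnegative only almost everywhere.\<close>

definition is_ess_inf :: "'x measure \<Rightarrow> 'a set \<Rightarrow> ('a \<Rightarrow> 'x \<Rightarrow> real) \<Rightarrow> ('x \<Rightarrow> real) \<Rightarrow> bool" where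
  "is_ess_inf m A F g \<longleftrightarrow> g \<in> borel_measurable m \<and> (\<forall>a\<in>A. AE x in m. g x \<le> F a x) \<and>
     (\<exists>c::nat \<Rightarrow> 'a. range c \<subseteq> A \<and> (\<forall>x. g x = (INF n. max 0 (F (c n) x))))"

text \<open>The classical argument: among all infima of countable subfamilies, one has the smallest
  integral. Adjoining one more member of the family cannot lower this integral, hence changes the
  infimum only on a null set.\<close>

lemma ex_bounded_ess_inf:
  fixes F :: "'a \<Rightarrow> 'x \<Rightarrow> real"
  assumes "prob_space m" "A \<noteq> {}" "\<And>a. a \<in> A \<Longrightarrow> F a \<in> borel_measurable m"
    and F: "\<And>a x. 0 \<le> F a x" "\<And>a x. F a x \<le> B"
  obtains c :: "nat \<Rightarrow> 'a" where "range c \<subseteq> A" "\<And>a. a \<in> A \<Longrightarrow> AE x in m. (INF n. F (c n) x) \<le> F a x"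
proof -
  interpret prob_space m by fact
  let ?g = "\<lambda>c x. INF n::nat. F (c n) x"
  have bdd: "bdd_below (range (\<lambda>n. F (c n) x))" for c :: "nat \<Rightarrow> 'a" and x by (rule bdd_belowI[of _ 0]) (use F in auto)
  have g: "0 \<le> ?g c x" "?g c x \<le> B" for c x
    using F cINF_lower[OF bdd, of 0 c x] by (auto intro!: cINF_greatest order_trans[OF _ F(2)])
  have meas: "?g c \<in> borel_measurable m" if "range c \<subseteq> A" for c
    by (rule borel_measurable_cINF) (use that assms(3) bdd in auto)
  have int: "integrable m (?g c)" if "range c \<subseteq> A" for c
    using g meas[OF that] by (intro integrable_const_bound[where B=B]) auto
  let ?S = "(\<lambda>c. \<integral>x. ?g c x \<partial>m) ` {c. range c \<subseteq> A}"
  obtain a0 where a0: "a0 \<in> A" using assms(2) by auto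
  have "range (\<lambda>_::nat. a0) \<subseteq> A" using a0 by auto
  then have ne: "?S \<noteq> {}" by blast
  have bS: "bdd_below ?S" by (rule bdd_belowI[of _ 0]) (use g in \<open>auto intro!: integral_nonneg_AE\<close>)
  have "\<forall>k::nat. \<exists>c. range c \<subseteq> A \<and> (\<integral>x. ?g c x \<partial>m) < Inf ?S + 1 / Suc k"
  proof
    fix k :: nat
    have "Inf ?S < Inf ?S + 1 / Suc k" by simp
    from cInf_lessD[OF ne this] show "\<exists>c. range c \<subseteq> A \<and> (\<integral>x. ?g c x \<partial>m) < Inf ?S + 1 / Suc k" by auto
  qed
  from choice[OF this] obtain C where C: "\<And>k. range (C k) \<subseteq> A" "\<And>k. (\<integral>x. ?g (C k) x \<partial>m) < Inf ?S + 1 / Suc k" by blast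
  \<comment> \<open>The pairing function merges the minimising sequence of subfamilies into one
    subfamily, whose infimum lies below all of theirs and so attains the minimum.\<close>
  define d where "d n = C (fst (prod_decode n)) (snd (prod_decode n))" for n
  have d: "range d \<subseteq> A" using C(1) by (auto simp: d_def)
  have dC: "?g d x \<le> ?g (C k) x" for k x
  proof (rule cINF_greatest)
    fix j
    have "?g d x \<le> F (d (prod_encode (k, j))) x" by (rule cINF_lower[OF bdd]) simp
    then show "?g d x \<le> F (C k j) x" by (simp add: d_def)
  qed simp
  have le: "(\<integral>x. ?g d x \<partial>m) \<le> Inf ?S"
  proof (rule field_le_epsilon)
    fix e :: real assume "e > 0"
    then obtain k where k: "1 / Suc k < e" using nat_approx_posE by metis
    have "(\<integral>x. ?g d x \<partial>m) \<le> (\<integral>x. ?g (C k) x \<partial>m)" by (intro integral_mono int d C dC)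
    with C(2)[of k] k show "(\<integral>x. ?g d x \<partial>m) \<le> Inf ?S + e" by simp
  qed
  have "AE x in m. ?g d x \<le> F a x" if a: "a \<in> A" for a
  proof -
    \<comment> \<open>Prepending \<open>a\<close> gives another competitor. Its infimum is at most
      that of \<open>d\<close> while its integral is at least \<open>Inf ?S\<close>, so the two
      agree almost everywhere.\<close>
    define e where "e n = (case n of 0 \<Rightarrow> a | Suc n \<Rightarrow> d n)" for n
    have e: "range e \<subseteq> A" using a range_subsetD[OF d] by (auto simp: e_def split: nat.splits)
    have ed: "?g e x \<le> ?g d x" for x
    proof (rule cINF_greatest)
      fix j
      have "?g e x \<le> F (e (Suc j)) x" by (rule cINF_lower[OF bdd]) simp
      then show "?g e x \<le> F (d j) x" by (simp add: e_def)
    qed simp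
    have ea: "?g e x \<le> F a x" for x using cINF_lower[OF bdd, of 0 e x] by (simp add: e_def)
    have "(\<integral>x. ?g d x \<partial>m) \<le> (\<integral>x. ?g e x \<partial>m)" using le cInf_lower[OF _ bS, of "\<integral>x. ?g e x \<partial>m"] e by auto
    then have "(\<integral>x. ?g d x - ?g e x \<partial>m) \<le> 0" using int[OF d] int[OF e] by simp
    moreover have "0 \<le> (\<integral>x. ?g d x - ?g e x \<partial>m)" using ed by (intro integral_nonneg_AE) auto
    ultimately have "(\<integral>x. ?g d x - ?g e x \<partial>m) = 0" by simp
    then have "AE x in m. ?g d x - ?g e x = 0"
      using int[OF d] int[OF e] ed by (subst (asm) integral_nonneg_eq_0_iff_AE) auto
    then show ?thesis
    proof eventually_elim
      case (elim x)
      with ea[of x] show ?case by simp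
    qed
  qed
  with d show ?thesis by (rule that)
qed

lemma ex_ess_inf:
  fixes F :: "'a \<Rightarrow> 'x \<Rightarrow> real"
  assumes "sigma_finite_measure m" "A \<noteq> {}" "\<And>a. a \<in> A \<Longrightarrow> F a \<in> borel_measurable m"
    and nn: "\<And>a. a \<in> A \<Longrightarrow> AE x in m. 0 \<le> F a x"
  shows "\<exists>g. is_ess_inf m A F g"
proof -
  \<comment> \<open>An increasing bounded transformation, so that the integrals to be minimised
    exist; it changes none of the comparisons.\<close>
  let ?F = "\<lambda>a x. arctan (max 0 (F a x))"
  have "\<exists>c::nat \<Rightarrow> 'a. range c \<subseteq> A \<and> (\<forall>a\<in>A. AE x in m. (INF n. ?F (c n) x) \<le> ?F a x)"
  proof (cases "emeasure m (space m) = 0")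
    case True
    obtain a where "a \<in> A" using assms(2) by auto
    then show ?thesis by (intro exI[of _ "\<lambda>_. a"]) (auto intro: AE_of_space_null[OF True])
  next
    case False
    then obtain m' where m': "equivalent_prob m m'"
      by (rule sigma_finite_measure.ex_equivalent_prob[OF assms(1)])
    have "prob_space m'" using m' by (simp add: equivalent_prob_def)
    moreover have "?F a \<in> borel_measurable m'" if "a \<in> A" for a
      unfolding equivalent_prob_measurable[OF m'] using assms(3)[OF that] by measurable
    moreover have "0 \<le> ?F a x" "?F a x \<le> pi/2" for a x
      using arctan_ubound[of "max 0 (F a x)"] by auto
    ultimately obtain c :: "nat \<Rightarrow> 'a" where "range c \<subseteq> A" "\<And>a. a \<in> A \<Longrightarrow> AE x in m'. (INF n. ?F (c n) x) \<le> ?F a x"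
      using ex_bounded_ess_inf[of m' A ?F "pi/2"] assms(2) by blast
    then show ?thesis unfolding equivalent_prob_AE[OF m', symmetric] by blast
  qed
  then obtain c :: "nat \<Rightarrow> 'a" where c: "range c \<subseteq> A" "\<And>a. a \<in> A \<Longrightarrow> AE x in m. (INF n. ?F (c n) x) \<le> ?F a x" by blast
  let ?g = "\<lambda>x. INF n. max 0 (F (c n) x)"
  have bdd: "bdd_below (range (\<lambda>n. max 0 (F (c n) x)))" for x by (rule bdd_belowI[of _ 0]) auto
  have "?g \<in> borel_measurable m"
  proof (rule borel_measurable_cINF)
    show "(\<lambda>x. max 0 (F (c n) x)) \<in> borel_measurable m" for n
      using assms(3)[of "c n"] c(1) by (intro borel_measurable_max) auto
  qed (use bdd in auto)
  moreover have "AE x in m. ?g x \<le> F a x" if "a \<in> A" for a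
    using c(2)[OF that] nn[OF that]
  proof eventually_elim
    case (elim x)
    \<comment> \<open>Monotonicity gives this inequality, and strict monotonicity removes
      \<open>arctan\<close> again at the end.\<close>
    have "arctan (?g x) \<le> (INF n. ?F (c n) x)"
      by (intro cINF_greatest arctan_monotone' cINF_lower[OF bdd]) auto
    with elim(1) have "arctan (?g x) \<le> arctan (max 0 (F a x))" by simp
    with elim(2) show ?case by (simp add: arctan_le_iff)
  qed
  ultimately have "is_ess_inf m A F ?g" using c(1) unfolding is_ess_inf_def by blast
  then show ?thesis by blast
qed

lemma is_ess_inf_nonneg:
  fixes F :: "'a \<Rightarrow> 'x \<Rightarrow> real"
  assumes "is_ess_inf m A F g" shows "0 \<le> g x"
proof -
  obtain c :: "nat \<Rightarrow> 'a" where "\<forall>x. g x = (INF n. max 0 (F (c n) x))" using assms by (auto simp: is_ess_inf_def)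
  then show ?thesis by (auto intro!: cINF_greatest)
qed

text \<open>The countable family behind the essential infimum makes it the greatest lower bound even
  after composition with an arbitrary map.\<close>

lemma is_ess_inf_greatest:
  fixes F :: "'a \<Rightarrow> 'x \<Rightarrow> real"
  assumes "is_ess_inf m A F g" "\<And>a. a \<in> A \<Longrightarrow> AE x in m'. h x \<le> F a (f x)"
  shows "AE x in m'. h x \<le> g (f x)"
proof -
  obtain c :: "nat \<Rightarrow> 'a" where c: "range c \<subseteq> A" "\<forall>x. g x = (INF n. max 0 (F (c n) x))"
    using assms(1) by (auto simp: is_ess_inf_def)
  have "AE x in m'. \<forall>n. h x \<le> F (c n) (f x)"
    unfolding AE_all_countable using assms(2) c(1) by blast
  then show ?thesis
    by eventually_elim (auto simp: c(2) intro!: cINF_greatest intro: le_max_iff_disj[THEN iffD2])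
qed

section \<open>Direct systems and the seminorm of the algebraic limit\<close>

locale nmod_system =
  fixes m :: "'x measure" and I :: "'i set" and r :: "'i rel"
    and M :: "'i \<Rightarrow> ('x, 'm) L0_nmodule" and \<phi> :: "'i \<Rightarrow> 'i \<Rightarrow> 'm \<Rightarrow> 'm"
  assumes sigma_finite: "sigma_finite_measure m"
    and directed: "directed_poset I r"
    and system: "direct_system m I r M \<phi>"
begin

lemma index_refl: "i \<in> I \<Longrightarrow> (i, i) \<in> r"
  and index_trans: "(i, j) \<in> r \<Longrightarrow> (j, k) \<in> r \<Longrightarrow> (i, k) \<in> r"
  and index_mem: "(i, j) \<in> r \<Longrightarrow> i \<in> I" "(i, j) \<in> r \<Longrightarrow> j \<in> I"
  using directed partial_order_onD[of I r] unfolding directed_poset_def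
  by (auto dest: refl_onD transD)

lemma index_ub: "i \<in> I \<Longrightarrow> j \<in> I \<Longrightarrow> \<exists>k\<in>I. (i, k) \<in> r \<and> (j, k) \<in> r"
  using directed by (auto simp: directed_poset_def)

lemma nmod: "i \<in> I \<Longrightarrow> nmod m (M i)"
  using system normed_module_iff_nmod[OF sigma_finite] by (auto simp: direct_system_def)

lemma pre_nmod: "i \<in> I \<Longrightarrow> pre_nmod m (M i)"
  using nmod by (auto simp: nmod_def)

lemma phi_mor: "(i, j) \<in> r \<Longrightarrow> \<phi> i j \<in> nm_mor m (M i) (M j)"
  using system by (auto simp: direct_system_def)

lemma phi_closed: "(i, j) \<in> r \<Longrightarrow> v \<in> carrier (M i) \<Longrightarrow> \<phi> i j v \<in> carrier (M j)"
  and phi_add: "(i, j) \<in> r \<Longrightarrow> v \<in> carrier (M i) \<Longrightarrow> w \<in> carrier (M i) \<Longrightarrow> \<phi> i j (v \<oplus>\<^bsub>M i\<^esub> w) = \<phi> i j v \<oplus>\<^bsub>M j\<^esub> \<phi> i j w"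
  and phi_smult: "(i, j) \<in> r \<Longrightarrow> a \<in> carrier (L0 m) \<Longrightarrow> v \<in> carrier (M i) \<Longrightarrow> \<phi> i j (a \<odot>\<^bsub>M i\<^esub> v) = a \<odot>\<^bsub>M j\<^esub> \<phi> i j v"
  and phi_pn: "(i, j) \<in> r \<Longrightarrow> v \<in> carrier (M i) \<Longrightarrow> AE x in m. pn (M j) (\<phi> i j v) x \<le> pn (M i) v x"
  using phi_mor[of i j] by (auto simp: nm_mor_def)

lemma phi_id: "i \<in> I \<Longrightarrow> v \<in> carrier (M i) \<Longrightarrow> \<phi> i i v = v"
  using system by (auto simp: direct_system_def)

lemma phi_comp: "(i, j) \<in> r \<Longrightarrow> (j, k) \<in> r \<Longrightarrow> v \<in> carrier (M i) \<Longrightarrow> \<phi> j k (\<phi> i j v) = \<phi> i k v"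
  using system by (simp add: direct_system_def)

lemma phi_diff:
  assumes ij: "(i, j) \<in> r" and "v \<in> carrier (M i)" "w \<in> carrier (M i)"
  shows "\<phi> i j (v \<ominus>\<^bsub>M i\<^esub> w) = \<phi> i j v \<ominus>\<^bsub>M j\<^esub> \<phi> i j w"
proof -
  interpret nmod_map m m "\<lambda>x. x" "M i" "M j"
    using pre_nmod index_mem[OF ij] by (intro nmod_map.intro nmod_map_axioms.intro) auto
  show ?thesis using dominated_diff[OF nm_mor_dominated[OF phi_mor[OF ij]]] assms by blast
qed

text \<open>The norm that \<open>v\<close> acquires in the algebraic direct limit: the norms of its
  images decrease along the system, and directedness makes their essential infimum a
  seminorm.\<close>

definition lim_norm :: "'i \<Rightarrow> 'm \<Rightarrow> 'x \<Rightarrow> real" where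
  "lim_norm i v = (SOME g. is_ess_inf m {j. (i, j) \<in> r} (\<lambda>j. pn (M j) (\<phi> i j v)) g)"

lemma lim_norm:
  assumes "i \<in> I" "v \<in> carrier (M i)"
  shows "is_ess_inf m {j. (i, j) \<in> r} (\<lambda>j. pn (M j) (\<phi> i j v)) (lim_norm i v)"
  unfolding lim_norm_def
proof (rule someI_ex[where P = "is_ess_inf m {j. (i, j) \<in> r} (\<lambda>j. pn (M j) (\<phi> i j v))"], rule ex_ess_inf[OF sigma_finite])
  show "{j. (i, j) \<in> r} \<noteq> {}" using index_refl[OF assms(1)] by auto
  fix j assume "j \<in> {j. (i, j) \<in> r}"
  then have j: "(i, j) \<in> r" by simp
  interpret pre_nmod m "M j" by (rule pre_nmod[OF index_mem(2)[OF j]])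
  show "pn (M j) (\<phi> i j v) \<in> borel_measurable m" "AE x in m. 0 \<le> pn (M j) (\<phi> i j v) x"
    using pn_measurable[OF phi_closed[OF j assms(2)]] pn_nonneg[OF phi_closed[OF j assms(2)]] by auto
qed

lemma lim_norm_measurable: "i \<in> I \<Longrightarrow> v \<in> carrier (M i) \<Longrightarrow> lim_norm i v \<in> borel_measurable m"
  and lim_norm_nonneg: "i \<in> I \<Longrightarrow> v \<in> carrier (M i) \<Longrightarrow> 0 \<le> lim_norm i v x"
  using lim_norm[of i v] is_ess_inf_nonneg[OF lim_norm[of i v]] by (auto simp: is_ess_inf_def)

lemma lim_norm_le: "(i, j) \<in> r \<Longrightarrow> v \<in> carrier (M i) \<Longrightarrow> AE x in m. lim_norm i v x \<le> pn (M j) (\<phi> i j v) x"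
  using lim_norm[of i v] index_mem[of i j] by (auto simp: is_ess_inf_def)

lemma lim_norm_le_pn: "i \<in> I \<Longrightarrow> v \<in> carrier (M i) \<Longrightarrow> AE x in m. lim_norm i v x \<le> pn (M i) v x"
  using lim_norm_le[OF index_refl] phi_id by metis

text \<open>The measure \<open>m'\<close> and the map \<open>f\<close> are arbitrary. With the
  identity this serves the seminorm calculus on one space; with the given map it later transfers
  bounds to \<open>mX\<close>.\<close>

lemma lim_norm_greatest:
  assumes "i \<in> I" "v \<in> carrier (M i)" "\<And>j. (i, j) \<in> r \<Longrightarrow> AE x in m'. h x \<le> pn (M j) (\<phi> i j v) (f x)"
  shows "AE x in m'. h x \<le> lim_norm i v (f x)"
  by (rule is_ess_inf_greatest[OF lim_norm[OF assms(1,2)]]) (use assms(3) in auto)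

text \<open>Cofinality: every index above \<open>i\<close> has an upper bound in common with
  \<open>k\<close>, and the norm does not increase on the way there.\<close>

lemma lim_norm_push:
  assumes ik: "(i, k) \<in> r" and v: "v \<in> carrier (M i)"
  shows "AE x in m. lim_norm i v x = lim_norm k (\<phi> i k v) x"
proof -
  note i = index_mem[OF ik] and kv = phi_closed[OF ik v]
  have "AE x in m. lim_norm i v x \<le> lim_norm k (\<phi> i k v) x"
  proof (rule lim_norm_greatest[OF i(2) kv])
    fix j assume kj: "(k, j) \<in> r"
    show "AE x in m. lim_norm i v x \<le> pn (M j) (\<phi> k j (\<phi> i k v)) x"
      unfolding phi_comp[OF ik kj v] by (rule lim_norm_le[OF index_trans[OF ik kj] v])
  qed
  moreover have "AE x in m. lim_norm k (\<phi> i k v) x \<le> lim_norm i v x"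
  proof (rule lim_norm_greatest[OF i(1) v])
    fix j assume ij: "(i, j) \<in> r"
    obtain l where l: "(j, l) \<in> r" "(k, l) \<in> r" using index_ub[OF index_mem(2)[OF ij] i(2)] by auto
    have "\<phi> k l (\<phi> i k v) = \<phi> j l (\<phi> i j v)" using phi_comp[OF ik l(2) v] phi_comp[OF ij l(1) v] by simp
    with lim_norm_le[OF l(2) kv] phi_pn[OF l(1) phi_closed[OF ij v]]
    show "AE x in m. lim_norm k (\<phi> i k v) x \<le> pn (M j) (\<phi> i j v) x" by (auto elim: eventually_elim2)
  qed
  ultimately show ?thesis by eventually_elim simp
qed

text \<open>The two seminorms on the right are infima over independent indices \<open>j\<close> and
  \<open>k\<close>. For fixed \<open>j\<close> and \<open>k\<close> the triangle inequality is used
  at a common upper bound \<open>l\<close>; then the infimum is taken over one index at a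
  time.\<close>

lemma lim_norm_add:
  assumes i: "i \<in> I" and v: "v \<in> carrier (M i)" and w: "w \<in> carrier (M i)"
  shows "AE x in m. lim_norm i (v \<oplus>\<^bsub>M i\<^esub> w) x \<le> lim_norm i v x + lim_norm i w x"
proof -
  interpret Mi: pre_nmod m "M i" by (rule pre_nmod[OF i])
  let ?s = "v \<oplus>\<^bsub>M i\<^esub> w"
  have s: "?s \<in> carrier (M i)" using v w by simp
  have 1: "AE x in m. lim_norm i ?s x - lim_norm i v x \<le> pn (M k) (\<phi> i k w) x" if ik: "(i, k) \<in> r" for k
  proof -
    have "AE x in m. lim_norm i ?s x - pn (M k) (\<phi> i k w) x \<le> lim_norm i v x"
    proof (rule lim_norm_greatest[OF i v])
      fix j assume ij: "(i, j) \<in> r"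
      obtain l where l: "(j, l) \<in> r" "(k, l) \<in> r" using index_ub[OF index_mem(2)[OF ij] index_mem(2)[OF ik]] by auto
      note il = index_trans[OF ij l(1)]
      interpret Ml: pre_nmod m "M l" by (rule pre_nmod[OF index_mem(2)[OF il]])
      have "AE x in m. lim_norm i ?s x \<le> pn (M l) (\<phi> i l v \<oplus>\<^bsub>M l\<^esub> \<phi> i l w) x"
        using lim_norm_le[OF il s] unfolding phi_add[OF il v w] .
      moreover have "AE x in m. pn (M l) (\<phi> i l v) x \<le> pn (M j) (\<phi> i j v) x"
        using phi_pn[OF l(1) phi_closed[OF ij v]] unfolding phi_comp[OF ij l(1) v] .
      moreover have "AE x in m. pn (M l) (\<phi> i l w) x \<le> pn (M k) (\<phi> i k w) x"
        using phi_pn[OF l(2) phi_closed[OF ik w]] unfolding phi_comp[OF ik l(2) w] .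
      moreover note Ml.pn_add[OF phi_closed[OF il v] phi_closed[OF il w]]
      ultimately show "AE x in m. lim_norm i ?s x - pn (M k) (\<phi> i k w) x \<le> pn (M j) (\<phi> i j v) x"
        by eventually_elim simp
    qed
    then show ?thesis by eventually_elim simp
  qed
  have "AE x in m. lim_norm i ?s x - lim_norm i v x \<le> lim_norm i w x" by (rule lim_norm_greatest[OF i w 1])
  then show ?thesis by eventually_elim simp
qed

lemma lim_norm_smult:
  assumes i: "i \<in> I" and a: "a \<in> carrier (L0 m)" and v: "v \<in> carrier (M i)"
  shows "AE x in m. lim_norm i (a \<odot>\<^bsub>M i\<^esub> v) x = \<bar>L0_rep a x\<bar> * lim_norm i v x"
proof -
  interpret Mi: pre_nmod m "M i" by (rule pre_nmod[OF i])
  let ?s = "a \<odot>\<^bsub>M i\<^esub> v"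
  have s: "?s \<in> carrier (M i)" using a v by simp
  have eq: "AE x in m. pn (M j) (\<phi> i j ?s) x = \<bar>L0_rep a x\<bar> * pn (M j) (\<phi> i j v) x \<and> 0 \<le> pn (M j) (\<phi> i j v) x"
    if ij: "(i, j) \<in> r" for j
  proof -
    interpret Mj: pre_nmod m "M j" by (rule pre_nmod[OF index_mem(2)[OF ij]])
    show ?thesis using Mj.pn_smult[OF a phi_closed[OF ij v]] Mj.pn_nonneg[OF phi_closed[OF ij v]]
      unfolding phi_smult[OF ij a v] by eventually_elim simp
  qed
  have "AE x in m. \<bar>L0_rep a x\<bar> * lim_norm i v x \<le> lim_norm i ?s x"
  proof (rule lim_norm_greatest[OF i s])
    fix j assume ij: "(i, j) \<in> r"
    from eq[OF ij] lim_norm_le[OF ij v] show "AE x in m. \<bar>L0_rep a x\<bar> * lim_norm i v x \<le> pn (M j) (\<phi> i j ?s) x"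
      by eventually_elim (simp add: mult_left_mono)
  qed
  \<comment> \<open>Dividing by the scalar turns the claim into a lower bound for the norms of the
    images of \<open>v\<close>. Where the scalar vanishes this bound is void, and the norm of
    \<open>?s\<close> itself is 0 there.\<close>
  moreover have "AE x in m. (if L0_rep a x = 0 then 0 else lim_norm i ?s x / \<bar>L0_rep a x\<bar>) \<le> lim_norm i v x"
  proof (rule lim_norm_greatest[OF i v])
    fix j assume ij: "(i, j) \<in> r"
    from eq[OF ij] lim_norm_le[OF ij s]
    show "AE x in m. (if L0_rep a x = 0 then 0 else lim_norm i ?s x / \<bar>L0_rep a x\<bar>) \<le> pn (M j) (\<phi> i j v) x"
      by eventually_elim (simp add: pos_divide_le_eq mult.commute)
  qed
  moreover have "AE x in m. lim_norm i ?s x \<le> pn (M i) ?s x" by (rule lim_norm_le_pn[OF i s])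
  moreover note Mi.pn_smult[OF a v]
  ultimately show ?thesis
  proof eventually_elim
    case (elim x)
    show ?case
    proof (cases "L0_rep a x = 0")
      case True
      then show ?thesis using elim lim_norm_nonneg[OF i s, of x] by simp
    next
      case False
      then have "lim_norm i ?s x \<le> \<bar>L0_rep a x\<bar> * lim_norm i v x" using elim(2) by (simp add: pos_divide_le_eq mult.commute)
      with elim(1) show ?thesis by simp
    qed
  qed
qed

lemma lim_norm_diff_swap:
  assumes i: "i \<in> I" and v: "v \<in> carrier (M i)" and w: "w \<in> carrier (M i)"
  shows "AE x in m. lim_norm i (v \<ominus>\<^bsub>M i\<^esub> w) x = lim_norm i (w \<ominus>\<^bsub>M i\<^esub> v) x"
proof -
  interpret Mi: pre_nmod m "M i" by (rule pre_nmod[OF i])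
  have d: "w \<ominus>\<^bsub>M i\<^esub> v \<in> carrier (M i)" using v w by simp
  have "AE x in m. L0_rep (L0_class m (\<lambda>_. -1)) x = -1" by (rule L0_rep_class) simp
  with lim_norm_smult[OF i L0_class_carrier[OF borel_measurable_const] d, of "-1"]
  show ?thesis unfolding Mi.minus_one_smult[OF d] Mi.diff_swap[OF w v]
    by eventually_elim simp
qed

lemma lim_norm_diff_triangle:
  assumes i: "i \<in> I" and u: "u \<in> carrier (M i)" and v: "v \<in> carrier (M i)" and w: "w \<in> carrier (M i)"
  shows "AE x in m. lim_norm i (u \<ominus>\<^bsub>M i\<^esub> w) x \<le> lim_norm i (u \<ominus>\<^bsub>M i\<^esub> v) x + lim_norm i (v \<ominus>\<^bsub>M i\<^esub> w) x"
proof -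
  interpret Mi: pre_nmod m "M i" by (rule pre_nmod[OF i])
  show ?thesis using lim_norm_add[OF i Mi.M.minus_closed[OF u v] Mi.M.minus_closed[OF v w]]
    unfolding Mi.diff_chain[OF u v w] .
qed

lemma lim_norm_zero: "i \<in> I \<Longrightarrow> AE x in m. lim_norm i \<zero>\<^bsub>M i\<^esub> x = 0"
proof -
  assume i: "i \<in> I"
  interpret Mi: pre_nmod m "M i" by (rule pre_nmod[OF i])
  from lim_norm_le_pn[OF i Mi.M.zero_closed] Mi.pn_zero show ?thesis
    by eventually_elim (use lim_norm_nonneg[OF i Mi.M.zero_closed] in \<open>simp add: order_antisym\<close>)
qed

section \<open>Elements and module structure of the algebraic limit\<close>

definition lim_pairs :: "('i \<times> 'm) set" where
  "lim_pairs = (SIGMA i:I. carrier (M i))"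

text \<open>Coarser than becoming equal at a later index: a difference whose norms have essential
  infimum 0 must also be identified, or the quotient would carry only a seminorm.\<close>

definition lim_eqv :: "'i \<times> 'm \<Rightarrow> 'i \<times> 'm \<Rightarrow> bool" where
  "lim_eqv y z \<longleftrightarrow> (\<exists>k. (fst y, k) \<in> r \<and> (fst z, k) \<in> r \<and>
     (AE x in m. lim_norm k (\<phi> (fst y) k (snd y) \<ominus>\<^bsub>M k\<^esub> \<phi> (fst z) k (snd z)) x = 0))"

text \<open>Two common upper bounds have an upper bound themselves, and the seminorm of the
  difference does not change when pushed there. Hence any common upper bound decides
  equivalence.\<close>

lemma lim_eqv_iff:
  assumes k: "(i, k) \<in> r" "(j, k) \<in> r" and v: "v \<in> carrier (M i)" and w: "w \<in> carrier (M j)"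
  shows "lim_eqv (i, v) (j, w) \<longleftrightarrow> (AE x in m. lim_norm k (\<phi> i k v \<ominus>\<^bsub>M k\<^esub> \<phi> j k w) x = 0)"
proof
  assume "lim_eqv (i, v) (j, w)"
  then obtain l where l: "(i, l) \<in> r" "(j, l) \<in> r" "AE x in m. lim_norm l (\<phi> i l v \<ominus>\<^bsub>M l\<^esub> \<phi> j l w) x = 0"
    by (auto simp: lim_eqv_def)
  obtain n where n: "(k, n) \<in> r" "(l, n) \<in> r" using index_ub index_mem(2)[OF k(1)] index_mem(2)[OF l(1)] by blast
  interpret Mk: pre_nmod m "M k" by (rule pre_nmod[OF index_mem(2)[OF k(1)]])
  interpret Ml: pre_nmod m "M l" by (rule pre_nmod[OF index_mem(2)[OF l(1)]])
  note ck = phi_closed[OF k(1) v] phi_closed[OF k(2) w] and lim_rep = phi_closed[OF l(1) v] phi_closed[OF l(2) w]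
  have "AE x in m. lim_norm k (\<phi> i k v \<ominus>\<^bsub>M k\<^esub> \<phi> j k w) x = lim_norm n (\<phi> i n v \<ominus>\<^bsub>M n\<^esub> \<phi> j n w) x"
    using lim_norm_push[OF n(1) Mk.M.minus_closed[OF ck]]
    unfolding phi_diff[OF n(1) ck] phi_comp[OF k(1) n(1) v] phi_comp[OF k(2) n(1) w] .
  moreover have "AE x in m. lim_norm l (\<phi> i l v \<ominus>\<^bsub>M l\<^esub> \<phi> j l w) x = lim_norm n (\<phi> i n v \<ominus>\<^bsub>M n\<^esub> \<phi> j n w) x"
    using lim_norm_push[OF n(2) Ml.M.minus_closed[OF lim_rep]]
    unfolding phi_diff[OF n(2) lim_rep] phi_comp[OF l(1) n(2) v] phi_comp[OF l(2) n(2) w] .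
  ultimately show "AE x in m. lim_norm k (\<phi> i k v \<ominus>\<^bsub>M k\<^esub> \<phi> j k w) x = 0" using l(3)
    by eventually_elim simp
qed (use k in \<open>auto simp: lim_eqv_def\<close>)

lemma lim_eqv_same_level:
  assumes k: "k \<in> I" and v: "v \<in> carrier (M k)" "w \<in> carrier (M k)"
  shows "lim_eqv (k, v) (k, w) \<longleftrightarrow> (AE x in m. lim_norm k (v \<ominus>\<^bsub>M k\<^esub> w) x = 0)"
  using lim_eqv_iff[OF index_refl[OF k] index_refl[OF k] v] phi_id[OF k] v by simp

lemma lim_eqv_refl: "k \<in> I \<Longrightarrow> v \<in> carrier (M k) \<Longrightarrow> lim_eqv (k, v) (k, v)"
  using lim_eqv_same_level[of k v v] lim_norm_zero[of k] pre_nmod[of k] by (simp add: pre_nmod.diff_self)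

lemma lim_eqv_sym:
  assumes "y \<in> lim_pairs" "z \<in> lim_pairs" "lim_eqv y z" shows "lim_eqv z y"
proof -
  obtain i v j w where yz: "y = (i, v)" "z = (j, w)" by (cases y, cases z)
  obtain k where k: "(i, k) \<in> r" "(j, k) \<in> r" "AE x in m. lim_norm k (\<phi> i k v \<ominus>\<^bsub>M k\<^esub> \<phi> j k w) x = 0"
    using assms(3) by (auto simp: lim_eqv_def yz)
  have c: "\<phi> i k v \<in> carrier (M k)" "\<phi> j k w \<in> carrier (M k)"
    using assms k by (auto simp: lim_pairs_def yz intro: phi_closed)
  from k(3) lim_norm_diff_swap[OF index_mem(2)[OF k(1)] c]
  have "AE x in m. lim_norm k (\<phi> j k w \<ominus>\<^bsub>M k\<^esub> \<phi> i k v) x = 0" by eventually_elim simp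
  then show ?thesis using k by (auto simp: lim_eqv_def yz)
qed

lemma lim_eqv_trans:
  assumes "y \<in> lim_pairs" "z \<in> lim_pairs" "u \<in> lim_pairs" "lim_eqv y z" "lim_eqv z u" shows "lim_eqv y u"
proof -
  obtain i v j w l t where eq: "y = (i, v)" "z = (j, w)" "u = (l, t)" by (cases y, cases z, cases u)
  have c: "i \<in> I" "j \<in> I" "l \<in> I" "v \<in> carrier (M i)" "w \<in> carrier (M j)" "t \<in> carrier (M l)"
    using assms by (auto simp: lim_pairs_def eq)
  obtain k1 where k1: "k1 \<in> I" "(i, k1) \<in> r" "(j, k1) \<in> r" using index_ub c by blast
  obtain k where k: "k \<in> I" "(k1, k) \<in> r" "(l, k) \<in> r" using index_ub k1(1) c by blast
  have ik: "(i, k) \<in> r" "(j, k) \<in> r" using index_trans k1 k by blast+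
  have ck: "\<phi> i k v \<in> carrier (M k)" "\<phi> j k w \<in> carrier (M k)" "\<phi> l k t \<in> carrier (M k)"
    using phi_closed ik k c by auto
  interpret Mk: pre_nmod m "M k" by (rule pre_nmod[OF k(1)])
  from assms(4,5)[unfolded eq lim_eqv_iff[OF ik c(4,5)] lim_eqv_iff[OF ik(2) k(3) c(5,6)]] lim_norm_diff_triangle[OF k(1) ck]
  have "AE x in m. lim_norm k (\<phi> i k v \<ominus>\<^bsub>M k\<^esub> \<phi> l k t) x = 0"
    by eventually_elim (use lim_norm_nonneg[OF k(1) Mk.M.minus_closed[OF ck(1,3)]] in \<open>simp add: order_antisym\<close>)
  then show ?thesis unfolding eq lim_eqv_iff[OF ik(1) k(3) c(4,6)] .
qed

definition lim_rep :: "'i \<times> 'm \<Rightarrow> 'i \<times> 'm" where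
  "lim_rep z = (SOME y. y \<in> lim_pairs \<and> lim_eqv z y)"

lemma lim_rep_mem: assumes "k \<in> I" "v \<in> carrier (M k)" shows "lim_rep (k, v) \<in> lim_pairs" "lim_eqv (k, v) (lim_rep (k, v))"
proof -
  have "(k, v) \<in> lim_pairs \<and> lim_eqv (k, v) (k, v)" using assms lim_eqv_refl by (simp add: lim_pairs_def)
  from someI[of "\<lambda>y. y \<in> lim_pairs \<and> lim_eqv (k, v) y", OF this] show "lim_rep (k, v) \<in> lim_pairs" "lim_eqv (k, v) (lim_rep (k, v))"
    by (auto simp: lim_rep_def)
qed

text \<open>Equivalent pairs satisfy the same choice predicate, so the choice returns literally the
  same pair.\<close>

lemma lim_rep_eq_iff:
  assumes "y \<in> lim_pairs" "z \<in> lim_pairs" shows "lim_rep y = lim_rep z \<longleftrightarrow> lim_eqv y z"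
proof
  have m: "lim_rep y \<in> lim_pairs" "lim_eqv y (lim_rep y)" "lim_rep z \<in> lim_pairs" "lim_eqv z (lim_rep z)"
    using assms lim_rep_mem by (auto simp: lim_pairs_def)
  assume "lim_rep y = lim_rep z"
  with m lim_eqv_sym[OF assms(2) m(3)] lim_eqv_trans[OF assms(1) m(1) assms(2)] show "lim_eqv y z" by auto
next
  assume e: "lim_eqv y z"
  have "lim_eqv y u \<longleftrightarrow> lim_eqv z u" if u: "u \<in> lim_pairs" for u
    using lim_eqv_trans[OF assms(1,2) u e] lim_eqv_trans[OF assms(2,1) u lim_eqv_sym[OF assms e]] by blast
  then have "(\<lambda>u. u \<in> lim_pairs \<and> lim_eqv y u) = (\<lambda>u. u \<in> lim_pairs \<and> lim_eqv z u)" by auto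
  then show "lim_rep y = lim_rep z" by (simp add: lim_rep_def)
qed

lemma lim_rep_push:
  assumes ik: "(i, k) \<in> r" and v: "v \<in> carrier (M i)" shows "lim_rep (i, v) = lim_rep (k, \<phi> i k v)"
proof -
  note i = index_mem[OF ik] and kv = phi_closed[OF ik v]
  interpret Mk: pre_nmod m "M k" by (rule pre_nmod[OF i(2)])
  have "lim_eqv (i, v) (k, \<phi> i k v)"
    unfolding lim_eqv_iff[OF ik index_refl[OF i(2)] v kv] phi_id[OF i(2) kv] Mk.diff_self[OF kv]
    by (rule lim_norm_zero[OF i(2)])
  then show ?thesis using lim_rep_eq_iff[of "(i, v)" "(k, \<phi> i k v)"] i v kv by (simp add: lim_pairs_def)
qed

lemma lim_rep_same_level:
  assumes k: "k \<in> I" and v: "v \<in> carrier (M k)" "w \<in> carrier (M k)"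
  shows "lim_rep (k, v) = lim_rep (k, w) \<longleftrightarrow> (AE x in m. lim_norm k (v \<ominus>\<^bsub>M k\<^esub> w) x = 0)"
  using lim_rep_eq_iff[of "(k, v)" "(k, w)"] lim_eqv_same_level[OF assms] assms by (simp add: lim_pairs_def)

text \<open>Brings elements to one index, where a module law for the limit becomes the law for a
  single \<open>M k\<close>. Three elements are the most that any law, namely associativity,
  requires.\<close>

lemma lim_rep_common:
  assumes "y \<in> lim_rep ` lim_pairs" "z \<in> lim_rep ` lim_pairs" "u \<in> lim_rep ` lim_pairs"
  obtains k v w t where "k \<in> I" "v \<in> carrier (M k)" "w \<in> carrier (M k)" "t \<in> carrier (M k)"
    "y = lim_rep (k, v)" "z = lim_rep (k, w)" "u = lim_rep (k, t)"
proof -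
  obtain i v j w l t where eq: "y = lim_rep (i, v)" "z = lim_rep (j, w)" "u = lim_rep (l, t)"
    and c: "i \<in> I" "j \<in> I" "l \<in> I" "v \<in> carrier (M i)" "w \<in> carrier (M j)" "t \<in> carrier (M l)"
    using assms by (auto simp: lim_pairs_def)
  obtain k1 where k1: "k1 \<in> I" "(i, k1) \<in> r" "(j, k1) \<in> r" using index_ub c by blast
  obtain k where k: "k \<in> I" "(k1, k) \<in> r" "(l, k) \<in> r" using index_ub k1(1) c by blast
  have ik: "(i, k) \<in> r" "(j, k) \<in> r" using index_trans k1 k by blast+
  show ?thesis
    by (rule that[of k "\<phi> i k v" "\<phi> j k w" "\<phi> l k t"])
      (use k(1) eq lim_rep_push[OF ik(1) c(4)] lim_rep_push[OF ik(2) c(5)] lim_rep_push[OF k(3) c(6)]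
        phi_closed[OF ik(1) c(4)] phi_closed[OF ik(2) c(5)] phi_closed[OF k(3) c(6)] in auto)
qed

definition upper :: "'i \<Rightarrow> 'i \<Rightarrow> 'i" where
  "upper i j = (SOME k. (i, k) \<in> r \<and> (j, k) \<in> r)"

lemma upper: assumes "i \<in> I" "j \<in> I" shows "(i, upper i j) \<in> r" "(j, upper i j) \<in> r"
  using someI_ex[of "\<lambda>k. (i, k) \<in> r \<and> (j, k) \<in> r"] index_ub[OF assms] unfolding upper_def by blast+

text \<open>Representatives instead of equivalence classes keep the elements in \<open>'i \<times> 'm\<close>, as the type of the
  admissible targets requires.\<close>

definition alg_limit :: "('x, 'i \<times> 'm) L0_nmodule" where
  "alg_limit = \<lparr>carrier = lim_rep ` lim_pairs, mult = undefined, one = undefined,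
     zero = (let i = SOME i. i \<in> I in lim_rep (i, \<zero>\<^bsub>M i\<^esub>)),
     add = (\<lambda>y z. let k = upper (fst y) (fst z) in lim_rep (k, \<phi> (fst y) k (snd y) \<oplus>\<^bsub>M k\<^esub> \<phi> (fst z) k (snd z))),
     smult = (\<lambda>a y. lim_rep (fst y, a \<odot>\<^bsub>M (fst y)\<^esub> snd y)),
     pnorm = (\<lambda>y. L0_class m (lim_norm (fst y) (snd y)))\<rparr>"

lemma alg_limit_carrier: "carrier alg_limit = lim_rep ` lim_pairs"
  by (simp add: alg_limit_def)

lemma lim_rep_zero: assumes k: "k \<in> I" shows "lim_rep (k, \<zero>\<^bsub>M k\<^esub>) = \<zero>\<^bsub>alg_limit\<^esub>"
proof -
  define i where "i = (SOME i. i \<in> I)"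
  have i: "i \<in> I" unfolding i_def using k by (rule someI)
  obtain l where l: "(i, l) \<in> r" "(k, l) \<in> r" using index_ub[OF i k] by blast
  have "\<phi> j l \<zero>\<^bsub>M j\<^esub> = \<zero>\<^bsub>M l\<^esub>" if jl: "(j, l) \<in> r" for j
  proof -
    interpret nmod_map m m "\<lambda>x. x" "M j" "M l"
      using pre_nmod index_mem[OF jl] by (intro nmod_map.intro nmod_map_axioms.intro) auto
    show ?thesis by (rule dominated_zero[OF nm_mor_dominated[OF phi_mor[OF jl]]])
  qed
  moreover have "\<zero>\<^bsub>M j\<^esub> \<in> carrier (M j)" if "j \<in> I" for j
  proof -
    interpret pre_nmod m "M j" by (rule pre_nmod[OF that])
    show ?thesis by simp
  qed
  ultimately have "lim_rep (k, \<zero>\<^bsub>M k\<^esub>) = lim_rep (i, \<zero>\<^bsub>M i\<^esub>)"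
    using lim_rep_push[OF l(1)] lim_rep_push[OF l(2)] i k l by metis
  then show ?thesis by (simp add: alg_limit_def i_def Let_def)
qed

lemma lim_rep_rep:
  assumes "k \<in> I" "v \<in> carrier (M k)"
  obtains i v' where "lim_rep (k, v) = (i, v')" "i \<in> I" "v' \<in> carrier (M i)" "lim_rep (i, v') = lim_rep (k, v)"
proof -
  obtain i v' where e: "lim_rep (k, v) = (i, v')" by (cases "lim_rep (k, v)")
  have "(k, v) \<in> lim_pairs" using assms by (simp add: lim_pairs_def)
  then show ?thesis
    using that[OF e] lim_rep_mem[OF assms] lim_rep_eq_iff[of "(k, v)" "(i, v')"] unfolding e lim_pairs_def by auto
qed

text \<open>The sum is defined through chosen representatives at indices unrelated to
  \<open>k\<close>. Everything is moved to an index \<open>n\<close> above all of them, where chosen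
  and given vectors differ by elements of seminorm 0.\<close>

lemma lim_rep_add:
  assumes k: "k \<in> I" and v: "v \<in> carrier (M k)" and w: "w \<in> carrier (M k)"
  shows "lim_rep (k, v) \<oplus>\<^bsub>alg_limit\<^esub> lim_rep (k, w) = lim_rep (k, v \<oplus>\<^bsub>M k\<^esub> w)"
proof -
  obtain i v' where v': "lim_rep (k, v) = (i, v')" "i \<in> I" "v' \<in> carrier (M i)" "lim_rep (i, v') = lim_rep (k, v)"
    by (rule lim_rep_rep[OF k v])
  obtain j w' where w': "lim_rep (k, w) = (j, w')" "j \<in> I" "w' \<in> carrier (M j)" "lim_rep (j, w') = lim_rep (k, w)"
    by (rule lim_rep_rep[OF k w])
  let ?l = "upper i j"
  note l = upper[OF v'(2) w'(2)]
  note lI = index_mem(2)[OF l(1)]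
  obtain n where n: "(?l, n) \<in> r" "(k, n) \<in> r" using index_ub[OF lI k] by blast
  note inn = index_trans[OF l(1) n(1)] and jn = index_trans[OF l(2) n(1)] and nI = index_mem(2)[OF n(1)]
  interpret Mk: pre_nmod m "M k" by (rule pre_nmod[OF k])
  interpret Ml: pre_nmod m "M ?l" by (rule pre_nmod[OF lI])
  interpret Mn: pre_nmod m "M n" by (rule pre_nmod[OF nI])
  note lc = phi_closed[OF l(1) v'(3)] phi_closed[OF l(2) w'(3)]
  note c = phi_closed[OF inn v'(3)] phi_closed[OF n(2) v] phi_closed[OF jn w'(3)] phi_closed[OF n(2) w]
  have "lim_rep (k, v) \<oplus>\<^bsub>alg_limit\<^esub> lim_rep (k, w) = lim_rep (?l, \<phi> i ?l v' \<oplus>\<^bsub>M ?l\<^esub> \<phi> j ?l w')"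
    by (simp add: alg_limit_def v'(1) w'(1) Let_def)
  also have "\<dots> = lim_rep (n, \<phi> i n v' \<oplus>\<^bsub>M n\<^esub> \<phi> j n w')"
    unfolding lim_rep_push[OF n(1) Ml.M.a_closed[OF lc]] phi_add[OF n(1) lc] phi_comp[OF l(1) n(1) v'(3)]
      phi_comp[OF l(2) n(1) w'(3)] ..
  also have "\<dots> = lim_rep (n, \<phi> k n v \<oplus>\<^bsub>M n\<^esub> \<phi> k n w)"
  proof -
    have "AE x in m. lim_norm n (\<phi> i n v' \<ominus>\<^bsub>M n\<^esub> \<phi> k n v) x = 0"
      using v'(4) unfolding lim_rep_push[OF inn v'(3)] lim_rep_push[OF n(2) v] lim_rep_same_level[OF nI c(1,2)] .
    moreover have "AE x in m. lim_norm n (\<phi> j n w' \<ominus>\<^bsub>M n\<^esub> \<phi> k n w) x = 0"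
      using w'(4) unfolding lim_rep_push[OF jn w'(3)] lim_rep_push[OF n(2) w] lim_rep_same_level[OF nI c(3,4)] .
    moreover note lim_norm_add[OF nI Mn.M.minus_closed[OF c(1,2)] Mn.M.minus_closed[OF c(3,4)],
        folded Mn.diff_add[OF c(1,2,3,4)]]
    moreover have "AE x in m. 0 \<le> lim_norm n ((\<phi> i n v' \<oplus>\<^bsub>M n\<^esub> \<phi> j n w') \<ominus>\<^bsub>M n\<^esub> (\<phi> k n v \<oplus>\<^bsub>M n\<^esub> \<phi> k n w)) x"
      by (intro AE_I2 lim_norm_nonneg nI Mn.M.minus_closed Mn.M.a_closed c)
    ultimately have "AE x in m. lim_norm n ((\<phi> i n v' \<oplus>\<^bsub>M n\<^esub> \<phi> j n w') \<ominus>\<^bsub>M n\<^esub> (\<phi> k n v \<oplus>\<^bsub>M n\<^esub> \<phi> k n w)) x = 0"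
      by eventually_elim simp
    then show ?thesis
      unfolding lim_rep_same_level[OF nI Mn.M.a_closed[OF c(1,3)] Mn.M.a_closed[OF c(2,4)]] .
  qed
  also have "\<dots> = lim_rep (k, v \<oplus>\<^bsub>M k\<^esub> w)"
    unfolding lim_rep_push[OF n(2) Mk.M.a_closed[OF v w]] phi_add[OF n(2) v w] ..
  finally show ?thesis .
qed

lemma lim_rep_smult:
  assumes k: "k \<in> I" and a: "a \<in> carrier (L0 m)" and v: "v \<in> carrier (M k)"
  shows "a \<odot>\<^bsub>alg_limit\<^esub> lim_rep (k, v) = lim_rep (k, a \<odot>\<^bsub>M k\<^esub> v)"
proof -
  obtain i v' where v': "lim_rep (k, v) = (i, v')" "i \<in> I" "v' \<in> carrier (M i)" "lim_rep (i, v') = lim_rep (k, v)"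
    by (rule lim_rep_rep[OF k v])
  obtain n where n: "(i, n) \<in> r" "(k, n) \<in> r" using index_ub[OF v'(2) k] by blast
  note nI = index_mem(2)[OF n(1)]
  interpret Mk: pre_nmod m "M k" by (rule pre_nmod[OF k])
  interpret Mi: pre_nmod m "M i" by (rule pre_nmod[OF v'(2)])
  interpret Mn: pre_nmod m "M n" by (rule pre_nmod[OF nI])
  note c = phi_closed[OF n(1) v'(3)] phi_closed[OF n(2) v]
  have "AE x in m. lim_norm n (\<phi> i n v' \<ominus>\<^bsub>M n\<^esub> \<phi> k n v) x = 0"
    using v'(4) unfolding lim_rep_push[OF n(1) v'(3)] lim_rep_push[OF n(2) v] lim_rep_same_level[OF nI c] .
  with lim_norm_smult[OF nI a Mn.M.minus_closed[OF c]]
  have "AE x in m. lim_norm n ((a \<odot>\<^bsub>M n\<^esub> \<phi> i n v') \<ominus>\<^bsub>M n\<^esub> (a \<odot>\<^bsub>M n\<^esub> \<phi> k n v)) x = 0"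
    unfolding Mn.diff_smult[OF a c] by eventually_elim simp
  then have "lim_rep (n, a \<odot>\<^bsub>M n\<^esub> \<phi> i n v') = lim_rep (n, a \<odot>\<^bsub>M n\<^esub> \<phi> k n v)"
    unfolding lim_rep_same_level[OF nI Mn.smult_closed[OF a c(1)] Mn.smult_closed[OF a c(2)]] .
  then have "lim_rep (i, a \<odot>\<^bsub>M i\<^esub> v') = lim_rep (k, a \<odot>\<^bsub>M k\<^esub> v)"
    unfolding lim_rep_push[OF n(1) Mi.smult_closed[OF a v'(3)]] lim_rep_push[OF n(2) Mk.smult_closed[OF a v]]
      phi_smult[OF n(1) a v'(3)] phi_smult[OF n(2) a v] .
  then show ?thesis by (simp add: alg_limit_def v'(1))
qed

text \<open>The norm is defined on the chosen pair; at an index above both pairs the triangle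
  inequality shows that vectors differing by seminorm 0 have equal seminorms.\<close>

lemma pn_lim_rep:
  assumes k: "k \<in> I" and v: "v \<in> carrier (M k)"
  shows "AE x in m. pn alg_limit (lim_rep (k, v)) x = lim_norm k v x"
proof -
  obtain i v' where v': "lim_rep (k, v) = (i, v')" "i \<in> I" "v' \<in> carrier (M i)" "lim_rep (i, v') = lim_rep (k, v)"
    by (rule lim_rep_rep[OF k v])
  obtain n where n: "(i, n) \<in> r" "(k, n) \<in> r" using index_ub[OF v'(2) k] by blast
  note nI = index_mem(2)[OF n(1)]
  interpret Mn: pre_nmod m "M n" by (rule pre_nmod[OF nI])
  note c = phi_closed[OF n(1) v'(3)] phi_closed[OF n(2) v]
  have "AE x in m. pn alg_limit (lim_rep (k, v)) x = lim_norm i v' x"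
    unfolding pn_def[of alg_limit] using L0_rep_class[OF lim_norm_measurable[OF v'(2,3)]]
    by (simp add: alg_limit_def v'(1))
  moreover have "AE x in m. lim_norm n (\<phi> i n v' \<ominus>\<^bsub>M n\<^esub> \<phi> k n v) x = 0"
    using v'(4) unfolding lim_rep_push[OF n(1) v'(3)] lim_rep_push[OF n(2) v] lim_rep_same_level[OF nI c] .
  moreover note lim_norm_push[OF n(2) v] lim_norm_push[OF n(1) v'(3)] lim_norm_diff_swap[OF nI c]
    lim_norm_diff_triangle[OF nI c Mn.M.zero_closed, unfolded Mn.diff_zero[OF c(1)] Mn.diff_zero[OF c(2)]]
    lim_norm_diff_triangle[OF nI c(2,1) Mn.M.zero_closed, unfolded Mn.diff_zero[OF c(1)] Mn.diff_zero[OF c(2)]]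
  ultimately show ?thesis by eventually_elim simp
qed

lemma alg_limit_pre_nmod: "pre_nmod m alg_limit"
proof -
  have closed: "lim_rep (k, v) \<in> carrier alg_limit" if "k \<in> I" "v \<in> carrier (M k)" for k v
    using that by (auto simp: alg_limit_carrier lim_pairs_def)
  have one: "\<exists>k v. k \<in> I \<and> v \<in> carrier (M k) \<and> y = lim_rep (k, v)" if "y \<in> carrier alg_limit" for y
    using that by (auto simp: alg_limit_carrier lim_pairs_def)
  have two: "\<exists>k v w. k \<in> I \<and> v \<in> carrier (M k) \<and> w \<in> carrier (M k) \<and> y = lim_rep (k, v) \<and> z = lim_rep (k, w)"
    if "y \<in> carrier alg_limit" "z \<in> carrier alg_limit" for y z
    using lim_rep_common[of y z z] that unfolding alg_limit_carrier by metis
  obtain i where "i \<in> I" using directed by (auto simp: directed_poset_def)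
  then interpret Mi: pre_nmod m "M i" by (rule pre_nmod)
  note rules = lim_rep_add lim_rep_smult closed
  have ab: "abelian_group alg_limit"
  proof (rule abelian_groupI)
    fix y z assume yz: "y \<in> carrier alg_limit" "z \<in> carrier alg_limit"
    obtain k v w where k: "k \<in> I" "v \<in> carrier (M k)" "w \<in> carrier (M k)" "y = lim_rep (k, v)" "z = lim_rep (k, w)"
      using two[OF yz] by blast
    interpret Mk: pre_nmod m "M k" by (rule pre_nmod[OF k(1)])
    show "y \<oplus>\<^bsub>alg_limit\<^esub> z \<in> carrier alg_limit" "y \<oplus>\<^bsub>alg_limit\<^esub> z = z \<oplus>\<^bsub>alg_limit\<^esub> y"
      by (simp_all add: k rules Mk.M.a_comm)
  next
    fix y z u assume "y \<in> carrier alg_limit" "z \<in> carrier alg_limit" "u \<in> carrier alg_limit"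
    then obtain k v w t where k: "k \<in> I" "v \<in> carrier (M k)" "w \<in> carrier (M k)" "t \<in> carrier (M k)"
        "y = lim_rep (k, v)" "z = lim_rep (k, w)" "u = lim_rep (k, t)"
      unfolding alg_limit_carrier by (rule lim_rep_common)
    interpret Mk: pre_nmod m "M k" by (rule pre_nmod[OF k(1)])
    show "(y \<oplus>\<^bsub>alg_limit\<^esub> z) \<oplus>\<^bsub>alg_limit\<^esub> u = y \<oplus>\<^bsub>alg_limit\<^esub> (z \<oplus>\<^bsub>alg_limit\<^esub> u)"
      by (simp add: k rules Mk.M.a_assoc)
  next
    show "\<zero>\<^bsub>alg_limit\<^esub> \<in> carrier alg_limit" using \<open>i \<in> I\<close> by (simp add: lim_rep_zero[OF \<open>i \<in> I\<close>, symmetric] closed)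
  next
    fix y assume "y \<in> carrier alg_limit"
    then obtain k v where k: "k \<in> I" "v \<in> carrier (M k)" "y = lim_rep (k, v)" using one by blast
    interpret Mk: pre_nmod m "M k" by (rule pre_nmod[OF k(1)])
    note zero = lim_rep_zero[OF k(1), symmetric]
    show "\<zero>\<^bsub>alg_limit\<^esub> \<oplus>\<^bsub>alg_limit\<^esub> y = y" by (simp add: k zero lim_rep_add)
    have "lim_rep (k, \<ominus>\<^bsub>M k\<^esub> v) \<in> carrier alg_limit" "lim_rep (k, \<ominus>\<^bsub>M k\<^esub> v) \<oplus>\<^bsub>alg_limit\<^esub> y = \<zero>\<^bsub>alg_limit\<^esub>"
      by (simp_all add: k zero closed lim_rep_add Mk.M.l_neg)
    then show "\<exists>z\<in>carrier alg_limit. z \<oplus>\<^bsub>alg_limit\<^esub> y = \<zero>\<^bsub>alg_limit\<^esub>" by blast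
  qed
  have md: "module (L0 m) alg_limit"
  proof (rule moduleI[OF Mi.R.is_cring ab])
    fix a y assume a: "a \<in> carrier (L0 m)" and "y \<in> carrier alg_limit"
    then obtain k v where k: "k \<in> I" "v \<in> carrier (M k)" "y = lim_rep (k, v)" using one by blast
    interpret Mk: pre_nmod m "M k" by (rule pre_nmod[OF k(1)])
    show "a \<odot>\<^bsub>alg_limit\<^esub> y \<in> carrier alg_limit" by (simp add: k a rules)
    fix b assume b: "b \<in> carrier (L0 m)"
    show "(a \<oplus>\<^bsub>L0 m\<^esub> b) \<odot>\<^bsub>alg_limit\<^esub> y = (a \<odot>\<^bsub>alg_limit\<^esub> y) \<oplus>\<^bsub>alg_limit\<^esub> (b \<odot>\<^bsub>alg_limit\<^esub> y)"
      "(a \<otimes>\<^bsub>L0 m\<^esub> b) \<odot>\<^bsub>alg_limit\<^esub> y = a \<odot>\<^bsub>alg_limit\<^esub> (b \<odot>\<^bsub>alg_limit\<^esub> y)"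
      by (simp_all add: k a b rules Mk.smult_l_distr Mk.smult_assoc1)
  next
    fix a y z assume a: "a \<in> carrier (L0 m)" and yz: "y \<in> carrier alg_limit" "z \<in> carrier alg_limit"
    obtain k v w where k: "k \<in> I" "v \<in> carrier (M k)" "w \<in> carrier (M k)" "y = lim_rep (k, v)" "z = lim_rep (k, w)"
      using two[OF yz] by blast
    interpret Mk: pre_nmod m "M k" by (rule pre_nmod[OF k(1)])
    show "a \<odot>\<^bsub>alg_limit\<^esub> (y \<oplus>\<^bsub>alg_limit\<^esub> z) = (a \<odot>\<^bsub>alg_limit\<^esub> y) \<oplus>\<^bsub>alg_limit\<^esub> (a \<odot>\<^bsub>alg_limit\<^esub> z)"
      by (simp add: k a rules Mk.smult_r_distr)
  next
    fix y assume "y \<in> carrier alg_limit"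
    then obtain k v where k: "k \<in> I" "v \<in> carrier (M k)" "y = lim_rep (k, v)" using one by blast
    interpret Mk: pre_nmod m "M k" by (rule pre_nmod[OF k(1)])
    show "\<one>\<^bsub>L0 m\<^esub> \<odot>\<^bsub>alg_limit\<^esub> y = y" by (simp add: k rules)
  qed
  have "pointwise_norm m alg_limit"
    unfolding pointwise_norm_def
  proof (intro conjI ballI)
    show "pnorm alg_limit \<in> carrier alg_limit \<rightarrow> carrier (L0 m)"
    proof
      fix y assume "y \<in> carrier alg_limit"
      then obtain k v where k: "k \<in> I" "v \<in> carrier (M k)" and eq: "y = lim_rep (k, v)" using one by blast
      have "fst y \<in> I" "snd y \<in> carrier (M (fst y))" using lim_rep_mem(1)[OF k] by (auto simp: eq lim_pairs_def)
      then show "pnorm alg_limit y \<in> carrier (L0 m)" by (simp add: alg_limit_def lim_norm_measurable)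
    qed
  next
    fix y assume "y \<in> carrier alg_limit"
    then obtain k v where k: "k \<in> I" "v \<in> carrier (M k)" and eq: "y = lim_rep (k, v)" using one by blast
    interpret Mk: pre_nmod m "M k" by (rule pre_nmod[OF k(1)])
    from pn_lim_rep[OF k] show "AE x in m. 0 \<le> pn alg_limit y x"
      unfolding eq by eventually_elim (simp add: lim_norm_nonneg[OF k])
    show "(AE x in m. pn alg_limit y x = 0) \<longleftrightarrow> y = \<zero>\<^bsub>alg_limit\<^esub>"
      unfolding eq lim_rep_zero[OF k(1), symmetric] lim_rep_same_level[OF k Mk.M.zero_closed] Mk.diff_zero[OF k(2)]
    proof
      assume "AE x in m. pn alg_limit (lim_rep (k, v)) x = 0"
      with pn_lim_rep[OF k] show "AE x in m. lim_norm k v x = 0" by eventually_elim simp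
    next
      assume "AE x in m. lim_norm k v x = 0"
      with pn_lim_rep[OF k] show "AE x in m. pn alg_limit (lim_rep (k, v)) x = 0" by eventually_elim simp
    qed
    fix a assume a: "a \<in> carrier (L0 m)"
    from pn_lim_rep[OF k] pn_lim_rep[OF k(1) Mk.smult_closed[OF a k(2)]] lim_norm_smult[OF k(1) a k(2)]
    show "AE x in m. pn alg_limit (a \<odot>\<^bsub>alg_limit\<^esub> y) x = \<bar>L0_rep a x\<bar> * pn alg_limit y x"
      unfolding eq lim_rep_smult[OF k(1) a k(2)] by eventually_elim simp
  next
    fix y z assume yz: "y \<in> carrier alg_limit" "z \<in> carrier alg_limit"
    obtain k v w where k: "k \<in> I" "v \<in> carrier (M k)" "w \<in> carrier (M k)" and eq: "y = lim_rep (k, v)" "z = lim_rep (k, w)"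
      using two[OF yz] by blast
    interpret Mk: pre_nmod m "M k" by (rule pre_nmod[OF k(1)])
    from pn_lim_rep[OF k(1,2)] pn_lim_rep[OF k(1,3)] pn_lim_rep[OF k(1) Mk.M.a_closed[OF k(2,3)]] lim_norm_add[OF k]
    show "AE x in m. pn alg_limit (y \<oplus>\<^bsub>alg_limit\<^esub> z) x \<le> pn alg_limit y x + pn alg_limit z x"
      unfolding eq lim_rep_add[OF k] by eventually_elim simp
  qed
  with md show ?thesis by (intro pre_nmod.intro pre_nmod_axioms.intro sigma_finite)
qed

end

section \<open>Direct limits and their pullbacks\<close>

context nmod_system begin

definition limit_map :: "'i \<Rightarrow> 'm \<Rightarrow> (nat \<Rightarrow> 'i \<times> 'm) set" where
  "limit_map i = restrict (\<lambda>v. pre_nmod.embed m alg_limit (lim_rep (i, v))) (carrier (M i))"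

lemma limit_map_target: "target m I r M \<phi> (completion m alg_limit) limit_map"
proof -
  interpret A: pre_nmod m alg_limit by (rule alg_limit_pre_nmod)
  have closed: "lim_rep (k, v) \<in> carrier alg_limit" if "k \<in> I" "v \<in> carrier (M k)" for k v
    using that by (auto simp: alg_limit_carrier lim_pairs_def)
  have mor: "limit_map i \<in> nm_mor m (M i) (completion m alg_limit)" if i: "i \<in> I" for i
  proof -
    interpret Mi: pre_nmod m "M i" by (rule pre_nmod[OF i])
    have "limit_map i (v \<oplus>\<^bsub>M i\<^esub> w) = limit_map i v \<oplus>\<^bsub>completion m alg_limit\<^esub> limit_map i w"
      if "v \<in> carrier (M i)" "w \<in> carrier (M i)" for v w
      using that A.embed_add[OF closed[OF i that(1)] closed[OF i that(2)]] lim_rep_add[OF i that] by (simp add: limit_map_def)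
    moreover have "limit_map i (a \<odot>\<^bsub>M i\<^esub> v) = a \<odot>\<^bsub>completion m alg_limit\<^esub> limit_map i v"
      if "a \<in> carrier (L0 m)" "v \<in> carrier (M i)" for a v
      using that A.embed_smult[OF that(1) closed[OF i that(2)]] lim_rep_smult[OF i that] by (simp add: limit_map_def)
    moreover have "AE x in m. pn (completion m alg_limit) (limit_map i v) x \<le> pn (M i) v x"
      if v: "v \<in> carrier (M i)" for v
    proof -
      have eq: "limit_map i v = A.embed (lim_rep (i, v))" using v by (simp add: limit_map_def)
      from A.pn_embed[OF closed[OF i v]] pn_lim_rep[OF i v] lim_norm_le_pn[OF i v] show ?thesis
        unfolding eq by eventually_elim simp
    qed
    moreover have "limit_map i \<in> carrier (M i) \<rightarrow>\<^sub>E carrier (completion m alg_limit)"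
      using A.embed_closed[OF closed[OF i]] by (auto simp: limit_map_def)
    ultimately show ?thesis by (simp add: nm_mor_def)
  qed
  have "limit_map j (\<phi> i j v) = limit_map i v" if "(i, j) \<in> r" "v \<in> carrier (M i)" for i j v
    using lim_rep_push[OF that] phi_closed[OF that] that by (simp add: limit_map_def)
  with mor A.completion_nmod normed_module_iff_nmod[OF sigma_finite] show ?thesis
    by (auto simp: target_def)
qed

text \<open>The morphism \<open>\<Phi>\<close> from \<open>L\<close> to the completion does not
  increase norms, and it sends \<open>\<kappa> i v\<close> to an element whose norm is exactly
  \<open>lim_norm i v\<close>.\<close>

lemma lim_norm_le_limit:
  fixes L :: "('x, 'l) L0_nmodule"
  assumes L: "direct_limit TYPE((nat \<Rightarrow> 'i \<times> 'm) set) m I r M \<phi> L \<kappa>"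
    and i: "i \<in> I" and v: "v \<in> carrier (M i)"
  shows "AE x in m. lim_norm i v x \<le> pn L (\<kappa> i v) x"
proof -
  interpret A: pre_nmod m alg_limit by (rule alg_limit_pre_nmod)
  have "lim_rep (i, v) \<in> carrier alg_limit" using i v by (auto simp: alg_limit_carrier lim_pairs_def)
  moreover have eq: "limit_map i v = A.embed (lim_rep (i, v))" using v by (simp add: limit_map_def)
  ultimately have "AE x in m. pn (completion m alg_limit) (limit_map i v) x = lim_norm i v x"
    using A.pn_embed[of "lim_rep (i, v)"] pn_lim_rep[OF i v] by (auto elim: eventually_elim2)
  moreover obtain \<Phi> where \<Phi>: "\<Phi> \<in> nm_mor m L (completion m alg_limit)" "\<forall>i\<in>I. \<forall>v\<in>carrier (M i). \<Phi> (\<kappa> i v) = limit_map i v"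
    using L limit_map_target unfolding direct_limit_def by blast
  moreover have "\<kappa> i v \<in> carrier L"
    using L i v by (auto simp: direct_limit_def target_def nm_mor_def)
  with \<Phi>(1) have "AE x in m. pn (completion m alg_limit) (\<Phi> (\<kappa> i v)) x \<le> pn L (\<kappa> i v) x"
    by (auto simp: nm_mor_def)
  ultimately show ?thesis using i v by (auto elim: eventually_elim2)
qed

end

section \<open>Morphisms, uniqueness of direct limits and density of the images\<close>

lemma target_mor: "target m I r M \<phi> N \<psi> \<Longrightarrow> i \<in> I \<Longrightarrow> \<psi> i \<in> nm_mor m (M i) N"
  and target_comp: "target m I r M \<phi> N \<psi> \<Longrightarrow> (i, j) \<in> r \<Longrightarrow> v \<in> carrier (M i) \<Longrightarrow> \<psi> j (\<phi> i j v) = \<psi> i v"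
  by (auto simp: target_def)

lemma nm_morD:
  assumes "\<phi> \<in> nm_mor m M N"
  shows "v \<in> carrier M \<Longrightarrow> \<phi> v \<in> carrier N"
    and "v \<in> carrier M \<Longrightarrow> w \<in> carrier M \<Longrightarrow> \<phi> (v \<oplus>\<^bsub>M\<^esub> w) = \<phi> v \<oplus>\<^bsub>N\<^esub> \<phi> w"
    and "a \<in> carrier (L0 m) \<Longrightarrow> v \<in> carrier M \<Longrightarrow> \<phi> (a \<odot>\<^bsub>M\<^esub> v) = a \<odot>\<^bsub>N\<^esub> \<phi> v"
    and "v \<in> carrier M \<Longrightarrow> AE x in m. pn N (\<phi> v) x \<le> pn M v x"
    and "\<phi> \<in> extensional (carrier M)"
  using assms by (auto simp: nm_mor_def PiE_def)

lemma (in pre_nmod) nm_mor_comp: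
  assumes \<phi>: "\<phi> \<in> nm_mor m M N" and \<psi>: "\<psi> \<in> nm_mor m N K"
  shows "restrict (\<lambda>v. \<psi> (\<phi> v)) (carrier M) \<in> nm_mor m M K"
proof -
  have "AE x in m. pn K (\<psi> (\<phi> v)) x \<le> pn M v x" if v: "v \<in> carrier M" for v
    using nm_morD(4)[OF \<phi> v] nm_morD(4)[OF \<psi> nm_morD(1)[OF \<phi> v]] by eventually_elim simp
  then show ?thesis
    unfolding nm_mor_def using nm_morD(1-3)[OF \<phi>] nm_morD(1-3)[OF \<psi>] by (simp add: Pi_iff)
qed

lemma (in pre_nmod) nm_mor_id: "restrict (\<lambda>v. v) (carrier M) \<in> nm_mor m M M"
  by (simp add: nm_mor_def)

lemma direct_limit_target: "direct_limit TYPE('n) m I r M \<phi> L \<kappa> \<Longrightarrow> target m I r M \<phi> L \<kappa>"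
  by (simp add: direct_limit_def)

lemma direct_limit_ex:
  fixes N :: "('x, 'n) L0_nmodule"
  assumes "direct_limit TYPE('n) m I r M \<phi> L \<kappa>" "target m I r M \<phi> N \<psi>"
  obtains \<Phi> where "\<Phi> \<in> nm_mor m L N" "\<And>i v. i \<in> I \<Longrightarrow> v \<in> carrier (M i) \<Longrightarrow> \<Phi> (\<kappa> i v) = \<psi> i v"
  using assms unfolding direct_limit_def by blast

lemma direct_limit_uniq:
  fixes N :: "('x, 'n) L0_nmodule"
  assumes "direct_limit TYPE('n) m I r M \<phi> L \<kappa>" "target m I r M \<phi> N \<psi>"
    and "\<Phi> \<in> nm_mor m L N" "\<And>i v. i \<in> I \<Longrightarrow> v \<in> carrier (M i) \<Longrightarrow> \<Phi> (\<kappa> i v) = \<psi> i v"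
    and "\<Phi>' \<in> nm_mor m L N" "\<And>i v. i \<in> I \<Longrightarrow> v \<in> carrier (M i) \<Longrightarrow> \<Phi>' (\<kappa> i v) = \<psi> i v"
  shows "\<Phi> = \<Phi>'"
proof -
  have "\<exists>!\<Phi>. \<Phi> \<in> nm_mor m L N \<and> (\<forall>i\<in>I. \<forall>v\<in>carrier (M i). \<Phi> (\<kappa> i v) = \<psi> i v)"
    using assms(1,2) by (simp add: direct_limit_def)
  with assms(3-6) show ?thesis by (metis (no_types, lifting))
qed

text \<open>Each limit is tested at both carrier types: at the other's type for the morphism between
  them, and at its own type to identify the composite with the identity.\<close>

lemma direct_limit_iso:
  fixes K :: "('x, 'k) L0_nmodule" and Q :: "('x, 'q) L0_nmodule"
  assumes m: "sigma_finite_measure m"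
    and K: "direct_limit TYPE('k) m I r P \<phi> K \<eta>" "direct_limit TYPE('q) m I r P \<phi> K \<eta>"
    and Q: "direct_limit TYPE('k) m I r P \<phi> Q \<kappa>" "direct_limit TYPE('q) m I r P \<phi> Q \<kappa>"
  shows "\<exists>\<Theta>\<in>nm_iso m K Q. \<forall>i\<in>I. \<forall>v\<in>carrier (P i). \<Theta> (\<eta> i v) = \<kappa> i v"
proof -
  note tK = direct_limit_target[OF K(1)] and tQ = direct_limit_target[OF Q(1)]
  interpret K: nmod m K using tK normed_module_iff_nmod[OF m] by (auto simp: target_def)
  interpret Q: nmod m Q using tQ normed_module_iff_nmod[OF m] by (auto simp: target_def)
  have cK: "\<eta> i v \<in> carrier K" and cQ: "\<kappa> i v \<in> carrier Q" if "i \<in> I" "v \<in> carrier (P i)" for i v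
    using nm_morD(1)[OF target_mor[OF tK]] nm_morD(1)[OF target_mor[OF tQ]] that by auto
  obtain \<Theta> where \<Theta>: "\<Theta> \<in> nm_mor m K Q" "\<And>i v. i \<in> I \<Longrightarrow> v \<in> carrier (P i) \<Longrightarrow> \<Theta> (\<eta> i v) = \<kappa> i v"
    using direct_limit_ex[OF K(2) tQ] by blast
  obtain \<Xi> where \<Xi>: "\<Xi> \<in> nm_mor m Q K" "\<And>i v. i \<in> I \<Longrightarrow> v \<in> carrier (P i) \<Longrightarrow> \<Xi> (\<kappa> i v) = \<eta> i v"
    using direct_limit_ex[OF Q(1) tK] by blast
  have 1: "restrict (\<lambda>v. \<Xi> (\<Theta> v)) (carrier K) = restrict (\<lambda>v. v) (carrier K)"
    using \<Theta> \<Xi> cK by (intro direct_limit_uniq[OF K(1) tK] K.nm_mor_comp K.nm_mor_id) auto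
  have 2: "restrict (\<lambda>v. \<Theta> (\<Xi> v)) (carrier Q) = restrict (\<lambda>v. v) (carrier Q)"
    using \<Theta> \<Xi> cQ by (intro direct_limit_uniq[OF Q(2) tQ] Q.nm_mor_comp Q.nm_mor_id) auto
  have "\<Theta> \<in> nm_iso m K Q"
    unfolding nm_iso_def
  proof (intro CollectI conjI bexI[OF _ \<Xi>(1)] ballI \<Theta>(1))
    show "\<Xi> (\<Theta> v) = v" if "v \<in> carrier K" for v using fun_cong[OF 1, of v] that by simp
    show "\<Theta> (\<Xi> v) = v" if "v \<in> carrier Q" for v using fun_cong[OF 2, of v] that by simp
  qed
  with \<Theta>(2) show ?thesis by blast
qed

text \<open>The closure of the union of the images is itself a target, so uniqueness of the factorisation
  forces it to be everything.\<close>

lemma (in nmod_system) limit_dense: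
  fixes L :: "('x, 'l) L0_nmodule"
  assumes L: "direct_limit TYPE('l) m I r M \<phi> L \<kappa>" and w: "w \<in> carrier L"
  shows "\<exists>s. s \<in> UNIV \<rightarrow> (\<Union>i\<in>I. \<kappa> i ` carrier (M i)) \<and> ae_tendsto m L s w"
proof -
  note t = direct_limit_target[OF L]
  interpret L: nmod m L using t normed_module_iff_nmod[OF sigma_finite] by (auto simp: target_def)
  note mor = target_mor[OF t]
  let ?U = "\<Union>i\<in>I. \<kappa> i ` carrier (M i)"
  have UL: "?U \<subseteq> carrier L" using nm_morD(1)[OF mor] by auto
  have Uadd: "u \<oplus>\<^bsub>L\<^esub> v \<in> ?U" if uv: "u \<in> ?U" "v \<in> ?U" for u v
  proof -
    obtain i u' j v' where u: "i \<in> I" "u' \<in> carrier (M i)" "u = \<kappa> i u'" and v: "j \<in> I" "v' \<in> carrier (M j)" "v = \<kappa> j v'"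
      using uv by blast
    obtain k where k: "k \<in> I" "(i, k) \<in> r" "(j, k) \<in> r" using index_ub u v by blast
    interpret Mk: pre_nmod m "M k" by (rule pre_nmod[OF k(1)])
    note c = phi_closed[OF k(2) u(2)] phi_closed[OF k(3) v(2)]
    have "u \<oplus>\<^bsub>L\<^esub> v = \<kappa> k (\<phi> i k u' \<oplus>\<^bsub>M k\<^esub> \<phi> j k v')"
      unfolding nm_morD(2)[OF mor[OF k(1)] c] target_comp[OF t k(2) u(2)] target_comp[OF t k(3) v(2)] u(3) v(3) ..
    then show ?thesis using k(1) Mk.M.a_closed[OF c] by auto
  qed
  have Usmult: "a \<odot>\<^bsub>L\<^esub> u \<in> ?U" if a: "a \<in> carrier (L0 m)" and u: "u \<in> ?U" for a u
  proof -
    obtain i u' where u: "i \<in> I" "u' \<in> carrier (M i)" "u = \<kappa> i u'" using u by blast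
    interpret Mi: pre_nmod m "M i" by (rule pre_nmod[OF u(1)])
    have "a \<odot>\<^bsub>L\<^esub> u = \<kappa> i (a \<odot>\<^bsub>M i\<^esub> u')" unfolding u(3) nm_morD(3)[OF mor[OF u(1)] a u(2)] ..
    then show ?thesis using u(1) Mi.smult_closed[OF a u(2)] by auto
  qed
  define D where "D = {v \<in> carrier L. \<exists>s. s \<in> UNIV \<rightarrow> ?U \<and> ae_tendsto m L s v}"
  have UD: "?U \<subseteq> D"
  proof
    fix u assume u: "u \<in> ?U"
    then have "(\<lambda>_. u) \<in> UNIV \<rightarrow> ?U" by simp
    moreover have uL: "u \<in> carrier L" using u UL by blast
    ultimately show "u \<in> D" using L.ae_tendsto_const[OF uL] uL unfolding D_def by blast
  qed
  have DL: "D \<subseteq> carrier L" by (auto simp: D_def)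
  have Dadd: "u \<oplus>\<^bsub>L\<^esub> v \<in> D" if uv: "u \<in> D" "v \<in> D" for u v
  proof -
    obtain s where s: "s \<in> UNIV \<rightarrow> ?U" "ae_tendsto m L s u" using uv(1) unfolding D_def by blast
    obtain t where t: "t \<in> UNIV \<rightarrow> ?U" "ae_tendsto m L t v" using uv(2) unfolding D_def by blast
    have c: "u \<in> carrier L" "v \<in> carrier L" using uv DL by auto
    have "s \<in> UNIV \<rightarrow> carrier L" "t \<in> UNIV \<rightarrow> carrier L" using s(1) t(1) UL by blast+
    from L.ae_tendsto_add[OF this c s(2) t(2)]
    have "ae_tendsto m L (\<lambda>n. s n \<oplus>\<^bsub>L\<^esub> t n) (u \<oplus>\<^bsub>L\<^esub> v)" .
    moreover have "(\<lambda>n. s n \<oplus>\<^bsub>L\<^esub> t n) \<in> UNIV \<rightarrow> ?U" using Uadd s(1) t(1) by (simp add: Pi_iff)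
    ultimately show ?thesis using c L.M.a_closed[OF c] unfolding D_def by blast
  qed
  have Dsmult: "a \<odot>\<^bsub>L\<^esub> u \<in> D" if a: "a \<in> carrier (L0 m)" and u: "u \<in> D" for a u
  proof -
    obtain s where s: "s \<in> UNIV \<rightarrow> ?U" "ae_tendsto m L s u" using u unfolding D_def by blast
    have c: "u \<in> carrier L" using u DL by auto
    have "s \<in> UNIV \<rightarrow> carrier L" using s(1) UL by blast
    from L.ae_tendsto_smult[OF this c a s(2)]
    have "ae_tendsto m L (\<lambda>n. a \<odot>\<^bsub>L\<^esub> s n) (a \<odot>\<^bsub>L\<^esub> u)" .
    moreover have "(\<lambda>n. a \<odot>\<^bsub>L\<^esub> s n) \<in> UNIV \<rightarrow> ?U" using Usmult[OF a] s(1) by (simp add: Pi_iff)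
    ultimately show ?thesis using L.smult_closed[OF a c] unfolding D_def by blast
  qed
  have Dneg: "\<ominus>\<^bsub>L\<^esub> u \<in> D" if "u \<in> D" for u
    using Dsmult[OF L0_class_carrier[OF borel_measurable_const] that, of "-1"] L.minus_one_smult[of u] that DL by auto
  have Dzero: "\<zero>\<^bsub>L\<^esub> \<in> D"
  proof -
    obtain i where i: "i \<in> I" using directed by (auto simp: directed_poset_def)
    interpret Mi: pre_nmod m "M i" by (rule pre_nmod[OF i])
    have "\<kappa> i \<zero>\<^bsub>M i\<^esub> \<in> D" using UD i by auto
    from Dadd[OF this Dneg[OF this]] show ?thesis using L.M.r_neg[of "\<kappa> i \<zero>\<^bsub>M i\<^esub>"] \<open>\<kappa> i \<zero>\<^bsub>M i\<^esub> \<in> D\<close> DL by auto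
  qed
  let ?L = "L\<lparr>carrier := D\<rparr>"
  have "submodule D (L0 m) L"
    by (rule L.submoduleI) (use DL Dzero Dneg Dadd Dsmult in auto)
  then have md: "module (L0 m) ?L" using L.module_axioms by (rule submodule.submodule_is_module)
  have pn: "pn ?L = pn L" by (simp add: pn_def fun_eq_iff)
  have "pointwise_norm m ?L"
    using subsetD[OF DL] L.pnorm_closed L.pn_nonneg L.pn_add L.pn_smult L.pn_eq_zero_iff
    by (simp add: pointwise_norm_def pn Pi_iff)
  then have "pre_nmod m ?L" using md by (intro pre_nmod.intro pre_nmod_axioms.intro sigma_finite)
  then interpret D: pre_nmod m ?L .
  \<comment> \<open>Negation is defined through the carrier and might change on passing to
    \<open>D\<close>; writing it as multiplication by the class of -1 shows that it does
    not.\<close>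
  have diff: "u \<ominus>\<^bsub>?L\<^esub> v = u \<ominus>\<^bsub>L\<^esub> v" if "u \<in> D" "v \<in> D" for u v
    using D.minus_one_smult[of v] L.minus_one_smult[of v] that DL by (auto simp: a_minus_def)
  have tends: "ae_tendsto m ?L s v \<longleftrightarrow> ae_tendsto m L s v" if "s \<in> UNIV \<rightarrow> D" "v \<in> D" for s v
    unfolding ae_tendsto_def pn using diff that by (simp add: Pi_iff)
  have "ae_complete m ?L"
  \<comment> \<open>Only limits of sequences in \<open>?U\<close> must be found, and these lie in
    \<open>D\<close> by its definition, so closedness of \<open>D\<close> itself need not be shown
    first.\<close>
  proof (rule D.ae_complete_of_dense[of ?U])
    show "?U \<subseteq> carrier ?L" using UD by simp
  next
    fix v assume "v \<in> carrier ?L"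
    then have v: "v \<in> D" by simp
    then obtain s where s: "s \<in> UNIV \<rightarrow> ?U" "ae_tendsto m L s v" unfolding D_def by blast
    moreover have "s \<in> UNIV \<rightarrow> D" using s(1) UD by blast
    ultimately show "\<exists>s. s \<in> UNIV \<rightarrow> ?U \<and> ae_tendsto m ?L s v" using tends[OF _ v] by blast
  next
    fix s assume s: "s \<in> UNIV \<rightarrow> ?U" and C: "ae_Cauchy m ?L s"
    have sD: "s \<in> UNIV \<rightarrow> D" and sL: "s \<in> UNIV \<rightarrow> carrier L" using s UD UL by blast+
    have "ae_Cauchy m L s" using C diff sD unfolding ae_Cauchy_def pn by (simp add: Pi_iff)
    then obtain v where v: "v \<in> carrier L" "ae_tendsto m L s v"
      using L.complete sL unfolding ae_complete_def by blast
    then have "v \<in> D" using s unfolding D_def by blast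
    then show "\<exists>v\<in>carrier ?L. ae_tendsto m ?L s v" using v tends[OF sD] by auto
  qed
  then have "nmod m ?L" using \<open>pre_nmod m ?L\<close> by (intro nmod.intro nmod_axioms.intro)
  then have "normed_module m ?L" using normed_module_iff_nmod[OF sigma_finite] by blast
  moreover have "\<kappa> i \<in> nm_mor m (M i) ?L" if "i \<in> I" for i
  proof -
    have "\<kappa> i \<in> carrier (M i) \<rightarrow> D" using UD that by auto
    then show ?thesis using mor[OF that] by (simp add: nm_mor_def PiE_def pn)
  qed
  ultimately have "target m I r M \<phi> ?L \<kappa>" using t by (auto simp: target_def)
  from direct_limit_ex[OF L this] obtain \<Phi> where
    \<Phi>: "\<Phi> \<in> nm_mor m L ?L" "\<And>i v. i \<in> I \<Longrightarrow> v \<in> carrier (M i) \<Longrightarrow> \<Phi> (\<kappa> i v) = \<kappa> i v" by blast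
  \<comment> \<open>Followed by the inclusion of \<open>D\<close>, the factorisation competes with
    the identity of \<open>L\<close>. Equality of the two places every \<open>w\<close> in
    \<open>D\<close>.\<close>
  have \<Phi>L: "\<Phi> \<in> nm_mor m L L"
    using \<Phi>(1) DL by (auto simp: nm_mor_def PiE_def pn)
  have "\<Phi> = restrict (\<lambda>v. v) (carrier L)"
    using \<Phi>(2) nm_morD(1)[OF mor] by (intro direct_limit_uniq[OF L t \<Phi>L] L.nm_mor_id) auto
  then have "w = \<Phi> w" using w by simp
  then have "w \<in> D" using nm_morD(1)[OF \<Phi>(1) w] by simp
  then show ?thesis by (simp add: D_def)
qed

section \<open>Composition of dominated maps and pullbacks of morphisms\<close>

lemma AE_comp_of_absolutely_continuous:
  assumes "f \<in> mX \<rightarrow>\<^sub>M mY" "absolutely_continuous mY (distr mX mY f)" "AE y in mY. S y"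
  shows "AE x in mX. S (f x)"
  using absolutely_continuous_AE[OF _ assms(2,3)] AE_distrD[OF assms(1)] by simp

lemma dominated_comp:
  assumes T: "dominated_map mX mY f M N T" and S: "dominated_map mY mZ g K M S"
    and AE_comp: "\<And>R. AE y in mY. R y \<Longrightarrow> AE x in mX. R (f x)"
  shows "dominated_map mX mZ (\<lambda>x. g (f x)) K N (\<lambda>v. T (S v))"
proof -
  have "AE x in mX. pn N (T (S v)) x \<le> pn K v (g (f x))" if v: "v \<in> carrier K" for v
    using dominated_mapD(4)[OF T dominated_mapD(1)[OF S v]] AE_comp[OF dominated_mapD(4)[OF S v]]
    by eventually_elim simp
  then show ?thesis
    unfolding dominated_map_def using dominated_mapD(1-3)[OF T] dominated_mapD(1-3)[OF S] by (simp add: Pi_iff)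
qed

context nmod_map begin

lemma dominated_precomp:
  "\<phi> \<in> nm_mor mY M' M \<Longrightarrow> dominated_map mX mY f M N T \<Longrightarrow> dominated_map mX mY f M' N (\<lambda>v. T (\<phi> v))"
  by (drule nm_mor_dominated) (rule dominated_comp[where g = "\<lambda>y. y", OF _ _ AE_comp])

lemma dominated_postcomp:
  "dominated_map mX mY f M N T \<Longrightarrow> \<theta> \<in> nm_mor mX N N' \<Longrightarrow> dominated_map mX mY f M N' (\<lambda>v. \<theta> (T v))"
  by (drule nm_mor_dominated) (rule dominated_comp[where f = "\<lambda>x. x"])

end

text \<open>Both morphisms factor the same dominated map, the composite of \<open>\<theta>\<close>
  with \<open>p\<close>.\<close>

lemma pullback_mor_unique:
  assumes P: "nmod_map mX mY f M P" and N: "nmod_map mX mY f M N" and complete: "ae_complete mX N"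
    and p: "is_pullback mX mY f M P p"
    and \<theta>: "\<theta> \<in> nm_mor mX P N" and \<theta>': "\<theta>' \<in> nm_mor mX P N"
    and eq: "\<And>v. v \<in> carrier M \<Longrightarrow> \<theta> (p v) = \<theta>' (p v)"
  shows "\<theta> = \<theta>'"
proof -
  interpret P: nmod_map mX mY f M P by (rule P)
  have "\<exists>!\<theta>''. \<theta>'' \<in> nm_mor mX P N \<and> (\<forall>v\<in>carrier M. \<theta>'' (p v) = \<theta> (p v))"
    by (rule pullback_universal[OF P N complete p P.dominated_postcomp[OF pullback_dominated[OF p] \<theta>]])
  then show ?thesis using \<theta> \<theta>' eq by (metis (no_types, lifting))
qed

lemma pullback_mor_works:
  assumes P: "nmod_map mX mY f M P" and N: "nmod_map mX mY f N Q" and MQ: "nmod_map mX mY f M Q"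
    and complete: "ae_complete mX Q"
    and p: "is_pullback mX mY f M P p" and q: "is_pullback mX mY f N Q q" and \<phi>: "\<phi> \<in> nm_mor mY M N"
  shows "pullback_mor mX M P p Q q \<phi> \<in> nm_mor mX P Q"
    and "v \<in> carrier M \<Longrightarrow> pullback_mor mX M P p Q q \<phi> (p v) = q (\<phi> v)"
proof -
  interpret N: nmod_map mX mY f N Q by (rule N)
  have "\<exists>!\<theta>. \<theta> \<in> nm_mor mX P Q \<and> (\<forall>v\<in>carrier M. \<theta> (p v) = q (\<phi> v))"
    by (rule pullback_universal[OF P MQ complete p N.dominated_precomp[OF \<phi> pullback_dominated[OF q]]])
  from theI'[OF this] show "pullback_mor mX M P p Q q \<phi> \<in> nm_mor mX P Q"
    "v \<in> carrier M \<Longrightarrow> pullback_mor mX M P p Q q \<phi> (p v) = q (\<phi> v)"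
    by (auto simp: pullback_mor_def)
qed

section \<open>The pulled back system and its direct limit\<close>

locale pullback_system = nmod_system mY I r M \<phi>
  for mX :: "'x measure" and mY :: "'y measure" and f :: "'x \<Rightarrow> 'y"
    and I :: "'i set" and r :: "'i rel"
    and M :: "'i \<Rightarrow> ('y, 'm) L0_nmodule" and \<phi> :: "'i \<Rightarrow> 'i \<Rightarrow> 'm \<Rightarrow> 'm" +
  fixes L :: "('y, 'l) L0_nmodule" and \<kappa> :: "'i \<Rightarrow> 'm \<Rightarrow> 'l"
    and P :: "'i \<Rightarrow> ('x, 'p) L0_nmodule" and p :: "'i \<Rightarrow> 'm \<Rightarrow> 'p"
    and Q :: "('x, 'q) L0_nmodule" and q :: "'l \<Rightarrow> 'q"
  assumes sigma_finite_X: "sigma_finite_measure mX"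
    and AE_comp: "\<And>S. AE y in mY. S y \<Longrightarrow> AE x in mX. S (f x)"
    and limit: "direct_limit TYPE('l) mY I r M \<phi> L \<kappa>"
    and limit': "direct_limit TYPE((nat \<Rightarrow> 'i \<times> 'm) set) mY I r M \<phi> L \<kappa>"
    and pullback: "\<And>i. i \<in> I \<Longrightarrow> is_pullback mX mY f (M i) (P i) (p i)"
    and pullback_limit: "is_pullback mX mY f L Q q"
begin

abbreviation p\<phi> where "p\<phi> \<equiv> \<lambda>i j. pullback_mor mX (M i) (P i) (p i) (P j) (p j) (\<phi> i j)"
abbreviation p\<kappa> where "p\<kappa> \<equiv> \<lambda>i. pullback_mor mX (M i) (P i) (p i) Q q (\<kappa> i)"

lemma nmod_X: "normed_module mX N \<longleftrightarrow> nmod mX N"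
  by (rule normed_module_iff_nmod[OF sigma_finite_X])

lemma nmod_P: "i \<in> I \<Longrightarrow> nmod mX (P i)" and nmod_Q: "nmod mX Q" and nmod_L: "nmod mY L"
proof -
  show "nmod mX (P i)" if "i \<in> I"
    using pullback[OF that] nmod_X[of "P i"] by (simp add: is_pullback_def)
  show "nmod mX Q" using pullback_limit nmod_X[of Q] by (simp add: is_pullback_def)
  show "nmod mY L"
    using direct_limit_target[OF limit] normed_module_iff_nmod[OF sigma_finite, of L] by (simp add: target_def)
qed

lemma map_M: "i \<in> I \<Longrightarrow> nmod mX N \<Longrightarrow> nmod_map mX mY f (M i) N"
  and map_L: "nmod mX N \<Longrightarrow> nmod_map mX mY f L N"
  using pre_nmod nmod_L AE_comp by (auto simp: nmod_def intro!: nmod_map.intro nmod_map_axioms.intro)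

lemma complete_of_nmod: "nmod mX N \<Longrightarrow> ae_complete mX N"
  by (simp add: nmod_def nmod_axioms_def)

lemma kappa_mor: "i \<in> I \<Longrightarrow> \<kappa> i \<in> nm_mor mY (M i) L"
  by (rule target_mor[OF direct_limit_target[OF limit]])

lemma kappa_comp: "(i, j) \<in> r \<Longrightarrow> v \<in> carrier (M i) \<Longrightarrow> \<kappa> j (\<phi> i j v) = \<kappa> i v"
  by (rule target_comp[OF direct_limit_target[OF limit]])

lemma p_closed: "i \<in> I \<Longrightarrow> v \<in> carrier (M i) \<Longrightarrow> p i v \<in> carrier (P i)"
  and pn_p: "i \<in> I \<Longrightarrow> v \<in> carrier (M i) \<Longrightarrow> AE x in mX. pn (P i) (p i v) x = pn (M i) v (f x)"
  using pullback[of i] by (auto simp: is_pullback_def)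

lemma fphi_mor: "(i, j) \<in> r \<Longrightarrow> p\<phi> i j \<in> nm_mor mX (P i) (P j)"
  and fphi_p: "(i, j) \<in> r \<Longrightarrow> v \<in> carrier (M i) \<Longrightarrow> p\<phi> i j (p i v) = p j (\<phi> i j v)"
  using index_mem[of i j] pullback_mor_works[OF map_M map_M map_M complete_of_nmod pullback pullback phi_mor] nmod_P
  by auto

lemma fkappa_mor: "i \<in> I \<Longrightarrow> p\<kappa> i \<in> nm_mor mX (P i) Q"
  and fkappa_p: "i \<in> I \<Longrightarrow> v \<in> carrier (M i) \<Longrightarrow> p\<kappa> i (p i v) = q (\<kappa> i v)"
  using pullback_mor_works[OF map_M map_L map_M complete_of_nmod pullback pullback_limit kappa_mor] nmod_P nmod_Q
  by auto

text \<open>Reduces every identity between morphisms out of \<open>P i\<close> to vectors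
  \<open>p i v\<close>. The laws of a direct system and of a target thus follow from those of the
  original system.\<close>

lemma mor_P_unique:
  assumes i: "i \<in> I" and N: "nmod mX N" and mor: "\<theta> \<in> nm_mor mX (P i) N" "\<theta>' \<in> nm_mor mX (P i) N"
    and eq: "\<And>v. v \<in> carrier (M i) \<Longrightarrow> \<theta> (p i v) = \<theta>' (p i v)"
  shows "\<theta> = \<theta>'"
  by (rule pullback_mor_unique[OF map_M[OF i nmod_P[OF i]] map_M[OF i N] complete_of_nmod[OF N] pullback[OF i] mor eq])

lemma pullback_direct_system: "direct_system mX I r P p\<phi>"
  unfolding direct_system_def
proof (intro conjI ballI allI impI)
  show "normed_module mX (P i)" if "i \<in> I" for i using nmod_P[OF that] nmod_X by blast
  show "case ij of (i, j) \<Rightarrow> p\<phi> i j \<in> nm_mor mX (P i) (P j)" if "ij \<in> r" for ij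
    using that fphi_mor by auto
  show "p\<phi> i i v = v" if i: "i \<in> I" and v: "v \<in> carrier (P i)" for i v
  proof -
    interpret Pi: nmod mX "P i" by (rule nmod_P[OF i])
    have "p\<phi> i i = restrict (\<lambda>v. v) (carrier (P i))"
      using p_closed[OF i] fphi_p[OF index_refl[OF i]] phi_id[OF i]
      by (intro mor_P_unique[OF i nmod_P[OF i] fphi_mor[OF index_refl[OF i]] Pi.nm_mor_id]) auto
    then show ?thesis using v by simp
  qed
  show "p\<phi> i k v = p\<phi> j k (p\<phi> i j v)" if r: "(i, j) \<in> r" "(j, k) \<in> r" and v: "v \<in> carrier (P i)" for i j k v
  proof -
    note i = index_mem[OF r(1)] and k = index_mem(2)[OF r(2)] and ik = index_trans[OF r]
    interpret Pi: nmod mX "P i" by (rule nmod_P[OF i(1)])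
    have "p\<phi> i k = restrict (\<lambda>v. p\<phi> j k (p\<phi> i j v)) (carrier (P i))"
      using p_closed[OF i(1)] fphi_p[OF ik] fphi_p[OF r(1)] fphi_p[OF r(2)] phi_comp[OF r] phi_closed[OF r(1)]
      by (intro mor_P_unique[OF i(1) nmod_P[OF k] fphi_mor[OF ik] Pi.nm_mor_comp[OF fphi_mor[OF r(1)] fphi_mor[OF r(2)]]]) auto
    then show ?thesis using v by simp
  qed
qed

lemma pullback_target: "target mX I r P p\<phi> Q p\<kappa>"
  unfolding target_def
proof (intro conjI ballI)
  show "normed_module mX Q" using nmod_Q nmod_X by blast
  show "p\<kappa> i \<in> nm_mor mX (P i) Q" if "i \<in> I" for i by (rule fkappa_mor[OF that])
  have "p\<kappa> j (p\<phi> i j v) = p\<kappa> i v" if r: "(i, j) \<in> r" and v: "v \<in> carrier (P i)" for i j v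
  proof -
    note i = index_mem[OF r]
    interpret Pi: nmod mX "P i" by (rule nmod_P[OF i(1)])
    have "p\<kappa> i = restrict (\<lambda>v. p\<kappa> j (p\<phi> i j v)) (carrier (P i))"
      using p_closed[OF i(1)] fphi_p[OF r] fkappa_p[OF i(1)] fkappa_p[OF i(2)] kappa_comp[OF r] phi_closed[OF r]
      by (intro mor_P_unique[OF i(1) nmod_Q fkappa_mor[OF i(1)] Pi.nm_mor_comp[OF fphi_mor[OF r] fkappa_mor[OF i(2)]]]) auto
    then show ?thesis using v by simp
  qed
  then show "case ij of (i, j) \<Rightarrow> \<forall>v\<in>carrier (P i). p\<kappa> j (p\<phi> i j v) = p\<kappa> i v" if "ij \<in> r" for ij
    using that by auto
qed

text \<open>The bound for each later index \<open>j\<close> holds off a null set of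
  \<open>mX\<close> that depends on \<open>j\<close>. Passing to the seminorm is legitimate because
  \<open>lim_norm_greatest\<close> combines only countably many of these bounds.\<close>

lemma target_dominated:
  assumes N: "target mX I r P p\<phi> N \<psi>" and i: "i \<in> I" and v: "v \<in> carrier (M i)"
  shows "AE x in mX. pn N (\<psi> i (p i v)) x \<le> pn L (\<kappa> i v) (f x)"
proof -
  have "AE x in mX. pn N (\<psi> i (p i v)) x \<le> lim_norm i v (f x)"
  proof (rule lim_norm_greatest[OF i v])
    fix j assume ij: "(i, j) \<in> r"
    note j = index_mem(2)[OF ij] and jv = phi_closed[OF ij v]
    have "\<psi> i (p i v) = \<psi> j (p j (\<phi> i j v))"
      using target_comp[OF N ij p_closed[OF i v]] fphi_p[OF ij v] by simp
    with nm_morD(4)[OF target_mor[OF N j] p_closed[OF j jv]] pn_p[OF j jv]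
    show "AE x in mX. pn N (\<psi> i (p i v)) x \<le> pn (M j) (\<phi> i j v) (f x)" by (auto elim: eventually_elim2)
  qed
  with AE_comp[OF lim_norm_le_limit[OF limit' i v]] show ?thesis by eventually_elim simp
qed

text \<open>The assignment is again made as a relation, since a vector of \<open>L\<close> may come
  from several indices. Additivity is checked by moving both pairs to a common upper bound, and
  \<open>limit_dense\<close> lets the extension reach all of \<open>L\<close>.\<close>

lemma target_extension:
  assumes N: "target mX I r P p\<phi> N \<psi>"
  shows "\<exists>T. dominated_map mX mY f L N T \<and> (\<forall>i\<in>I. \<forall>v\<in>carrier (M i). T (\<kappa> i v) = \<psi> i (p i v))"
proof -
  have nN: "nmod mX N" using N nmod_X by (auto simp: target_def)
  interpret LN: nmod_map mX mY f L N by (rule map_L[OF nN])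
  let ?G = "\<Union>i\<in>I. (\<lambda>v. (\<kappa> i v, \<psi> i (p i v))) ` carrier (M i)"
  note \<psi> = target_mor[OF N]
  have GI: "(\<kappa> i v, \<psi> i (p i v)) \<in> ?G" if "i \<in> I" "v \<in> carrier (M i)" for i v using that by blast
  have dp: "dominated_map mX mY f (M i) (P i) (p i)" if "i \<in> I" for i by (rule pullback_dominated[OF pullback[OF that]])
  obtain T where T: "dominated_map mX mY f L N T" "\<And>v w. (v, w) \<in> ?G \<Longrightarrow> T v = w"
  proof (rule LN.dominated_extension[of ?G])
    show "ae_complete mX N" by (rule complete_of_nmod[OF nN])
    show "?G \<subseteq> carrier L \<times> carrier N"
      using nm_morD(1)[OF kappa_mor] nm_morD(1)[OF \<psi>] p_closed by auto
    show "AE x in mX. pn N w x \<le> pn L v (f x)" if "(v, w) \<in> ?G" for v w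
      using that target_dominated[OF N] by auto
    show "(v \<oplus>\<^bsub>L\<^esub> v', w \<oplus>\<^bsub>N\<^esub> w') \<in> ?G" if vw: "(v, w) \<in> ?G" "(v', w') \<in> ?G" for v w v' w'
    proof -
      obtain i u j u' where i: "i \<in> I" "u \<in> carrier (M i)" "v = \<kappa> i u" "w = \<psi> i (p i u)"
        and j: "j \<in> I" "u' \<in> carrier (M j)" "v' = \<kappa> j u'" "w' = \<psi> j (p j u')"
        using vw by blast
      obtain k where k: "k \<in> I" "(i, k) \<in> r" "(j, k) \<in> r" using index_ub i j by blast
      interpret Mk: pre_nmod mY "M k" by (rule pre_nmod[OF k(1)])
      let ?u = "\<phi> i k u" and ?u' = "\<phi> j k u'"
      note c = phi_closed[OF k(2) i(2)] phi_closed[OF k(3) j(2)]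
      have push: "\<psi> l (p l t) = \<psi> k (p k (\<phi> l k t))" if l: "(l, k) \<in> r" and t: "t \<in> carrier (M l)" for l t
        using target_comp[OF N l p_closed[OF index_mem(1)[OF l] t]] fphi_p[OF l t] by simp
      have "v \<oplus>\<^bsub>L\<^esub> v' = \<kappa> k (?u \<oplus>\<^bsub>M k\<^esub> ?u')"
        unfolding nm_morD(2)[OF kappa_mor[OF k(1)] c] kappa_comp[OF k(2) i(2)] kappa_comp[OF k(3) j(2)] i(3) j(3) ..
      moreover have "w \<oplus>\<^bsub>N\<^esub> w' = \<psi> k (p k (?u \<oplus>\<^bsub>M k\<^esub> ?u'))"
        unfolding dominated_mapD(2)[OF dp[OF k(1)] c] nm_morD(2)[OF \<psi>[OF k(1)] p_closed[OF k(1) c(1)] p_closed[OF k(1) c(2)]]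
          i(4) j(4) push[OF k(2) i(2)] push[OF k(3) j(2)] ..
      ultimately show ?thesis using GI[OF k(1) Mk.M.a_closed[OF c]] by simp
    qed
    show "(L0_class mY (\<lambda>_. b) \<odot>\<^bsub>L\<^esub> v, L0_class mX (\<lambda>_. b) \<odot>\<^bsub>N\<^esub> w) \<in> ?G" if vw: "(v, w) \<in> ?G" for b v w
    proof -
      obtain i u where i: "i \<in> I" "u \<in> carrier (M i)" "v = \<kappa> i u" "w = \<psi> i (p i u)" using vw by blast
      interpret Mi: pre_nmod mY "M i" by (rule pre_nmod[OF i(1)])
      note b = L0_class_carrier[OF borel_measurable_const]
      have "L0_class mY (\<lambda>_. b) \<odot>\<^bsub>L\<^esub> v = \<kappa> i (L0_class mY (\<lambda>_. b) \<odot>\<^bsub>M i\<^esub> u)"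
        unfolding i(3) nm_morD(3)[OF kappa_mor[OF i(1)] b i(2)] ..
      moreover have "L0_class mX (\<lambda>_. b) \<odot>\<^bsub>N\<^esub> w = \<psi> i (p i (L0_class mY (\<lambda>_. b) \<odot>\<^bsub>M i\<^esub> u))"
        unfolding i(4) dominated_mapD(3)[OF dp[OF i(1)] i(2)] nm_morD(3)[OF \<psi>[OF i(1)] b p_closed[OF i(1,2)]] ..
      ultimately show ?thesis using GI[OF i(1) Mi.smult_closed[OF b i(2)]] by simp
    qed
    show "\<exists>s t. (\<forall>n. (s n, t n) \<in> ?G) \<and> ae_tendsto mY L s v" if v: "v \<in> carrier L" for v
    proof -
      obtain s where s: "s \<in> UNIV \<rightarrow> (\<Union>i\<in>I. \<kappa> i ` carrier (M i))" "ae_tendsto mY L s v" using limit_dense[OF limit v] by blast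
      have "\<forall>n. \<exists>w. (s n, w) \<in> ?G"
      proof
        fix n
        have "s n \<in> (\<Union>i\<in>I. \<kappa> i ` carrier (M i))" by (rule funcset_mem[OF s(1) UNIV_I])
        then show "\<exists>w. (s n, w) \<in> ?G" by fastforce
      qed
      from choice[OF this] s(2) show ?thesis by blast
    qed
  qed (rule that)
  with GI show ?thesis by blast
qed

text \<open>Two extensions in a row give the morphism, first to \<open>L\<close> and then from
  \<open>L\<close> to \<open>Q\<close>. For uniqueness the same steps run backwards: vectors
  \<open>q l\<close> determine a morphism out of \<open>Q\<close>, density reduces \<open>l\<close>
  to the form \<open>\<kappa> i v\<close>, and there \<open>q (\<kappa> i v)\<close> is the value of
  \<open>p\<kappa> i\<close> at \<open>p i v\<close>.\<close>

lemma pullback_direct_limit: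
  fixes N :: "('x, 'n) L0_nmodule"
  assumes N: "target mX I r P p\<phi> N \<psi>"
  shows "\<exists>!\<Phi>. \<Phi> \<in> nm_mor mX Q N \<and> (\<forall>i\<in>I. \<forall>v\<in>carrier (P i). \<Phi> (p\<kappa> i v) = \<psi> i v)"
proof -
  have nN: "nmod mX N" using N nmod_X by (auto simp: target_def)
  note LQ = map_L[OF nmod_Q] and LN = map_L[OF nN]
  interpret LQ: nmod_map mX mY f L Q by (rule LQ)
  interpret LN: nmod_map mX mY f L N by (rule LN)
  obtain T where T: "dominated_map mX mY f L N T" "\<And>i v. i \<in> I \<Longrightarrow> v \<in> carrier (M i) \<Longrightarrow> T (\<kappa> i v) = \<psi> i (p i v)"
    using target_extension[OF N] by blast
  obtain \<Phi> where \<Phi>: "\<Phi> \<in> nm_mor mX Q N" "\<And>v. v \<in> carrier L \<Longrightarrow> \<Phi> (q v) = T v"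
    using pullback_universal[OF LQ LN complete_of_nmod[OF nN] pullback_limit T(1)] by blast
  have cL: "\<kappa> i v \<in> carrier L" if "i \<in> I" "v \<in> carrier (M i)" for i v using nm_morD(1)[OF kappa_mor] that by blast
  have fac: "\<Phi> (p\<kappa> i v) = \<psi> i v" if i: "i \<in> I" and v: "v \<in> carrier (P i)" for i v
  proof -
    interpret Pi: nmod mX "P i" by (rule nmod_P[OF i])
    have "restrict (\<lambda>v. \<Phi> (p\<kappa> i v)) (carrier (P i)) = \<psi> i"
      using p_closed[OF i] fkappa_p[OF i] \<Phi>(2)[OF cL[OF i]] T(2)[OF i]
      by (intro mor_P_unique[OF i nN Pi.nm_mor_comp[OF fkappa_mor[OF i] \<Phi>(1)] target_mor[OF N i]]) auto
    from fun_cong[OF this, of v] v show ?thesis by simp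
  qed
  show ?thesis
  proof (rule ex1I[of _ \<Phi>])
    show "\<Phi> \<in> nm_mor mX Q N \<and> (\<forall>i\<in>I. \<forall>v\<in>carrier (P i). \<Phi> (p\<kappa> i v) = \<psi> i v)" using \<Phi>(1) fac by blast
    fix \<Phi>' assume \<Phi>': "\<Phi>' \<in> nm_mor mX Q N \<and> (\<forall>i\<in>I. \<forall>v\<in>carrier (P i). \<Phi>' (p\<kappa> i v) = \<psi> i v)"
    show "\<Phi>' = \<Phi>"
    proof (rule pullback_mor_unique[OF LQ LN complete_of_nmod[OF nN] pullback_limit _ \<Phi>(1)])
      show \<Phi>'m: "\<Phi>' \<in> nm_mor mX Q N" using \<Phi>' by blast
      fix l assume l: "l \<in> carrier L"
      obtain s where s: "s \<in> UNIV \<rightarrow> (\<Union>i\<in>I. \<kappa> i ` carrier (M i))" "ae_tendsto mY L s l"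
        using limit_dense[OF limit l] by blast
      note dq = pullback_dominated[OF pullback_limit]
      show "\<Phi>' (q l) = \<Phi> (q l)"
      proof (rule LN.dominated_unique[OF LQ.dominated_postcomp[OF dq \<Phi>'m] LQ.dominated_postcomp[OF dq \<Phi>(1)] _ _ s l])
        show "(\<Union>i\<in>I. \<kappa> i ` carrier (M i)) \<subseteq> carrier L" using cL by auto
        fix d assume "d \<in> (\<Union>i\<in>I. \<kappa> i ` carrier (M i))"
        then obtain i v where i: "i \<in> I" "v \<in> carrier (M i)" "d = \<kappa> i v" by blast
        have "\<Phi>' (p\<kappa> i (p i v)) = \<psi> i (p i v)" using \<Phi>' i(1) p_closed[OF i(1,2)] by blast
        with fac[OF i(1) p_closed[OF i(1,2)]] show "\<Phi>' (q d) = \<Phi> (q d)"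
          unfolding i(3) fkappa_p[OF i(1,2)] by simp
      qed
    qed
  qed
qed

end

(* The universal property of L is assumed only for targets with elements in 'l or in
   (nat => 'i * 'm) set; the latter type can hold the classes of Cauchy sequences in the disjoint
   union of the M i. The one of Q is concluded for the arbitrary type 'n. *)
theorem theorem2p12:
  fixes mX :: "'x::polish_space measure" and mY :: "'y::polish_space measure"
    and f :: "'x \<Rightarrow> 'y"
    and I :: "'i set" and r :: "'i rel"
    and M :: "'i \<Rightarrow> ('y, 'm) L0_nmodule" and \<phi> :: "'i \<Rightarrow> 'i \<Rightarrow> 'm \<Rightarrow> 'm"
    and L :: "('y, 'l) L0_nmodule" and \<kappa> :: "'i \<Rightarrow> 'm \<Rightarrow> 'l"
    and P :: "'i \<Rightarrow> ('x, 'p) L0_nmodule" and p :: "'i \<Rightarrow> 'm \<Rightarrow> 'p"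
    and Q :: "('x, 'q) L0_nmodule" and q :: "'l \<Rightarrow> 'q"
  assumes "radon_measure mX" and "radon_measure mY"
    and "f \<in> borel \<rightarrow>\<^sub>M borel" and "absolutely_continuous mY (distr mX mY f)"
    and "directed_poset I r"
    and "direct_system mY I r M \<phi>"
    and "direct_limit TYPE('l) mY I r M \<phi> L \<kappa>"
    and "direct_limit TYPE((nat \<Rightarrow> 'i \<times> 'm) set) mY I r M \<phi> L \<kappa>"
    and "\<forall>i\<in>I. is_pullback mX mY f (M i) (P i) (p i)"
    and "is_pullback mX mY f L Q q"
  defines "f\<phi> \<equiv> \<lambda>i j. pullback_mor mX (M i) (P i) (p i) (P j) (p j) (\<phi> i j)"
    and "f\<kappa> \<equiv> \<lambda>i. pullback_mor mX (M i) (P i) (p i) Q q (\<kappa> i)"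
  shows "direct_system mX I r P f\<phi> \<and>
    direct_limit TYPE('n) mX I r P f\<phi> Q f\<kappa> \<and>
    (\<forall>(K :: ('x, 'k) L0_nmodule) \<eta>.
       direct_limit TYPE('k) mX I r P f\<phi> K \<eta> \<and> direct_limit TYPE('q) mX I r P f\<phi> K \<eta> \<longrightarrow>
       (\<exists>\<Theta>\<in>nm_iso mX K Q. \<forall>i\<in>I. \<forall>v\<in>carrier (P i). \<Theta> (\<eta> i v) = f\<kappa> i v))"
proof -
  have sX: "sigma_finite_measure mX" and sY: "sigma_finite_measure mY"
    using assms(1,2) by (simp_all add: radon_sigma_finite)
  have "sets mX = sets borel" "sets mY = sets borel" using assms(1,2) by (simp_all add: radon_measure_def)
  from measurable_cong_sets[OF this] have fm: "f \<in> mX \<rightarrow>\<^sub>M mY" using assms(3) by simp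
  interpret pullback_system mX mY f I r M \<phi> L \<kappa> P p Q q
  proof (intro pullback_system.intro nmod_system.intro pullback_system_axioms.intro)
    show "AE x in mX. S (f x)" if "AE y in mY. S y" for S
      by (rule AE_comp_of_absolutely_continuous[OF fm assms(4) that])
    show "is_pullback mX mY f (M i) (P i) (p i)" if "i \<in> I" for i using assms(9) that by blast
  qed (fact sX sY assms(5-8) assms(10))+
  have sys: "direct_system mX I r P f\<phi>"
    unfolding f\<phi>_def by (rule pullback_direct_system)
  have "direct_limit TYPE('n) mX I r P f\<phi> Q f\<kappa>"
    unfolding direct_limit_def f\<phi>_def f\<kappa>_def
    by (intro conjI allI impI pullback_target pullback_direct_limit)
  \<comment> \<open>The universal property of \<open>Q\<close> holds at any carrier type; it is
    instantiated again at the two types that the comparison with another limit \<open>K\<close>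
    requires.\<close>
  moreover have Qk: "direct_limit TYPE('k) mX I r P f\<phi> Q f\<kappa>"
    unfolding direct_limit_def f\<phi>_def f\<kappa>_def
    by (intro conjI allI impI pullback_target pullback_direct_limit)
  moreover have Qq: "direct_limit TYPE('q) mX I r P f\<phi> Q f\<kappa>"
    unfolding direct_limit_def f\<phi>_def f\<kappa>_def
    by (intro conjI allI impI pullback_target pullback_direct_limit)
  ultimately show ?thesis
    using sys direct_limit_iso[OF sX _ _ Qk Qq] by blast
qed

end
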